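(* Let $n\ge1$ and let $t_{i,j},s_{i,j}$ ($1\le i<j\le n$), $t_i$ ($1\le i\le n$) be independent variables, abbreviated $\mathbf t$. Consider the factorization, over the field of rational functions in these variables, $$X^{(n)}(-\mathbf t)\,\bar w_0^{(n)}=Y\cdot T\cdot X^{(n)}(\mathbf p)$$ in $SO_{n+1,n}$, with $Y$ lower triangular unipotent, $T$ diagonal, and $\mathbf p=(p_{i,j},q_{i,j},p_i)$ rational functions of $\mathbf t$. With $u_{i,j},r_{i,j}$ as in the context: a) for $1\le i<j\le n$ $$p_{i,j}=r_{i,j}\prod_{k<i}\frac{t_{k,j-1}}{s_{k,j-1}}\prod_{k<i}\frac{s_{k,j}}{t_{k,j}},\qquad q_{i,j}=r_{i,j}\prod_{k<i}\frac{t_{k,j-1}}{s_{k,j-1}}\prod_{k\le i}\frac{s_{k,j}}{t_{k,j}},$$ and for $1\le i\le n$ $$p_i=\frac{u_{i,n}}{t_i\,s_{i,n}}\prod_{k<i}\frac{t_{k,n}}{s_{k,n}};$$ b) $T=e_{n+1,n+1}+\sum_{k=1}^n\big(T_ke_{k,k}+T_k^{-1}e_{\hat k,\hat k}\big)$ with $$T_k=t_k^2\prod_{j<k}\frac{s_{j,k}}{t_{j,k}}\cdot\prod_{j>k}s_{k,j}t_{k,j};$$ c) the map $\mathbf t\mapsto\mathbf p$ preserves the measure: $\prod_{i<j}\frac{dt_{i,j}ds_{i,j}}{t_{i,j}s_{i,j}}\prod_k\frac{dt_k}{t_k}=\prod_{i<j}\frac{dp_{i,j}dq_{i,j}}{p_{i,j}q_{i,j}}\prod_k\frac{dp_k}{p_k}$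 (as measures on the positive orthant).
   Context: Let $e_{a,b}$ be the $(2n+1)\times(2n+1)$ matrix units, $\hat k=2n+2-k$. $SO(n+1,n)$ is the group preserving $\sum_{i=1}^n(x_iy_{\hat i}+x_{\hat i}y_i)+x_{n+1}y_{n+1}$. Chevalley generators: $e_i=e_{i,i+1}-e_{2n+1-i,2n+2-i}$, $f_i=e_{i+1,i}-e_{2n+2-i,2n+1-i}$ for $1\le i\le n-1$; $e_n=\sqrt2(e_{n,n+1}-e_{n+1,n+2})$, $f_n=\sqrt2(e_{n+1,n}-e_{n+2,n+1})$. $X^{(n)}(\mathbf t)=R_nR_{n-1}\cdots R_1$ with $R_n=\exp(t_ne_n)$ and, for $i<n$, $$R_i=\exp(s_{i,i+1}e_i)\exp(s_{i,i+2}e_{i+1})\cdots\exp(s_{i,n}e_{n-1})\exp(t_ie_n)\exp(t_{i,n}e_{n-1})\cdots\exp(t_{i,i+2}e_{i+1})\exp(t_{i,i+1}e_i).$$ $X^{(n)}(\mathbf p)$ is the same product with $p_{i,j},q_{i,j},p_i$ in place of $t_{i,j},s_{i,j},t_i$. $\bar w_0^{(n)}$ is obtained from this product by replacing each factor $\exp(c\,e_j)$ by $\exp(e_j)\exp(-f_j)\exp(e_j)$. Set $s_{j,j}=t_{j,j}=u_{j,j}=1$, and for $1\le i<j\le n$: $u_{i,j}=t_{i,j}+s_{i,j}$, $r_{i,j}=\dfrac{u_{i,j-1}}{u_{i,j}\,s_{i,j-1}}$. *)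

theory Defs
  imports
    "HOL-Analysis.Analysis"
    "HOL-Library.Poly_Mapping"
    "HOL-Library.Countable"
    "HOL-Computational_Algebra.Fraction_Field"
    "Jordan_Normal_Form.Determinant"
begin

section \<open>The variables and the field of rational functions\<close>

text \<open>Names of the variables: \<open>Tv i j\<close>, \<open>Sv i j\<close>, \<open>Dv i\<close> stand for
  $t_{i,j}$, $s_{i,j}$, $t_i$.  The same names index the parameters on the other side of the
  factorization, where they stand for $p_{i,j}$, $q_{i,j}$, $p_i$.\<close>

datatype pvar = Tv nat nat | Sv nat nat | Dv nat

instance pvar :: countable
  by countable_datatype

text \<open>An arbitrary linear order.  Its only purpose is that the library proves polynomial rings to
  be integral domains for linearly ordered sets of variables.\<close>

instantiation pvar :: linorder
begin

definition less_eq_pvar :: "pvar \<Rightarrow> pvar \<Rightarrow> bool" where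
  "less_eq_pvar x y \<longleftrightarrow> to_nat x \<le> to_nat y"

definition less_pvar :: "pvar \<Rightarrow> pvar \<Rightarrow> bool" where
  "less_pvar x y \<longleftrightarrow> to_nat x < to_nat y"

instance
  by standard (auto simp: less_eq_pvar_def less_pvar_def)

end

definition pvars :: "nat \<Rightarrow> pvar set" where
  "pvars n = {Tv i j | i j. 1 \<le> i \<and> i < j \<and> j \<le> n}
           \<union> {Sv i j | i j. 1 \<le> i \<and> i < j \<and> j \<le> n}
           \<union> {Dv i | i. 1 \<le> i \<and> i \<le> n}"

type_synonym rpoly = "(pvar \<Rightarrow>\<^sub>0 nat) \<Rightarrow>\<^sub>0 real"
type_synonym ratfun = "rpoly fract"

definition poly_const :: "real \<Rightarrow> rpoly" where
  "poly_const c = Poly_Mapping.single 0 c"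

definition poly_var :: "pvar \<Rightarrow> rpoly" where
  "poly_var v = Poly_Mapping.single (Poly_Mapping.single v 1) 1"

definition rconst :: "real \<Rightarrow> ratfun" where
  "rconst c = Fraction_Field.Fract (poly_const c) 1"

definition rvar :: "pvar \<Rightarrow> ratfun" where
  "rvar v = Fraction_Field.Fract (poly_var v) 1"

definition poly_vars :: "rpoly \<Rightarrow> pvar set" where
  "poly_vars a = (\<Union>m\<in>Poly_Mapping.keys a. Poly_Mapping.keys m)"

text \<open>The type \<open>ratfun\<close> has variables for all indices; the field of rational functions in the
  variables \<open>\<^bold>t\<close> belonging to \<open>n\<close> is the following subfield.\<close>

definition ratfuns :: "nat \<Rightarrow> ratfun set" where
  "ratfuns n = {Fraction_Field.Fract a b | a b.
      b \<noteq> 0 \<and> poly_vars a \<subseteq> pvars n \<and> poly_vars b \<subseteq> pvars n}"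

definition poly_eval :: "(pvar \<Rightarrow> real) \<Rightarrow> rpoly \<Rightarrow> real" where
  "poly_eval x a = (\<Sum>m\<in>Poly_Mapping.keys a.
      Poly_Mapping.lookup a m * (\<Prod>v\<in>Poly_Mapping.keys m. x v ^ Poly_Mapping.lookup m v))"

definition regular_at :: "(pvar \<Rightarrow> real) \<Rightarrow> ratfun \<Rightarrow> bool" where
  "regular_at x f \<longleftrightarrow> (\<exists>a b. f = Fraction_Field.Fract a b \<and> poly_eval x b \<noteq> 0)"

text \<open>The value at \<open>x\<close> of a rational function that is regular at \<open>x\<close>.\<close>

definition rat_eval :: "(pvar \<Rightarrow> real) \<Rightarrow> ratfun \<Rightarrow> real" where
  "rat_eval x f = (THE y. \<exists>a b. f = Fraction_Field.Fract a b \<and> poly_eval x b \<noteq> 0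
      \<and> y = poly_eval x a / poly_eval x b)"


section \<open>The group \<open>SO(n+1,n)\<close> and its Chevalley generators\<close>

text \<open>Row and column indices run through \<open>1, \<dots>, 2n+1\<close> in the mathematics, but vectors and matrices
  of the library are indexed from \<open>0\<close>.\<close>

abbreviation dimN :: "nat \<Rightarrow> nat" where
  "dimN n \<equiv> 2 * n + 1"

abbreviation hat :: "nat \<Rightarrow> nat \<Rightarrow> nat" where
  "hat n k \<equiv> 2 * n + 2 - k"

definition munit :: "nat \<Rightarrow> nat \<Rightarrow> nat \<Rightarrow> ratfun mat" where
  "munit n a b = mat (dimN n) (dimN n) (\<lambda>(i, j). if i + 1 = a \<and> j + 1 = b then 1 else 0)"

definition mprod :: "nat \<Rightarrow> ratfun mat list \<Rightarrow> ratfun mat" where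
  "mprod n As = foldr (*) As (1\<^sub>m (dimN n))"

definition msum :: "nat \<Rightarrow> ratfun mat list \<Rightarrow> ratfun mat" where
  "msum n As = foldr (+) As (0\<^sub>m (dimN n) (dimN n))"

text \<open>The exponential of a nilpotent matrix: if \<open>A\<close> is nilpotent of size \<open>N\<close>, then $A^N = 0$, so the
  exponential series stops after the terms with exponent \<open>< N\<close>.\<close>

definition mexp :: "nat \<Rightarrow> ratfun mat \<Rightarrow> ratfun mat" where
  "mexp n A = msum n (map (\<lambda>k. inverse (of_nat (fact k)) \<cdot>\<^sub>m (A ^\<^sub>m k)) [0..<dimN n])"

definition bform :: "nat \<Rightarrow> ratfun vec \<Rightarrow> ratfun vec \<Rightarrow> ratfun" where
  "bform n x y = (\<Sum>i=1..n. x $ (i - 1) * y $ (hat n i - 1) + x $ (hat n i - 1) * y $ (i - 1))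
      + x $ n * y $ n"

definition SO_mats :: "nat \<Rightarrow> ratfun mat set" where
  "SO_mats n = {A \<in> carrier_mat (dimN n) (dimN n). Determinant.det A = 1 \<and>
      (\<forall>x\<in>carrier_vec (dimN n). \<forall>y\<in>carrier_vec (dimN n).
         bform n (A *\<^sub>v x) (A *\<^sub>v y) = bform n x y)}"

definition egen :: "nat \<Rightarrow> nat \<Rightarrow> ratfun mat" where
  "egen n i = (if i < n
     then munit n i (i + 1) - munit n (2 * n + 1 - i) (2 * n + 2 - i)
     else rconst (sqrt 2) \<cdot>\<^sub>m (munit n n (n + 1) - munit n (n + 1) (n + 2)))"

definition fgen :: "nat \<Rightarrow> nat \<Rightarrow> ratfun mat" where
  "fgen n i = (if i < n
     then munit n (i + 1) i - munit n (2 * n + 2 - i) (2 * n + 1 - i)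
     else rconst (sqrt 2) \<cdot>\<^sub>m (munit n (n + 1) n - munit n (n + 2) (n + 1)))"


section \<open>The products \<open>X\<close> and \<open>w\<^sub>0\<close>\<close>

text \<open>\<open>Rword n \<phi> i\<close> and \<open>Xword n \<phi>\<close> are the products $R_i$ and $R_n \cdots R_1$ in which the factor
  with parameter \<open>v\<close> and generator $e_j$ is \<open>\<phi> v j\<close>.\<close>

definition Rword :: "nat \<Rightarrow> (pvar \<Rightarrow> nat \<Rightarrow> ratfun mat) \<Rightarrow> nat \<Rightarrow> ratfun mat" where
  "Rword n \<phi> i = mprod n
     (map (\<lambda>j. \<phi> (Sv i j) (j - 1)) [i+1..<n+1]
      @ [\<phi> (Dv i) n]
      @ map (\<lambda>j. \<phi> (Tv i j) (j - 1)) (rev [i+1..<n+1]))"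

definition Xword :: "nat \<Rightarrow> (pvar \<Rightarrow> nat \<Rightarrow> ratfun mat) \<Rightarrow> ratfun mat" where
  "Xword n \<phi> = mprod n (map (Rword n \<phi>) (rev [1..<n+1]))"

definition Xmat :: "nat \<Rightarrow> (pvar \<Rightarrow> ratfun) \<Rightarrow> ratfun mat" where
  "Xmat n c = Xword n (\<lambda>v j. mexp n (c v \<cdot>\<^sub>m egen n j))"

definition w0bar :: "nat \<Rightarrow> ratfun mat" where
  "w0bar n = Xword n (\<lambda>v j. mexp n (egen n j) * mexp n (- fgen n j) * mexp n (egen n j))"

definition lower_unipotent :: "nat \<Rightarrow> ratfun mat \<Rightarrow> bool" where
  "lower_unipotent n Y \<longleftrightarrow> Y \<in> carrier_mat (dimN n) (dimN n) \<and>
     (\<forall>i<dimN n. Y $$ (i, i) = 1) \<and> (\<forall>i<dimN n. \<forall>j<dimN n. i < j \<longrightarrow> Y $$ (i, j) = 0)"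

definition is_factorization ::
    "nat \<Rightarrow> ratfun mat \<Rightarrow> ratfun mat \<Rightarrow> (pvar \<Rightarrow> ratfun) \<Rightarrow> bool" where
  "is_factorization n Y T p \<longleftrightarrow>
     Y \<in> SO_mats n \<and> elements_mat Y \<subseteq> ratfuns n \<and> lower_unipotent n Y \<and>
     T \<in> SO_mats n \<and> elements_mat T \<subseteq> ratfuns n \<and> diagonal_mat T \<and>
     p ` pvars n \<subseteq> ratfuns n \<and>
     Xmat n (\<lambda>v. - rvar v) * w0bar n = Y * T * Xmat n p"


section \<open>The quantities occurring in the formulas\<close>

definition tvar :: "nat \<Rightarrow> nat \<Rightarrow> ratfun" where
  "tvar i j = (if i = j then 1 else rvar (Tv i j))"

definition svar :: "nat \<Rightarrow> nat \<Rightarrow> ratfun" where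
  "svar i j = (if i = j then 1 else rvar (Sv i j))"

definition uvar :: "nat \<Rightarrow> nat \<Rightarrow> ratfun" where
  "uvar i j = (if i = j then 1 else tvar i j + svar i j)"

definition rquot :: "nat \<Rightarrow> nat \<Rightarrow> ratfun" where
  "rquot i j = uvar i (j - 1) / (uvar i j * svar i (j - 1))"

abbreviation dvar :: "nat \<Rightarrow> ratfun" where
  "dvar i \<equiv> rvar (Dv i)"

definition Tcoeff :: "nat \<Rightarrow> nat \<Rightarrow> ratfun" where
  "Tcoeff n k = (dvar k)^2 * (\<Prod>j\<in>{1..<k}. svar j k / tvar j k)
      * (\<Prod>j\<in>{k<..n}. svar k j * tvar k j)"


section \<open>The measure on the positive orthant and the map \<open>\<^bold>t \<mapsto> \<^bold>p\<close>\<close>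

text \<open>The measure \<open>dx/x\<close> on the positive half-line.\<close>

definition log_measure :: "real measure" where
  "log_measure = density (restrict_space lborel {0<..}) (\<lambda>x. ennreal (1 / x))"

text \<open>Its underlying space is the positive orthant, realised as the set of functions in
  \<open>pvars n \<rightarrow>\<^sub>E {0<..}\<close>.\<close>

definition orthant_measure :: "nat \<Rightarrow> (pvar \<Rightarrow> real) measure" where
  "orthant_measure n = Pi\<^sub>M (pvars n) (\<lambda>_. log_measure)"

definition rat_map :: "nat \<Rightarrow> (pvar \<Rightarrow> ratfun) \<Rightarrow> (pvar \<Rightarrow> real) \<Rightarrow> (pvar \<Rightarrow> real)" where
  "rat_map n p x = (\<lambda>v\<in>pvars n. rat_eval x (p v))"

end

theory Submission
  imports Defs
begin

text \<open>
  Write $X^{(n)} = X' R_1$ with $X' = R_n \cdots R_2$, and $\bar w_0^{(n)} = w' \bar r_1$ accordingly.  All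
  entries of $R_1$ have a closed form, and comparing rows gives
  $R_1(-\mathbf t)\, \bar w_0^{(n)} = Z\, w' D\, R_1(\mathbf p)$, where $D$ is the torus element with entries
  $s_{1,k}/t_{1,k}$ and the middle block of $Z$ is the identity.  As $X'$ normalises the matrices of the
  shape of $Z$, the factorization for $X'$ yields the one for $X^{(n)}$; moving $D$ past $X'(\mathbf p)$
  rescales the parameters, which produces the products over $k < i$.

  Conversely the Gauss decomposition determines $X^{(n)}(\mathbf p)$, whose first row is that of $R_1$ and
  determines the parameters of $R_1$.

  For the measure, $q_{i,j}/p_{i,j} = s_{i,j}/t_{i,j}$, and $p_{i,j} t_{i,j}$ and $p_i t_i$ depend on these
  ratios only.  In the coordinates $t_{i,j}$, $t_i$, $s_{i,j}/t_{i,j}$ the map thus inverts some of the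
  coordinates up to factors that depend on the other ones, so it is an involution preserving the measure.
\<close>

subsection \<open>Evaluation of rational functions\<close>

text \<open>The groups for smaller n never appear as matrices of smaller size. The tail R_n ... R_i
  is a matrix of size 2n+1 that is the identity outside the rows and columns i, ..., 2n+2-i, and the
  induction descends from i = n+1 to i = 1. Hence the intermediate formulas carry a lower bound i
  for the products over k.

  The closed form exists because the parameters telescope. Entries of R_i contain long products of
  parameters, and the quotients u_{i,j-1}/u_{i,j} make every such product a quotient of two terms.
  Off the diagonal all entries of R_i(-t) and R_i(p) are then monomials in s, t, u, t_i, and each
  row identity reduces to a cancellation.

  Orthogonality does two further jobs. It makes the adjoint an inverse, so factors can be moved
  across an equation. It also recovers the half of the diagonal of Y that the induction leaves open:
  for a lower triangular orthogonal matrix opposite diagonal entries multiply to 1.\<close>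

definition mono_eval :: "(pvar \<Rightarrow> real) \<Rightarrow> (pvar \<Rightarrow>\<^sub>0 nat) \<Rightarrow> real" where
  "mono_eval x m = (\<Prod>v\<in>Poly_Mapping.keys m. x v ^ Poly_Mapping.lookup m v)"

lemma mono_eval_superset:
  assumes "finite V" "Poly_Mapping.keys m \<subseteq> V"
  shows "mono_eval x m = (\<Prod>v\<in>V. x v ^ Poly_Mapping.lookup m v)"
  unfolding mono_eval_def
  by (rule prod.mono_neutral_left) (use assms in \<open>auto simp: in_keys_iff\<close>)

lemma mono_eval_zero [simp]: "mono_eval x 0 = 1"
  by (simp add: mono_eval_def)

lemma mono_eval_add: "mono_eval x (m + m') = mono_eval x m * mono_eval x m'"
proof -
  let ?V = "Poly_Mapping.keys m \<union> Poly_Mapping.keys m'"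
  have "mono_eval x (m + m') = (\<Prod>v\<in>?V. x v ^ Poly_Mapping.lookup (m + m') v)"
    by (rule mono_eval_superset) (auto simp: keys_add)
  also have "\<dots> = mono_eval x m * mono_eval x m'"
    by (simp add: mono_eval_superset[of ?V] lookup_add power_add prod.distrib)
  finally show ?thesis .
qed

lemma poly_eval_superset:
  assumes "finite M" "Poly_Mapping.keys a \<subseteq> M"
  shows "poly_eval x a = (\<Sum>m\<in>M. Poly_Mapping.lookup a m * mono_eval x m)"
  unfolding poly_eval_def mono_eval_def
  by (rule sum.mono_neutral_left) (use assms in \<open>auto simp: in_keys_iff\<close>)

lemma poly_eval_zero [simp]: "poly_eval x 0 = 0"
  by (simp add: poly_eval_def)

lemma poly_eval_single: "poly_eval x (Poly_Mapping.single m c) = c * mono_eval x m"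
  by (subst poly_eval_superset[of "{m}"]) auto

lemma poly_eval_one [simp]: "poly_eval x 1 = 1"
  using poly_eval_single[of x 0 1] by simp

lemma poly_eval_add: "poly_eval x (a + b) = poly_eval x a + poly_eval x b"
proof -
  let ?M = "Poly_Mapping.keys a \<union> Poly_Mapping.keys b"
  have "poly_eval x (a + b) = (\<Sum>m\<in>?M. Poly_Mapping.lookup (a + b) m * mono_eval x m)"
    by (rule poly_eval_superset) (auto simp: keys_add)
  also have "\<dots> = poly_eval x a + poly_eval x b"
    by (simp add: poly_eval_superset[of ?M] lookup_add distrib_right sum.distrib)
  finally show ?thesis .
qed

lemma poly_eval_sum: "poly_eval x (sum f A) = (\<Sum>i\<in>A. poly_eval x (f i))"
  by (induction A rule: infinite_finite_induct) (auto simp: poly_eval_add)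

text \<open>Splitting both factors into monomials reduces multiplicativity of evaluation to the
  product of two monomials, by bilinearity.\<close>

lemma sum_single_lookup:
  "(\<Sum>m\<in>Poly_Mapping.keys a. Poly_Mapping.single m (Poly_Mapping.lookup a m)) = a"
  by (rule poly_mapping_eqI) (auto simp: lookup_sum lookup_single when_def in_keys_iff sum.delta)

lemma poly_eval_mult: "poly_eval x (a * b) = poly_eval x a * poly_eval x b"
proof -
  have "poly_eval x (a * b) = poly_eval x
     ((\<Sum>m\<in>Poly_Mapping.keys a. Poly_Mapping.single m (Poly_Mapping.lookup a m)) *
      (\<Sum>m\<in>Poly_Mapping.keys b. Poly_Mapping.single m (Poly_Mapping.lookup b m)))"
    by (simp only: sum_single_lookup)
  also have "\<dots> = (\<Sum>m\<in>Poly_Mapping.keys a. \<Sum>m'\<in>Poly_Mapping.keys b.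
      (Poly_Mapping.lookup a m * mono_eval x m) * (Poly_Mapping.lookup b m' * mono_eval x m'))"
    by (simp add: sum_product poly_eval_sum mult_single poly_eval_single mono_eval_add algebra_simps)
  also have "\<dots> = poly_eval x a * poly_eval x b"
    by (simp add: sum_product poly_eval_def mono_eval_def)
  finally show ?thesis .
qed

lemma poly_eval_var [simp]: "poly_eval x (poly_var v) = x v"
  by (simp add: poly_var_def poly_eval_single mono_eval_def)

text \<open>A relation in place of the definite description in \<open>rat_eval\<close>: it carries
  regularity together with the value, so both pass through the field operations at once.\<close>

definition evaluates :: "(pvar \<Rightarrow> real) \<Rightarrow> ratfun \<Rightarrow> real \<Rightarrow> bool" where
  "evaluates x f y \<longleftrightarrow> (\<exists>a b. f = Fraction_Field.Fract a b \<and> poly_eval x b \<noteq> 0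
      \<and> y = poly_eval x a / poly_eval x b)"

text \<open>Two representing fractions satisfy a d = c b as polynomials, because a denominator with
  nonzero value is a nonzero polynomial. Evaluating this identity makes the two quotients
  equal.\<close>

lemma evaluates_unique:
  assumes "evaluates x f y" "evaluates x f z"
  shows "y = z"
proof -
  obtain a b c d where *: "f = Fraction_Field.Fract a b" "poly_eval x b \<noteq> 0"
      "y = poly_eval x a / poly_eval x b" "f = Fraction_Field.Fract c d"
      "poly_eval x d \<noteq> 0" "z = poly_eval x c / poly_eval x d"
    using assms unfolding evaluates_def by blast
  then have "b \<noteq> 0" "d \<noteq> 0" by auto
  with * have "a * d = c * b" by (simp add: eq_fract)
  then have "poly_eval x a * poly_eval x d = poly_eval x c * poly_eval x b"
    by (metis poly_eval_mult)
  then show ?thesis using *(2,5) unfolding *(3,6) by (simp add: field_simps)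
qed

lemma evaluates_regular_at: "evaluates x f y \<Longrightarrow> regular_at x f"
  by (auto simp: evaluates_def regular_at_def)

lemma evaluates_rat_eval: "evaluates x f y \<Longrightarrow> rat_eval x f = y"
  unfolding rat_eval_def evaluates_def[symmetric]
  by (rule the_equality) (auto intro: evaluates_unique)

lemma evaluates_rvar: "evaluates x (rvar v) (x v)"
  unfolding evaluates_def rvar_def by (intro exI[of _ "poly_var v"] exI[of _ 1]) simp

lemma evaluates_one: "evaluates x 1 1"
  unfolding evaluates_def One_fract_def by (intro exI[of _ 1]) simp

lemma evaluates_add:
  assumes "evaluates x f y" "evaluates x g z"
  shows "evaluates x (f + g) (y + z)"
proof -
  obtain a b c d where *: "f = Fraction_Field.Fract a b" "poly_eval x b \<noteq> 0"
      "y = poly_eval x a / poly_eval x b" "g = Fraction_Field.Fract c d"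
      "poly_eval x d \<noteq> 0" "z = poly_eval x c / poly_eval x d"
    using assms unfolding evaluates_def by blast
  then have "b \<noteq> 0" "d \<noteq> 0" by auto
  with * have "f + g = Fraction_Field.Fract (a * d + c * b) (b * d)" by simp
  with * show ?thesis unfolding evaluates_def
    by (intro exI[of _ "a * d + c * b"] exI[of _ "b * d"])
       (simp add: poly_eval_add poly_eval_mult field_simps)
qed

lemma evaluates_mult:
  assumes "evaluates x f y" "evaluates x g z"
  shows "evaluates x (f * g) (y * z)"
proof -
  obtain a b c d where *: "f = Fraction_Field.Fract a b" "poly_eval x b \<noteq> 0"
      "y = poly_eval x a / poly_eval x b" "g = Fraction_Field.Fract c d"
      "poly_eval x d \<noteq> 0" "z = poly_eval x c / poly_eval x d"
    using assms unfolding evaluates_def by blast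
  then show ?thesis unfolding evaluates_def
    by (intro exI[of _ "a * c"] exI[of _ "b * d"]) (simp add: poly_eval_mult)
qed

lemma evaluates_inverse:
  assumes "evaluates x f y" "y \<noteq> 0"
  shows "evaluates x (inverse f) (inverse y)"
proof -
  obtain a b where *: "f = Fraction_Field.Fract a b" "poly_eval x b \<noteq> 0"
      "y = poly_eval x a / poly_eval x b"
    using assms unfolding evaluates_def by blast
  with assms show ?thesis unfolding evaluates_def
    by (intro exI[of _ b] exI[of _ a]) auto
qed

lemma evaluates_divide:
  assumes "evaluates x f y" "evaluates x g z" "z \<noteq> 0"
  shows "evaluates x (f / g) (y / z)"
  unfolding divide_inverse by (intro evaluates_mult evaluates_inverse assms)

lemma evaluates_prod:
  assumes "\<And>i. i \<in> A \<Longrightarrow> evaluates x (f i) (y i)"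
  shows "evaluates x (prod f A) (prod y A)"
  using assms
  by (induction A rule: infinite_finite_induct) (auto intro: evaluates_mult evaluates_one)

subsection \<open>The subfield of rational functions in the given variables\<close>

lemma poly_vars_add: "poly_vars (a + b) \<subseteq> poly_vars a \<union> poly_vars b"
  using keys_add[of a b] by (auto simp: poly_vars_def)

lemma poly_vars_mult: "poly_vars (a * b) \<subseteq> poly_vars a \<union> poly_vars b"
proof
  fix v assume "v \<in> poly_vars (a * b)"
  then obtain m where m: "m \<in> Poly_Mapping.keys (a * b)" "v \<in> Poly_Mapping.keys m"
    by (auto simp: poly_vars_def)
  then obtain k l where "m = k + l" "k \<in> Poly_Mapping.keys a" "l \<in> Poly_Mapping.keys b"
    using keys_mult[of a b] by blast
  with m show "v \<in> poly_vars a \<union> poly_vars b"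
    using keys_add[of k l] by (auto simp: poly_vars_def)
qed

lemma poly_vars_uminus: "poly_vars (- a) = poly_vars a"
proof -
  have "Poly_Mapping.keys (- a) = Poly_Mapping.keys a" by (auto simp: in_keys_iff)
  then show ?thesis by (simp add: poly_vars_def)
qed

lemma poly_vars_const [simp]: "poly_vars (poly_const c) = {}"
  by (simp add: poly_vars_def poly_const_def)

lemma poly_vars_one [simp]: "poly_vars 1 = {}"
  by (simp add: poly_vars_def)

lemma poly_vars_var [simp]: "poly_vars (poly_var v) = {v}"
  by (simp add: poly_vars_def poly_var_def)

lemma ratfunsI:
  "b \<noteq> 0 \<Longrightarrow> poly_vars a \<subseteq> pvars n \<Longrightarrow> poly_vars b \<subseteq> pvars n \<Longrightarrow> Fraction_Field.Fract a b \<in> ratfuns n"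
  by (auto simp: ratfuns_def)

lemma ratfuns_rconst: "rconst c \<in> ratfuns n"
  unfolding rconst_def by (rule ratfunsI) auto

lemma ratfuns_rvar: "v \<in> pvars n \<Longrightarrow> rvar v \<in> ratfuns n"
  unfolding rvar_def by (rule ratfunsI) auto

lemma ratfuns_cases:
  assumes "f \<in> ratfuns n"
  obtains a b where "f = Fraction_Field.Fract a b" "b \<noteq> 0"
    "poly_vars a \<subseteq> pvars n" "poly_vars b \<subseteq> pvars n"
  using assms unfolding ratfuns_def by blast

lemma poly_vars_mult_subset: "poly_vars a \<subseteq> V \<Longrightarrow> poly_vars b \<subseteq> V \<Longrightarrow> poly_vars (a * b) \<subseteq> V"
  using poly_vars_mult by blast

lemma ratfuns_add:
  assumes "f \<in> ratfuns n" "g \<in> ratfuns n"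
  shows "f + g \<in> ratfuns n"
proof -
  obtain a b where f: "f = Fraction_Field.Fract a b" "b \<noteq> 0"
      "poly_vars a \<subseteq> pvars n" "poly_vars b \<subseteq> pvars n"
    using assms(1) by (rule ratfuns_cases)
  obtain c d where g: "g = Fraction_Field.Fract c d" "d \<noteq> 0"
      "poly_vars c \<subseteq> pvars n" "poly_vars d \<subseteq> pvars n"
    using assms(2) by (rule ratfuns_cases)
  have "f + g = Fraction_Field.Fract (a * d + c * b) (b * d)"
    using f(1,2) g(1,2) by simp
  moreover have "poly_vars (a * d + c * b) \<subseteq> pvars n"
    by (rule order.trans[OF poly_vars_add]) (simp add: poly_vars_mult_subset f g)
  ultimately show ?thesis
    using f(2) g(2) by (simp add: ratfunsI poly_vars_mult_subset f(4) g(4))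
qed

lemma ratfuns_mult:
  assumes "f \<in> ratfuns n" "g \<in> ratfuns n"
  shows "f * g \<in> ratfuns n"
proof -
  obtain a b where f: "f = Fraction_Field.Fract a b" "b \<noteq> 0"
      "poly_vars a \<subseteq> pvars n" "poly_vars b \<subseteq> pvars n"
    using assms(1) by (rule ratfuns_cases)
  obtain c d where g: "g = Fraction_Field.Fract c d" "d \<noteq> 0"
      "poly_vars c \<subseteq> pvars n" "poly_vars d \<subseteq> pvars n"
    using assms(2) by (rule ratfuns_cases)
  show ?thesis
    using f(2) g(2) by (simp add: f(1) g(1) ratfunsI poly_vars_mult_subset f(3,4) g(3,4))
qed

lemma ratfuns_uminus: "f \<in> ratfuns n \<Longrightarrow> - f \<in> ratfuns n"
  by (erule ratfuns_cases) (simp add: ratfunsI poly_vars_uminus)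

lemma ratfuns_zero: "0 \<in> ratfuns n"
  unfolding Zero_fract_def by (rule ratfunsI) (auto simp: poly_vars_def)

lemma ratfuns_one: "1 \<in> ratfuns n"
  unfolding One_fract_def by (rule ratfunsI) auto

lemma ratfuns_inverse: 
  assumes "f \<in> ratfuns n" shows "inverse f \<in> ratfuns n"
proof (cases "f = 0")
  case True
  then show ?thesis by (simp add: ratfuns_zero)
next
  case False
  with assms obtain a b where *: "f = Fraction_Field.Fract a b" "b \<noteq> 0"
      "poly_vars a \<subseteq> pvars n" "poly_vars b \<subseteq> pvars n"
    by (auto simp: ratfuns_def)
  with False have "a \<noteq> 0" by (auto simp: fract_collapse)
  with * show ?thesis by (auto intro: ratfunsI)
qed

lemma ratfuns_divide: "f \<in> ratfuns n \<Longrightarrow> g \<in> ratfuns n \<Longrightarrow> f / g \<in> ratfuns n"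
  by (simp add: divide_inverse ratfuns_mult ratfuns_inverse)

lemma ratfuns_sum: "(\<And>i. i \<in> A \<Longrightarrow> f i \<in> ratfuns n) \<Longrightarrow> sum f A \<in> ratfuns n"
  by (induction A rule: infinite_finite_induct) (auto intro: ratfuns_add ratfuns_zero)

lemma ratfuns_prod: "(\<And>i. i \<in> A \<Longrightarrow> f i \<in> ratfuns n) \<Longrightarrow> prod f A \<in> ratfuns n"
  by (induction A rule: infinite_finite_induct) (auto intro: ratfuns_mult ratfuns_one)

lemma rconst_mult: "rconst a * rconst b = rconst (a * b)"
  by (simp add: rconst_def poly_const_def mult_single)

lemma poly_const_numeral: "poly_const (numeral k) = numeral k"
  by (simp add: poly_const_def)

lemma fract_of_numeral: "Fraction_Field.Fract (numeral k) 1 = (numeral k :: ratfun)"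
  using Fract_of_nat_eq[of "numeral k", where 'a = rpoly] by (simp only: of_nat_numeral)

lemma rconst_numeral: "rconst (numeral k) = numeral k"
  by (simp only: rconst_def poly_const_numeral fract_of_numeral)

lemma fract_eq_zero_iff: "Fraction_Field.Fract a 1 = 0 \<longleftrightarrow> (a :: rpoly) = 0"
  unfolding Zero_fract_def by (simp add: eq_fract(1))

text \<open>A polynomial with a nonzero value at some point is nonzero; evaluation at one point
  settles this claim as well as \<open>rvar_nonzero\<close> and
  \<open>rvar_add_nonzero\<close>.\<close>

lemma two_neq_zero_ratfun: "(2::ratfun) \<noteq> 0"
proof -
  have "(2 :: rpoly) \<noteq> 0"
  proof
    assume "(2 :: rpoly) = 0"
    then have "poly_eval (\<lambda>_. 0) (1 + 1) = 0" by simp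
    then show False unfolding poly_eval_add by simp
  qed
  then show ?thesis
    by (simp only: fract_of_numeral[symmetric] fract_eq_zero_iff not_False_eq_True)
qed

lemma rvar_nonzero: "rvar v \<noteq> 0"
proof
  assume "rvar v = 0"
  then have "poly_var v = 0" by (simp add: rvar_def fract_eq_zero_iff)
  with poly_eval_var[of "\<lambda>_. 1" v] show False by simp
qed

lemma rvar_add_nonzero: "rvar v + rvar w \<noteq> 0"
proof
  assume "rvar v + rvar w = 0"
  then have "poly_var v + poly_var w = 0" by (simp add: rvar_def fract_eq_zero_iff)
  moreover have "poly_eval (\<lambda>_. 1) (poly_var v + poly_var w) = 2" by (simp add: poly_eval_add)
  ultimately show False by simp
qed

subsection \<open>Matrix entries with indices from 1\<close>

definition ent :: "ratfun mat \<Rightarrow> nat \<Rightarrow> nat \<Rightarrow> ratfun" where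
  "ent A r c = A $$ (r - 1, c - 1)"

definition emat :: "nat \<Rightarrow> (nat \<Rightarrow> nat \<Rightarrow> ratfun) \<Rightarrow> ratfun mat" where
  "emat n f = mat (dimN n) (dimN n) (\<lambda>(i, j). f (i + 1) (j + 1))"

definition Mats :: "nat \<Rightarrow> ratfun mat set" where
  "Mats n = carrier_mat (dimN n) (dimN n)"

definition idm :: "nat \<Rightarrow> ratfun mat" where
  "idm n = 1\<^sub>m (dimN n)"

definition Idx :: "nat \<Rightarrow> nat set" where
  "Idx n = {1..2 * n + 1}"

lemma mem_Idx [simp]: "m \<in> Idx n \<longleftrightarrow> 1 \<le> m \<and> m \<le> 2 * n + 1"
  by (simp add: Idx_def)

lemma finite_Idx [simp]: "finite (Idx n)"
  by (simp add: Idx_def)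

lemma MatsD: "A \<in> Mats n \<Longrightarrow> A \<in> carrier_mat (dimN n) (dimN n)"
  by (simp add: Mats_def)

lemma idm_Mats [simp]: "idm n \<in> Mats n"
  by (simp add: Mats_def idm_def)

lemma Mats_mult [simp]: "A \<in> Mats n \<Longrightarrow> B \<in> Mats n \<Longrightarrow> A * B \<in> Mats n"
  unfolding Mats_def by (rule mult_carrier_mat)

lemma Mats_add [simp]: "A \<in> Mats n \<Longrightarrow> B \<in> Mats n \<Longrightarrow> A + B \<in> Mats n"
  unfolding Mats_def by simp

lemma Mats_diff [simp]: "A \<in> Mats n \<Longrightarrow> B \<in> Mats n \<Longrightarrow> A - B \<in> Mats n"
  unfolding Mats_def by (simp add: minus_carrier_mat)

lemma Mats_smult [simp]: "A \<in> Mats n \<Longrightarrow> a \<cdot>\<^sub>m A \<in> Mats n"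
  unfolding Mats_def by simp

lemma Mats_zero [simp]: "0\<^sub>m (dimN n) (dimN n) \<in> Mats n"
  unfolding Mats_def by simp

lemma Mats_zero' [simp]: "0\<^sub>m (Suc (2 * n)) (Suc (2 * n)) \<in> Mats n"
  using Mats_zero[of n] by simp

lemma Mats_pow [simp]: "A \<in> Mats n \<Longrightarrow> A ^\<^sub>m k \<in> Mats n"
  unfolding Mats_def by (rule pow_carrier_mat)

lemma Mats_assoc: "A \<in> Mats n \<Longrightarrow> B \<in> Mats n \<Longrightarrow> C \<in> Mats n \<Longrightarrow> A * B * C = A * (B * C)"
  unfolding Mats_def by (rule assoc_mult_mat)

lemma Mats_one_mult [simp]: "A \<in> Mats n \<Longrightarrow> idm n * A = A" "A \<in> Mats n \<Longrightarrow> A * idm n = A"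
  unfolding Mats_def idm_def by auto

lemma Mats_distrib:
  assumes "A \<in> Mats n" "B \<in> Mats n" "C \<in> Mats n"
  shows "A * (B + C) = A * B + A * C" "A * (B - C) = A * B - A * C"
    "A * (a \<cdot>\<^sub>m B) = a \<cdot>\<^sub>m (A * B)"
  using assms unfolding Mats_def
  by (simp_all add: mult_add_distrib_mat[of _ _ "dimN n" _ "dimN n"]
      mult_minus_distrib_mat[of _ _ "dimN n" _ "dimN n"] mult_smult_distrib[of _ _ "dimN n" _ "dimN n"])

lemma emat_Mats [simp]: "emat n f \<in> Mats n"
  by (simp add: emat_def Mats_def)

lemma ent_emat [simp]: "r \<in> Idx n \<Longrightarrow> c \<in> Idx n \<Longrightarrow> ent (emat n f) r c = f r c"
  by (auto simp: ent_def emat_def)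

lemma mat_eqI_ent:
  assumes "A \<in> Mats n" "B \<in> Mats n"
    and "\<And>r c. r \<in> Idx n \<Longrightarrow> c \<in> Idx n \<Longrightarrow> ent A r c = ent B r c"
  shows "A = B"
proof (rule eq_matI)
  fix i j assume "i < dim_row B" "j < dim_col B"
  then show "A $$ (i, j) = B $$ (i, j)"
    using assms(3)[of "i + 1" "j + 1"] assms(1,2) by (auto simp: ent_def Mats_def)
qed (use assms in \<open>auto simp: Mats_def\<close>)

lemma ent_add: "A \<in> Mats n \<Longrightarrow> B \<in> Mats n \<Longrightarrow> r \<in> Idx n \<Longrightarrow> c \<in> Idx n \<Longrightarrow>
    ent (A + B) r c = ent A r c + ent B r c"
  by (auto simp: ent_def Mats_def)

lemma ent_smult: "A \<in> Mats n \<Longrightarrow> r \<in> Idx n \<Longrightarrow> c \<in> Idx n \<Longrightarrow> ent (a \<cdot>\<^sub>m A) r c = a * ent A r c"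
  by (auto simp: ent_def Mats_def)

lemma ent_idm: "r \<in> Idx n \<Longrightarrow> c \<in> Idx n \<Longrightarrow> ent (idm n) r c = (if r = c then 1 else 0)"
  by (auto simp: ent_def idm_def)

lemma ent_mult:
  assumes "A \<in> Mats n" "B \<in> Mats n" "r \<in> Idx n" "c \<in> Idx n"
  shows "ent (A * B) r c = (\<Sum>m\<in>Idx n. ent A r m * ent B m c)"
proof -
  have "ent (A * B) r c = (\<Sum>k<dimN n. A $$ (r - 1, k) * B $$ (k, c - 1))"
    using assms by (auto simp: Mats_def ent_def scalar_prod_def atLeast0LessThan)
  also have "\<dots> = (\<Sum>m\<in>Idx n. ent A r m * ent B m c)"
    using sum.atLeast1_atMost_eq[of "\<lambda>m. ent A r m * ent B m c" "2 * n + 1"]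
    by (simp add: ent_def Idx_def)
  finally show ?thesis .
qed

lemma munit_Mats [simp]: "munit n a b \<in> Mats n"
  by (simp add: munit_def Mats_def)

lemma ent_munit:
  "r \<in> Idx n \<Longrightarrow> c \<in> Idx n \<Longrightarrow> ent (munit n a b) r c = (if r = a \<and> c = b then 1 else 0)"
  by (auto simp: ent_def munit_def)

lemma ent_mult_munit:
  assumes "A \<in> Mats n" "a \<in> Idx n" "r \<in> Idx n" "c \<in> Idx n"
  shows "ent (A * munit n a b) r c = (if c = b then ent A r a else 0)"
proof -
  have "ent (A * munit n a b) r c = (\<Sum>m\<in>Idx n. if m = a then if c = b then ent A r a else 0 else 0)"
    unfolding ent_mult[OF assms(1) munit_Mats assms(3,4)]
    by (rule sum.cong[OF refl]) (use assms in \<open>simp add: ent_munit\<close>)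
  also have "\<dots> = (if c = b then ent A r a else 0)" using assms by (simp only: sum.delta finite_Idx if_True)
  finally show ?thesis .
qed

lemma ent_diff: "A \<in> Mats n \<Longrightarrow> B \<in> Mats n \<Longrightarrow> r \<in> Idx n \<Longrightarrow> c \<in> Idx n \<Longrightarrow>
    ent (A - B) r c = ent A r c - ent B r c"
  by (auto simp: ent_def Mats_def)

subsection \<open>Products and exponentials\<close>

lemma mprod_Nil [simp]: "mprod n [] = idm n"
  by (simp add: mprod_def idm_def)

lemma mprod_Cons [simp]: "mprod n (A # As) = A * mprod n As"
  by (simp add: mprod_def)

lemma mprod_Mats [simp]: "set As \<subseteq> Mats n \<Longrightarrow> mprod n As \<in> Mats n"
  by (induction As) auto

lemma mprod_append:
  "set As \<subseteq> Mats n \<Longrightarrow> set Bs \<subseteq> Mats n \<Longrightarrow> mprod n (As @ Bs) = mprod n As * mprod n Bs"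
  by (induction As) (auto simp: Mats_assoc)

lemma ent_msum:
  assumes "set As \<subseteq> Mats n" "r \<in> Idx n" "c \<in> Idx n"
  shows "msum n As \<in> Mats n \<and> ent (msum n As) r c = (\<Sum>A\<leftarrow>As. ent A r c)"
  using assms by (induction As) (auto simp: msum_def ent_add[of _ n] ent_def[of "0\<^sub>m _ _"])

lemma msum_Mats: "set As \<subseteq> Mats n \<Longrightarrow> msum n As \<in> Mats n"
  by (induction As) (auto simp: msum_def)

lemma mexp_Mats [simp]: "X \<in> Mats n \<Longrightarrow> mexp n X \<in> Mats n"
  unfolding mexp_def by (rule msum_Mats) auto

text \<open>All Chevalley generators satisfy X^3 = 0. With \<open>n \<ge> 1\<close> the truncated
  series has at least three terms, so the square is not cut off.\<close>

lemma mexp_cube_zero: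
  assumes X: "X \<in> Mats n" and "X * X * X = 0\<^sub>m (dimN n) (dimN n)" and "n \<ge> 1"
  shows "mexp n X = idm n + X + inverse 2 \<cdot>\<^sub>m (X * X)"
proof (rule mat_eqI_ent[of _ n])
  fix r c assume rc: "r \<in> Idx n" "c \<in> Idx n"
  have pow: "X ^\<^sub>m k = 0\<^sub>m (dimN n) (dimN n)" if "k \<ge> 3" for k
    using that
  proof (induction k rule: dec_induct)
    case base
    then show ?case using assms by (simp add: numeral_3_eq_3 Mats_def)
  next
    case (step k)
    then show ?case using X by (simp add: Mats_def)
  qed
  have pow0: "X ^\<^sub>m 0 = idm n" and pow1: "X ^\<^sub>m Suc 0 = X" and pow2: "X ^\<^sub>m Suc (Suc 0) = X * X"
    using X by (auto simp: Mats_def idm_def)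
  note pow_mat.simps [simp del]
  let ?f = "\<lambda>k. inverse (of_nat (fact k)) * ent (X ^\<^sub>m k) r c"
  have "ent (mexp n X) r c = sum_list (map ?f [0..<dimN n])"
    unfolding mexp_def using X rc
    by (subst ent_msum[THEN conjunct2]) (auto simp del: mem_Idx simp: o_def ent_smult[of _ n] intro!: arg_cong[of _ _ sum_list])
  also have "\<dots> = sum ?f {..<dimN n}"
    by (simp only: interv_sum_list_conv_sum_set_nat atLeast_upt[symmetric] set_upt atLeast0LessThan)
  also have "\<dots> = sum ?f {..<3}"
    by (rule sum.mono_neutral_right) (use \<open>n \<ge> 1\<close> rc in \<open>auto simp: pow ent_def\<close>)
  also have "\<dots> = ent (idm n + X + inverse 2 \<cdot>\<^sub>m (X * X)) r c"
    using X rc by (simp add: eval_nat_numeral ent_add[of _ n] ent_smult[of _ n] idm_def[symmetric] pow0 pow1 pow2)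
  finally show "ent (mexp n X) r c = ent (idm n + X + inverse 2 \<cdot>\<^sub>m (X * X)) r c" .
qed (use X in auto)

text \<open>Right multiplication by \<open>X\<close> is abstracted to an operation \<phi> on rows,
  which turns exponentials into computations with functions of the column. A row is a function on
  all natural numbers but is meaningful only on \<open>Idx n\<close>; \<open>cong\<close> lets
  \<phi> be iterated in spite of that, and \<open>nil\<close> yields X^3 = 0.\<close>

lemma ent_mult_mexp:
  assumes A: "A \<in> Mats n" and X: "X \<in> Mats n" and n: "n \<ge> 1"
    and act: "\<And>A r c. A \<in> Mats n \<Longrightarrow> r \<in> Idx n \<Longrightarrow> c \<in> Idx n \<Longrightarrow> ent (A * X) r c = \<phi> (ent A r) c"
    and cong: "\<And>g h c. (\<And>m. m \<in> Idx n \<Longrightarrow> g m = h m) \<Longrightarrow> c \<in> Idx n \<Longrightarrow> \<phi> g c = \<phi> h c"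
    and nil: "\<And>g c. c \<in> Idx n \<Longrightarrow> \<phi> (\<phi> (\<phi> g)) c = 0"
    and rc: "r \<in> Idx n" "c \<in> Idx n"
  shows "ent (A * mexp n X) r c = ent A r c + \<phi> (ent A r) c + inverse 2 * \<phi> (\<phi> (ent A r)) c"
proof -
  have act2: "ent (A * X * X) r c = \<phi> (\<phi> (ent A r)) c"
    if "A \<in> Mats n" "r \<in> Idx n" "c \<in> Idx n" for A r c
    using that X by (simp add: act del: mem_Idx) (rule cong, simp_all add: act del: mem_Idx)
  have act3: "ent (A * X * X * X) r c = \<phi> (\<phi> (\<phi> (ent A r))) c"
    if "A \<in> Mats n" "r \<in> Idx n" "c \<in> Idx n" for A r c
    using that X by (simp add: act del: mem_Idx) (rule cong, simp_all add: act2 del: mem_Idx)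
  \<comment> \<open>Three applications of the row operation to the identity matrix give the rows of
    X^3 itself.\<close>
  have "X * X * X = 0\<^sub>m (dimN n) (dimN n)"
  proof (rule mat_eqI_ent[of _ n])
    fix r c assume "r \<in> Idx n" "c \<in> Idx n"
    then show "ent (X * X * X) r c = ent (0\<^sub>m (dimN n) (dimN n)) r c"
      using act3[of "idm n" r c] nil X by (auto simp: ent_def)
  qed (use X in auto)
  then have "A * mexp n X = A + A * X + inverse 2 \<cdot>\<^sub>m (A * X * X)"
    using A X n by (simp add: mexp_cube_zero Mats_distrib[of _ n] Mats_assoc)
  then have "ent (A * mexp n X) r c = ent A r c + ent (A * X) r c + inverse 2 * ent (A * X * X) r c"
    using A X rc by (simp only: ent_add[of _ n] ent_smult[of _ n] Mats_add Mats_mult Mats_smult)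
  then show ?thesis
    unfolding act[OF A rc] act2[OF A rc] .
qed

section \<open>Right multiplication by the generators and their exponentials\<close>

abbreviation sqrt2 :: ratfun where
  "sqrt2 \<equiv> rconst (sqrt 2)"

lemma sqrt2_mult: "sqrt2 * sqrt2 = 2" "sqrt2 * (sqrt2 * a) = 2 * a"
proof -
  show "sqrt2 * sqrt2 = 2" by (simp add: rconst_mult rconst_numeral)
  then show "sqrt2 * (sqrt2 * a) = 2 * a" by (simp add: mult.assoc[symmetric])
qed

lemma egen_Mats [simp]: "egen n j \<in> Mats n"
  by (simp add: egen_def)

lemma fgen_Mats [simp]: "fgen n j \<in> Mats n"
  by (simp add: fgen_def)

text \<open>The row \<open>g\<close> multiplied from the right by \<open>a\<close> times e_j;
  \<open>fgact\<close> is the counterpart for f_j. At most two entries of the result are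
  nonzero.\<close>

definition egact :: "nat \<Rightarrow> nat \<Rightarrow> ratfun \<Rightarrow> (nat \<Rightarrow> ratfun) \<Rightarrow> nat \<Rightarrow> ratfun" where
  "egact n j a g c = (if j < n
     then if c = j + 1 then a * g j else if c = 2 * n + 2 - j then - a * g (2 * n + 1 - j) else 0
     else if c = n + 1 then sqrt2 * a * g n else if c = n + 2 then - sqrt2 * a * g (n + 1) else 0)"

definition fgact :: "nat \<Rightarrow> nat \<Rightarrow> ratfun \<Rightarrow> (nat \<Rightarrow> ratfun) \<Rightarrow> nat \<Rightarrow> ratfun" where
  "fgact n j a g c = (if j < n
     then if c = j then a * g (j + 1) else if c = 2 * n + 1 - j then - a * g (2 * n + 2 - j) else 0
     else if c = n then sqrt2 * a * g (n + 1) else if c = n + 1 then - sqrt2 * a * g (n + 2) else 0)"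

lemma ent_mult_egen:
  assumes A: "A \<in> Mats n" and j: "1 \<le> j" "j \<le> n" and rc: "r \<in> Idx n" "c \<in> Idx n"
  shows "ent (A * (a \<cdot>\<^sub>m egen n j)) r c = egact n j a (ent A r) c"
proof -
  have I: "j \<in> Idx n" "j + 1 \<in> Idx n" "2 * n + 1 - j \<in> Idx n" "2 * n + 2 - j \<in> Idx n"
      "n \<in> Idx n" "n + 1 \<in> Idx n" "n + 2 \<in> Idx n"
    using j by auto
  show ?thesis
  proof (cases "j < n")
    case True
    then have "j + 1 \<noteq> 2 * n + 2 - j" "j \<noteq> 2 * n + 1 - j" by auto
    then show ?thesis using True A rc I
      by (simp add: egact_def egen_def Mats_distrib[of _ n] ent_smult[of _ n] ent_diff[of _ n]
          ent_mult_munit del: mem_Idx)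
  next
    case False
    then show ?thesis using A rc I
      by (simp add: egact_def egen_def Mats_distrib[of _ n] ent_smult[of _ n] ent_diff[of _ n]
          ent_mult_munit del: mem_Idx)
  qed
qed

lemma ent_mult_fgen:
  assumes A: "A \<in> Mats n" and j: "1 \<le> j" "j \<le> n" and rc: "r \<in> Idx n" "c \<in> Idx n"
  shows "ent (A * (a \<cdot>\<^sub>m fgen n j)) r c = fgact n j a (ent A r) c"
proof -
  have I: "j \<in> Idx n" "j + 1 \<in> Idx n" "2 * n + 1 - j \<in> Idx n" "2 * n + 2 - j \<in> Idx n"
      "n \<in> Idx n" "n + 1 \<in> Idx n" "n + 2 \<in> Idx n"
    using j by auto
  show ?thesis
  proof (cases "j < n")
    case True
    then have "j + 1 \<noteq> 2 * n + 2 - j" "j \<noteq> 2 * n + 1 - j" by auto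
    then show ?thesis using True A rc I
      by (simp add: fgact_def fgen_def Mats_distrib[of _ n] ent_smult[of _ n] ent_diff[of _ n]
          ent_mult_munit del: mem_Idx)
  next
    case False
    then show ?thesis using A rc I
      by (simp add: fgact_def fgen_def Mats_distrib[of _ n] ent_smult[of _ n] ent_diff[of _ n]
          ent_mult_munit del: mem_Idx)
  qed
qed

lemma egact_cong:
  assumes "1 \<le> j" "j \<le> n" "\<And>m. m \<in> Idx n \<Longrightarrow> g m = h m"
  shows "egact n j a g c = egact n j a h c"
proof -
  have "g m = h m" if "m \<in> {j, j + 1, 2 * n + 1 - j, 2 * n + 2 - j, n, n + 1, n + 2}" for m
    using that assms(1,2) by (intro assms(3)) auto
  then show ?thesis by (simp add: egact_def)
qed

lemma egact_nilpotent:
  assumes "1 \<le> j" "j \<le> n"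
  shows "egact n j a (egact n j a (egact n j a g)) c = 0"
proof (cases "j < n")
  case True
  then have "j + 1 \<noteq> 2 * n + 2 - j" "j \<noteq> 2 * n + 1 - j" "2 * n + 1 - j \<noteq> 2 * n + 2 - j"
      "j + 1 \<noteq> 2 * n + 1 - j" "j \<noteq> 2 * n + 2 - j"
    by auto
  with True show ?thesis by (simp add: egact_def)
qed (simp add: egact_def)

lemma fgact_cong:
  assumes "1 \<le> j" "j \<le> n" "\<And>m. m \<in> Idx n \<Longrightarrow> g m = h m"
  shows "fgact n j a g c = fgact n j a h c"
proof -
  have "g m = h m" if "m \<in> {j, j + 1, 2 * n + 1 - j, 2 * n + 2 - j, n, n + 1, n + 2}" for m
    using that assms(1,2) by (intro assms(3)) auto
  then show ?thesis by (simp add: fgact_def)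
qed

lemma fgact_nilpotent:
  assumes "1 \<le> j" "j \<le> n"
  shows "fgact n j a (fgact n j a (fgact n j a g)) c = 0"
proof (cases "j < n")
  case True
  then have "j + 1 \<noteq> 2 * n + 2 - j" "j \<noteq> 2 * n + 1 - j" "2 * n + 1 - j \<noteq> 2 * n + 2 - j"
      "j + 1 \<noteq> 2 * n + 1 - j" "j \<noteq> 2 * n + 2 - j"
    by auto
  with True show ?thesis by (simp add: fgact_def)
qed (simp add: fgact_def)

text \<open>The row \<open>g\<close> times exp(a e_j), and in \<open>yop\<close> times exp(a f_j).
  For \<open>j < n\<close> the generator squares to zero. For \<open>j = n\<close> half the square
  contributes: the two factors sqrt 2 cancel the 1/2 and leave the coefficient -a^2.\<close>

definition xop :: "nat \<Rightarrow> nat \<Rightarrow> ratfun \<Rightarrow> (nat \<Rightarrow> ratfun) \<Rightarrow> nat \<Rightarrow> ratfun" where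
  "xop n j a g c = (if j < n
     then if c = j + 1 then g (j + 1) + a * g j
       else if c = 2 * n + 2 - j then g (2 * n + 2 - j) - a * g (2 * n + 1 - j) else g c
     else if c = n + 1 then g (n + 1) + sqrt2 * a * g n
       else if c = n + 2 then g (n + 2) - sqrt2 * a * g (n + 1) - a\<^sup>2 * g n else g c)"

definition yop :: "nat \<Rightarrow> nat \<Rightarrow> ratfun \<Rightarrow> (nat \<Rightarrow> ratfun) \<Rightarrow> nat \<Rightarrow> ratfun" where
  "yop n j a g c = (if j < n
     then if c = j then g j + a * g (j + 1)
       else if c = 2 * n + 1 - j then g (2 * n + 1 - j) - a * g (2 * n + 2 - j) else g c
     else if c = n then g n + sqrt2 * a * g (n + 1) - a\<^sup>2 * g (n + 2)
       else if c = n + 1 then g (n + 1) - sqrt2 * a * g (n + 2) else g c)"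

lemma half_sqrt2: "inverse 2 * (- sqrt2 * a * (sqrt2 * a * x)) = - (a\<^sup>2 * x)"
proof -
  have "inverse 2 * (- sqrt2 * a * (sqrt2 * a * x)) = - ((inverse 2 * (sqrt2 * sqrt2)) * (a * a * x))"
    by (simp only: mult_minus_left mult_minus_right mult_ac)
  also have "inverse 2 * (sqrt2 * sqrt2) = 1"
    unfolding sqrt2_mult using two_neq_zero_ratfun by (rule left_inverse)
  finally show ?thesis by (simp only: power2_eq_square mult_1_left)
qed

lemma half_sqrt2': "inverse 2 * (sqrt2 * a * (- sqrt2 * a * x)) = - (a\<^sup>2 * x)"
  using half_sqrt2[of a x] by (simp only: mult_minus_left mult_minus_right mult_ac)

lemma ent_mult_xmat:
  assumes A: "A \<in> Mats n" and j: "1 \<le> j" "j \<le> n" and rc: "r \<in> Idx n" "c \<in> Idx n"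
  shows "ent (A * mexp n (a \<cdot>\<^sub>m egen n j)) r c = xop n j a (ent A r) c"
proof -
  have "ent (A * mexp n (a \<cdot>\<^sub>m egen n j)) r c
      = ent A r c + egact n j a (ent A r) c + inverse 2 * egact n j a (egact n j a (ent A r)) c"
  proof (rule ent_mult_mexp)
    show "egact n j a g c = egact n j a h c" if "\<And>m. m \<in> Idx n \<Longrightarrow> g m = h m" for g h c
      using j that by (rule egact_cong)
  qed (use j in \<open>simp_all add: A rc ent_mult_egen egact_nilpotent del: mem_Idx\<close>)
  also have "\<dots> = xop n j a (ent A r) c"
  proof (cases "j < n")
    case True
    then have "egact n j a (egact n j a (ent A r)) c = 0"
      using j by (auto simp: egact_def)
    moreover have "ent A r c + egact n j a (ent A r) c = xop n j a (ent A r) c"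
      using True by (simp add: egact_def xop_def)
    ultimately show ?thesis by (simp only: mult_zero_right add_0_right)
  next
    case False
    have "inverse 2 * egact n j a (egact n j a (ent A r)) c
        = (if c = n + 2 then - (a\<^sup>2 * ent A r (n)) else 0)"
    proof (cases "c = n + 2")
      case True
      then show ?thesis using \<open>\<not> j < n\<close> half_sqrt2[of a "ent A r (n)"] half_sqrt2'[of a "ent A r (n)"]
        by (simp add: egact_def)
    next
      case False
      then show ?thesis using \<open>\<not> j < n\<close> by (simp add: egact_def)
    qed
    moreover have "ent A r c + egact n j a (ent A r) c + (if c = n + 2 then - (a\<^sup>2 * ent A r (n)) else 0)
        = xop n j a (ent A r) c"
      using False by (simp add: egact_def xop_def)
    ultimately show ?thesis by (simp only:)
  qed
  finally show ?thesis .
qed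

lemma ent_mult_ymat:
  assumes A: "A \<in> Mats n" and j: "1 \<le> j" "j \<le> n" and rc: "r \<in> Idx n" "c \<in> Idx n"
  shows "ent (A * mexp n (a \<cdot>\<^sub>m fgen n j)) r c = yop n j a (ent A r) c"
proof -
  have "ent (A * mexp n (a \<cdot>\<^sub>m fgen n j)) r c
      = ent A r c + fgact n j a (ent A r) c + inverse 2 * fgact n j a (fgact n j a (ent A r)) c"
  proof (rule ent_mult_mexp)
    show "fgact n j a g c = fgact n j a h c" if "\<And>m. m \<in> Idx n \<Longrightarrow> g m = h m" for g h c
      using j that by (rule fgact_cong)
  qed (use j in \<open>simp_all add: A rc ent_mult_fgen fgact_nilpotent del: mem_Idx\<close>)
  also have "\<dots> = yop n j a (ent A r) c"
  proof (cases "j < n")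
    case True
    then have "fgact n j a (fgact n j a (ent A r)) c = 0"
      using j by (auto simp: fgact_def)
    moreover have "ent A r c + fgact n j a (ent A r) c = yop n j a (ent A r) c"
      using True by (simp add: fgact_def yop_def)
    ultimately show ?thesis by (simp only: mult_zero_right add_0_right)
  next
    case False
    have "inverse 2 * fgact n j a (fgact n j a (ent A r)) c
        = (if c = n then - (a\<^sup>2 * ent A r (n + 2)) else 0)"
    proof (cases "c = n")
      case True
      then show ?thesis using \<open>\<not> j < n\<close> half_sqrt2[of a "ent A r (n + 2)"] half_sqrt2'[of a "ent A r (n + 2)"]
        by (simp add: fgact_def)
    next
      case False
      then show ?thesis using \<open>\<not> j < n\<close> by (simp add: fgact_def)
    qed
    moreover have "ent A r c + fgact n j a (ent A r) c + (if c = n then - (a\<^sup>2 * ent A r (n + 2)) else 0)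
        = yop n j a (ent A r) c"
      using False by (simp add: fgact_def yop_def)
    ultimately show ?thesis by (simp only:)
  qed
  finally show ?thesis .
qed

subsection \<open>Closed form of the factors\<close>

lemma xop_cong:
  assumes "1 \<le> j" "j \<le> n" "c \<in> Idx n" "\<And>m. m \<in> Idx n \<Longrightarrow> g m = h m"
  shows "xop n j a g c = xop n j a h c"
proof -
  have "g m = h m" if "m \<in> {j, j + 1, 2 * n + 1 - j, 2 * n + 2 - j, n, n + 1, n + 2, c}" for m
    using that assms(1-3) by (intro assms(4)) auto
  then show ?thesis by (simp add: xop_def)
qed

text \<open>\<open>Sform n i a s\<close> is the product of the first factors of $R_i$, up to the one with parameter
  $s_{i,a}$.\<close>

definition Sform :: "nat \<Rightarrow> nat \<Rightarrow> nat \<Rightarrow> (nat \<Rightarrow> ratfun) \<Rightarrow> nat \<Rightarrow> nat \<Rightarrow> ratfun" where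
  "Sform n i a s r c =
    (if r = c then 1
     else if i \<le> r \<and> r < c \<and> c \<le> a then \<Prod>l\<in>{r<..c}. s l
     else if c = r + 1 \<and> 2 * n + 2 - a \<le> r \<and> c \<le> 2 * n + 2 - i then - s (2 * n + 2 - r)
     else 0)"

lemma prod_greaterThanAtMost_Suc:
  "r \<le> a \<Longrightarrow> (\<Prod>l\<in>{r<..Suc a}. f l) = (\<Prod>l\<in>{r<..a}. f l) * (f (Suc a) :: ratfun)"
proof -
  assume "r \<le> a"
  then have "{r<..Suc a} = insert (Suc a) {r<..a}" by auto
  then show ?thesis by (simp add: mult.commute)
qed

lemma xop_Sform:
  assumes "1 \<le> i" "i \<le> a" "a < n"
  shows "xop n a (s (a + 1)) (Sform n i a s r) c = Sform n i (a + 1) s r c"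
proof -
  consider "c = a + 1" | "c = 2 * n + 2 - a" | "c \<noteq> a + 1" "c \<noteq> 2 * n + 2 - a" by blast
  then show ?thesis
  proof cases
    case 1
    then show ?thesis using assms
      by (auto simp: xop_def Sform_def prod_greaterThanAtMost_Suc)
  next
    case 2
    then have "c \<noteq> a + 1" "\<not> c \<le> a + 1" "2 * n + 1 - a = c - 1" using assms by auto
    then show ?thesis using assms 2
      by (auto simp: xop_def Sform_def)
  next
    case 3
    then show ?thesis using assms
      by (auto simp: xop_def Sform_def)
  qed
qed

lemma ent_sprod:
  assumes "1 \<le> i" "i \<le> a" "a \<le> n" "r \<in> Idx n" "c \<in> Idx n"
  shows "ent (mprod n (map (\<lambda>j. mexp n (s j \<cdot>\<^sub>m egen n (j - 1))) [i + 1..<a + 1])) r c = Sform n i a s r c"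
  using assms(2,3,5)
proof (induction a arbitrary: c rule: dec_induct)
  case base
  then show ?case using assms by (auto simp: ent_idm Sform_def)
next
  case (step a)
  let ?P = "mprod n (map (\<lambda>j. mexp n (s j \<cdot>\<^sub>m egen n (j - 1))) [i + 1..<a + 1])"
  have "mprod n (map (\<lambda>j. mexp n (s j \<cdot>\<^sub>m egen n (j - 1))) [i + 1..<Suc a + 1])
      = ?P * mexp n (s (a + 1) \<cdot>\<^sub>m egen n a)"
  proof -
    have "[i + 1..<Suc a + 1] = [i + 1..<a + 1] @ [a + 1]"
      using step.hyps upt_Suc_append[of "i + 1" "a + 1"] by simp
    then show ?thesis by (simp only: map_append, subst mprod_append) auto
  qed
  moreover have "ent (?P * mexp n (s (a + 1) \<cdot>\<^sub>m egen n a)) r c = xop n a (s (a + 1)) (ent ?P r) c"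
    using step assms by (intro ent_mult_xmat mprod_Mats) auto
  moreover have "\<dots> = xop n a (s (a + 1)) (Sform n i a s r) c"
    by (rule xop_cong) (use step assms in auto)
  ultimately show ?case
    using xop_Sform[of i a n s r c] step assms by simp
qed

text \<open>\<open>Rform n i a s d t\<close> is the product of the factors of $R_i$ up to the one with parameter $t_{i,a}$;
  thus \<open>a = n + 1\<close> means that no $t_{i,j}$ occurs yet, and \<open>a = i + 1\<close> gives the whole of $R_i$.\<close>

definition Rform :: "nat \<Rightarrow> nat \<Rightarrow> nat \<Rightarrow> (nat \<Rightarrow> ratfun) \<Rightarrow> ratfun \<Rightarrow> (nat \<Rightarrow> ratfun)
    \<Rightarrow> nat \<Rightarrow> nat \<Rightarrow> ratfun" where
  "Rform n i a s d t r c =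
    (if r = c then 1
     else if r < i \<or> c \<le> r \<or> 2 * n + 2 - i < c then 0
     else if c \<le> n then (\<Prod>l\<in>{r<..<c}. s l) * (s c + (if a \<le> c then t c else 0))
     else if c = n + 1 then sqrt2 * d * (\<Prod>l\<in>{r<..n}. s l)
     else if r \<le> n then if a + c \<le> 2 * n + 3
       then - (d\<^sup>2) * (\<Prod>l\<in>{r<..n}. s l) * (\<Prod>l\<in>{2 * n + 2 - c<..n}. - t l) else 0
     else if r = n + 1 then if a + c \<le> 2 * n + 3
       then - sqrt2 * d * (\<Prod>l\<in>{2 * n + 2 - c<..n}. - t l) else 0
     else if a + c \<le> 2 * n + 3 \<or> c = r + 1
       then - (s (2 * n + 2 - r) + (if a + r \<le> 2 * n + 2 then t (2 * n + 2 - r) else 0))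
              * (\<Prod>l\<in>{2 * n + 2 - c<..<2 * n + 2 - r}. - t l)
     else 0)"

lemma xop_Sform_Rform:
  assumes "1 \<le> i" "i \<le> n"
  shows "xop n n d (Sform n i n s r) c = Rform n i (n + 1) s d t r c"
proof -
  have *: "{r<..<Suc x} = {r<..x}" for x by auto
  have **: "{Suc (2 * n) - q<..<Suc (Suc (2 * n)) - q} = {}" for q by auto
  have ***: "(\<Prod>l\<in>{r<..<c}. s l) * s c = (\<Prod>l\<in>{r<..c}. s l)" if "r < c" for c
    using that prod_greaterThanAtMost_Suc[of r "c - 1" s] *[of "c - 1"] by simp
  consider "c \<le> n" | "c = n + 1" | "c = n + 2" | "c > n + 2" by linarith
  then show ?thesis
  proof cases
    case 1
    then show ?thesis using assms by (auto simp: xop_def Sform_def Rform_def ***)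
  next
    case 2
    then show ?thesis using assms by (auto simp: xop_def Sform_def Rform_def)
  next
    case 3
    then show ?thesis using assms by (auto simp: xop_def Sform_def Rform_def)
  next
    case 4
    then show ?thesis using assms by (auto simp: xop_def Sform_def Rform_def **)
  qed
qed

text \<open>The factor exp(t_a e_{a-1}) changes only the columns a and 2n+3-a. In column a it
  completes s_a to s_a + t_a; to column 2n+3-a it adds -t_a times the column before, which is how
  the products of \<open>- t l\<close> grow.\<close>

lemma xop_Rform:
  assumes "1 \<le> i" "i < a" "a \<le> n"
  shows "xop n (a - 1) (t a) (Rform n i (a + 1) s d t r) c = Rform n i a s d t r c"
proof -
  have head: "{a - Suc 0<..n} = insert a {a<..n}" "{a - Suc 0<..<a} = {}"
    using assms by auto
  consider "c = a" | "c = 2 * n + 3 - a" | "c \<noteq> a" "c \<noteq> 2 * n + 3 - a" by blast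
  then show ?thesis
  proof cases
    case 1
    have *: "(\<Prod>l\<in>{r<..<a}. s l) = (\<Prod>l\<in>{r<..<a - 1}. s l) * s (a - 1)" if "r < a - 1"
    proof -
      have "{r<..<a} = insert (a - 1) {r<..<a - 1}" using that by auto
      then show ?thesis by (simp add: mult.commute)
    qed
    consider "r < a - 1" | "r = a - 1" | "r \<ge> a" by linarith
    then show ?thesis
    proof cases
      assume "r < a - 1"
      then show ?thesis using assms 1 * by (auto simp: xop_def Rform_def algebra_simps)
    next
      assume "r = a - 1"
      then show ?thesis using assms 1 by (auto simp: xop_def Rform_def head)
    next
      assume r: "r \<ge> a"
      have "xop n (a - 1) (t a) (Rform n i (a + 1) s d t r) a
          = Rform n i (a + 1) s d t r a + t a * Rform n i (a + 1) s d t r (a - 1)"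
        using assms by (simp add: xop_def)
      moreover have "Rform n i (a + 1) s d t r (a - 1) = 0" "Rform n i (a + 1) s d t r a = Rform n i a s d t r a"
        using r assms by (auto simp: Rform_def)
      ultimately show ?thesis unfolding 1 by (simp only: mult_zero_right add_0_right)
    qed
  next
    case 2
    then have c: "c > n + 2" "c \<noteq> a" "2 * n + 2 - c = a - 1" "c \<le> 2 * n + 2 - i" "a + c = 2 * n + 3" using assms by auto
    have c2: "Suc (Suc (Suc (2 * n))) - c = a" using c assms by auto
    have x: "xop n (a - 1) (t a) (Rform n i (a + 1) s d t r) c
        = Rform n i (a + 1) s d t r c - t a * Rform n i (a + 1) s d t r (c - 1)"
      using c assms 2 by (auto simp: xop_def)
    consider "r < i" | "i \<le> r" "r \<le> n" | "r = n + 1" | "n + 1 < r" "r < c - 1" | "r = c - 1" | "r \<ge> c" by linarith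
    then show ?thesis unfolding x
    proof cases
      case 4
      have a: "a < 2 * n + 2 - r" using 4 c by auto
      let ?k = "2 * n + 2 - r"
      have "Rform n i (a + 1) s d t r c = 0"
        using 4 c by (auto simp: Rform_def)
      moreover have "Rform n i (a + 1) s d t r (c - 1) = - (s ?k + t ?k) * (\<Prod>l\<in>{2 * n + 2 - (c - 1)<..<?k}. - t l)"
        using 4 c a by (auto simp: Rform_def)
      moreover have "Rform n i a s d t r c = - (s ?k + t ?k) * (\<Prod>l\<in>{2 * n + 2 - c<..<?k}. - t l)"
        using 4 c a by (auto simp: Rform_def)
      moreover have "(\<Prod>l\<in>{2 * n + 2 - c<..<?k}. - t l) = - t a * (\<Prod>l\<in>{2 * n + 2 - (c - 1)<..<?k}. - t l)"
      proof -
        have "{2 * n + 2 - c<..<?k} = insert a {2 * n + 2 - (c - 1)<..<?k}" "2 * n + 2 - (c - 1) = a"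
          using a c 2 assms by auto
        then show ?thesis by simp
      qed
      ultimately show "Rform n i (a + 1) s d t r c - t a * Rform n i (a + 1) s d t r (c - 1)
          = Rform n i a s d t r c"
        by (simp only: mult_ac mult_minus_left mult_minus_right diff_0)
    qed (use assms c in \<open>auto simp: Rform_def c2 head\<close>)
  next
    case 3
    then have "xop n (a - 1) (t a) (Rform n i (a + 1) s d t r) c = Rform n i (a + 1) s d t r c"
      using assms by (auto simp: xop_def)
    also have "\<dots> = Rform n i a s d t r c"
    proof -
      have "a + 1 \<le> c \<longleftrightarrow> a \<le> c" "(a + 1) + c \<le> 2 * n + 3 \<longleftrightarrow> a + c \<le> 2 * n + 3"
        using 3 by auto
      moreover have "(a + 1) + r \<le> 2 * n + 2 \<longleftrightarrow> a + r \<le> 2 * n + 2" if "r < c" "a + c \<le> 2 * n + 3 \<or> c = r + 1"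
        using 3 that by auto
      ultimately show ?thesis unfolding Rform_def by auto
    qed
    finally show ?thesis .
  qed
qed

lemma ent_tprod:
  assumes "1 \<le> i" "i < a" "a \<le> n + 1" "r \<in> Idx n" "c \<in> Idx n"
  shows "ent (mprod n (map (\<lambda>j. mexp n (s j \<cdot>\<^sub>m egen n (j - 1))) [i + 1..<n + 1]
      @ [mexp n (d \<cdot>\<^sub>m egen n n)]
      @ map (\<lambda>j. mexp n (t j \<cdot>\<^sub>m egen n (j - 1))) (rev [a..<n + 1]))) r c = Rform n i a s d t r c"
  using assms(3,2,5)
proof (induction a arbitrary: c rule: inc_induct)
  case base
  let ?P = "mprod n (map (\<lambda>j. mexp n (s j \<cdot>\<^sub>m egen n (j - 1))) [i + 1..<n + 1])"
  have "mprod n (map (\<lambda>j. mexp n (s j \<cdot>\<^sub>m egen n (j - 1))) [i + 1..<n + 1]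
      @ [mexp n (d \<cdot>\<^sub>m egen n n)]) = ?P * mexp n (d \<cdot>\<^sub>m egen n n)"
    by (subst mprod_append) auto
  moreover have "ent (?P * mexp n (d \<cdot>\<^sub>m egen n n)) r c = xop n n d (ent ?P r) c"
    using base assms by (intro ent_mult_xmat mprod_Mats) auto
  moreover have "\<dots> = xop n n d (Sform n i n s r) c"
    by (rule xop_cong) (use base assms ent_sprod[of i n n] in auto)
  ultimately show ?case
    using xop_Sform_Rform[of i n d s r c t] base assms by simp
next
  case (step a)
  let ?w = "\<lambda>a. map (\<lambda>j. mexp n (s j \<cdot>\<^sub>m egen n (j - 1))) [i + 1..<n + 1]
      @ [mexp n (d \<cdot>\<^sub>m egen n n)]
      @ map (\<lambda>j. mexp n (t j \<cdot>\<^sub>m egen n (j - 1))) (rev [a..<n + 1])"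
  have "?w a = ?w (Suc a) @ [mexp n (t a \<cdot>\<^sub>m egen n (a - 1))]"
    using step.hyps by (subst upt_conv_Cons) auto
  then have "mprod n (?w a) = mprod n (?w (Suc a)) * mexp n (t a \<cdot>\<^sub>m egen n (a - 1))"
    by (simp only:, subst mprod_append) auto
  moreover have "ent (mprod n (?w (Suc a)) * mexp n (t a \<cdot>\<^sub>m egen n (a - 1))) r c
      = xop n (a - 1) (t a) (ent (mprod n (?w (Suc a))) r) c"
    using step assms by (intro ent_mult_xmat mprod_Mats) auto
  moreover have "\<dots> = xop n (a - 1) (t a) (Rform n i (Suc a) s d t r) c"
    by (rule xop_cong) (use step assms in auto)
  ultimately show ?case
    using xop_Rform[of i a n t s d r c] step assms by simp
qed

subsection \<open>The representatives of the Weyl group elements\<close>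

lemma yop_cong:
  assumes "1 \<le> j" "j \<le> n" "c \<in> Idx n" "\<And>m. m \<in> Idx n \<Longrightarrow> g m = h m"
  shows "yop n j a g c = yop n j a h c"
proof -
  have "g m = h m" if "m \<in> {j, j + 1, 2 * n + 1 - j, 2 * n + 2 - j, n, n + 1, n + 2, c}" for m
    using that assms(1-3) by (intro assms(4)) auto
  then show ?thesis by (simp add: yop_def)
qed

definition sbar :: "nat \<Rightarrow> nat \<Rightarrow> ratfun mat" where
  "sbar n j = mexp n (egen n j) * mexp n (- fgen n j) * mexp n (egen n j)"

lemma uminus_eq_smult: "- A = (-1) \<cdot>\<^sub>m (A :: ratfun mat)"
  by (rule eq_matI) auto

lemma sbar_Mats [simp]: "sbar n j \<in> Mats n"
  by (simp add: sbar_def uminus_eq_smult)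

definition sop :: "nat \<Rightarrow> nat \<Rightarrow> (nat \<Rightarrow> ratfun) \<Rightarrow> nat \<Rightarrow> ratfun" where
  "sop n j g c = (if j < n
     then if c = j + 1 then g j else if c = j then - g (j + 1)
       else if c = 2 * n + 2 - j then - g (2 * n + 1 - j)
       else if c = 2 * n + 1 - j then g (2 * n + 2 - j) else g c
     else if c = n + 2 then - g n else if c = n + 1 then - g (n + 1)
       else if c = n then - g (n + 2) else g c)"

text \<open>The SL_2 identity behind the Weyl representatives. For \<open>j < n\<close> two
  commuting copies of a two-dimensional representation occur, on the columns j, j+1 and on the
  mirrored pair; for \<open>j = n\<close> it is the three-dimensional representation on the columns
  n, n+1, n+2.\<close>

lemma xop_yop_xop:
  assumes "1 \<le> j" "j \<le> n"
  shows "xop n j 1 (yop n j (-1) (xop n j 1 g)) c = sop n j g c"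
proof (cases "j < n")
  case True
  then have ne: "j + 1 \<noteq> 2 * n + 2 - j" "j \<noteq> 2 * n + 1 - j" "2 * n + 1 - j \<noteq> 2 * n + 2 - j"
      "j + 1 \<noteq> 2 * n + 1 - j" "j \<noteq> 2 * n + 2 - j"
    by auto
  \<comment> \<open>The mirrored pair of columns. It is disjoint from \<open>j\<close>,
    \<open>j + 1\<close>, so the operations become updates at four distinct places.\<close>
  define k l where "k = 2 * n + 1 - j" and "l = 2 * n + 2 - j"
  then have kl: "j + 1 \<noteq> l" "j \<noteq> k" "k \<noteq> l" "j + 1 \<noteq> k" "j \<noteq> l" using ne by auto
  have kl': "Suc (2 * n) - j = k" "Suc (Suc (2 * n)) - j = l" by (simp_all add: k_def l_def)
  have x: "xop n j a g = g(l := g l - a * g k, j + 1 := g (j + 1) + a * g j)"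
    and y: "yop n j a g = g(k := g k - a * g l, j := g j + a * g (j + 1))"
    and s: "sop n j g = g(k := g l, l := - g k, j := - g (j + 1), j + 1 := g j)" for a g
    using True by (simp_all add: fun_eq_iff fun_upd_def xop_def yop_def sop_def kl')
  have "xop n j 1 (yop n j (-1) (xop n j 1 g)) = sop n j g"
    unfolding x y s using kl by (simp add: fun_eq_iff)
  then show ?thesis by simp
next
  case False
  then show ?thesis using assms by (auto simp: xop_def yop_def sop_def algebra_simps sqrt2_mult)
qed

lemma ent_mult_sbar:
  assumes A: "A \<in> Mats n" and j: "1 \<le> j" "j \<le> n" and rc: "r \<in> Idx n" "c \<in> Idx n"
  shows "ent (A * sbar n j) r c = sop n j (ent A r) c"
proof -
  let ?E = "mexp n (1 \<cdot>\<^sub>m egen n j)" and ?F = "mexp n ((-1) \<cdot>\<^sub>m fgen n j)"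
  have "1 \<cdot>\<^sub>m egen n j = egen n j" by (rule eq_matI) auto
  then have "A * sbar n j = A * ?E * ?F * ?E"
    using A by (simp add: sbar_def uminus_eq_smult Mats_assoc)
  also have "ent \<dots> r c = xop n j 1 (ent (A * ?E * ?F) r) c"
    using A by (intro ent_mult_xmat j rc) simp
  also have "\<dots> = xop n j 1 (yop n j (-1) (ent (A * ?E) r)) c"
    using A by (intro xop_cong j rc ent_mult_ymat) simp_all
  also have "\<dots> = xop n j 1 (yop n j (-1) (xop n j 1 (ent A r))) c"
    using A by (intro xop_cong yop_cong j rc ent_mult_xmat) simp_all
  also have "\<dots> = sop n j (ent A r) c"
    by (rule xop_yop_xop[OF j])
  finally show ?thesis .
qed

lemma sop_cong:
  assumes "1 \<le> j" "j \<le> n" "c \<in> Idx n" "\<And>m. m \<in> Idx n \<Longrightarrow> g m = h m"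
  shows "sop n j g c = sop n j h c"
proof -
  have "j \<in> Idx n" "j + 1 \<in> Idx n" "2 * n + 1 - j \<in> Idx n" "2 * n + 2 - j \<in> Idx n"
    "n \<in> Idx n" "n + 1 \<in> Idx n" "n + 2 \<in> Idx n" using assms(1,2) by auto
  from this[THEN assms(4)] assms(4)[OF assms(3)] show ?thesis
    unfolding sop_def by (simp only:)
qed

definition delta :: "nat \<Rightarrow> nat \<Rightarrow> ratfun" where
  "delta m c = (if m = c then 1 else 0)"

text \<open>The partial products of $\bar s_i \cdots \bar s_{n-1} \bar s_n \bar s_{n-1} \cdots \bar s_i$: those up to
  $\bar s_{a-1}$ in the ascending part, and those down to $\bar s_b$ in the descending part.\<close>

definition asc_form :: "nat \<Rightarrow> nat \<Rightarrow> nat \<Rightarrow> nat \<Rightarrow> nat \<Rightarrow> ratfun" where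
  "asc_form n i a r c =
    (if r = i then delta a c else if r = 2 * n + 2 - i then delta (2 * n + 2 - a) c
     else if i < r \<and> r \<le> a then - delta (r - 1) c
     else if 2 * n + 2 \<le> r + a \<and> r < 2 * n + 2 - i then - delta (r + 1) c
     else delta r c)"

definition desc_form :: "nat \<Rightarrow> nat \<Rightarrow> nat \<Rightarrow> nat \<Rightarrow> nat \<Rightarrow> ratfun" where
  "desc_form n i b r c =
    (if r = i then - ((-1) ^ (n - b)) * delta (2 * n + 2 - b) c
     else if r = 2 * n + 2 - i then - ((-1) ^ (n - b)) * delta b c
     else if i < r \<and> r \<le> b then - delta (r - 1) c
     else if 2 * n + 2 \<le> r + b \<and> r < 2 * n + 2 - i then - delta (r + 1) c
     else if i < r \<and> r < 2 * n + 2 - i then - delta r c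
     else delta r c)"

lemma delta_simps [simp]: "delta c c = 1" "m \<noteq> c \<Longrightarrow> delta m c = 0"
  by (auto simp: delta_def)

text \<open>The mirrored index \<open>j'\<close> is given by an equation, which keeps truncated
  subtraction out of the case distinctions.\<close>

lemma sop_delta:
  assumes "j < n" "j + j' = 2 * n + 1"
  shows "sop n j (delta m) c = (if m = j then delta (j + 1) c else if m = j + 1 then - delta j c
      else if m = j' then - delta (j' + 1) c
      else if m = j' + 1 then delta j' c else delta m c)"
proof -
  have "2 * n + 1 - j = j'" "2 * n + 2 - j = j' + 1" "j + 1 < j'" using assms by auto
  then show ?thesis using assms by (auto simp: sop_def delta_def)
qed

lemma sop_n_delta:
  "sop n n (delta m) c = (if m = n then - delta (n + 2) c else if m = n + 1 then - delta (n + 1) c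
      else if m = n + 2 then - delta n c else delta m c)"
  by (auto simp: sop_def delta_def)

lemma sop_smult: "sop n j (\<lambda>c. a * g c) c = a * sop n j g c"
  by (simp only: sop_def if_distrib[of "\<lambda>x. a * x"] mult_minus_right)

text \<open>Each row is a signed unit vector, so one more factor acts on it through
  \<open>sop_delta\<close> or \<open>sop_n_delta\<close> and linearity alone.\<close>

lemma asc_form_row:
  assumes "i + i' = 2 * n + 2" "a + a' = 2 * n + 2"
  shows "asc_form n i a r = (\<lambda>c. (if r = i \<or> r = i' then 1 else if i < r \<and> r \<le> a then -1 else if a' \<le> r \<and> r < i' then -1 else 1)
    * delta (if r = i then a else if r = i' then a' else if i < r \<and> r \<le> a then r - 1
       else if a' \<le> r \<and> r < i' then r + 1 else r) c)"
proof -
  have "2 * n + 2 - i = i'" "2 * n + 2 - a = a'" "2 * n + 2 \<le> r + a \<longleftrightarrow> a' \<le> r" using assms by auto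
  then show ?thesis
    unfolding asc_form_def by (simp only:) (auto simp: fun_eq_iff)
qed

lemma desc_form_row:
  assumes "i + i' = 2 * n + 2" "b + b' = 2 * n + 2"
  shows "desc_form n i b r = (\<lambda>c. (if r = i \<or> r = i' then - ((-1) ^ (n - b)) else if i < r \<and> r \<le> b then -1 else if b' \<le> r \<and> r < i' then -1 else if i < r \<and> r < i' then -1 else 1)
    * delta (if r = i then b' else if r = i' then b else if i < r \<and> r \<le> b then r - 1
       else if b' \<le> r \<and> r < i' then r + 1 else r) c)"
proof -
  have "2 * n + 2 - i = i'" "2 * n + 2 - b = b'" "2 * n + 2 \<le> r + b \<longleftrightarrow> b' \<le> r" using assms by auto
  then show ?thesis
    unfolding desc_form_def by (simp only:) (auto simp: fun_eq_iff)
qed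

lemma sop_asc:
  assumes "1 \<le> i" "i \<le> a" "a < n" "1 \<le> r"
  shows "sop n a (asc_form n i a r) c = asc_form n i (a + 1) r c"
proof -
  define i' a' where "i' = 2 * n + 2 - i" and "a' = 2 * n + 1 - a"
  have i': "i + i' = 2 * n + 2" and a': "a + a' = 2 * n + 1" "a + (a' + 1) = 2 * n + 2" "a + 1 + a' = 2 * n + 2"
    using assms by (auto simp: i'_def a'_def)
  have "a' < i'" "a + 1 < a'" using i' a' assms by auto
  then consider "r = i" | "r = i'" | "i < r" "r \<le> a" | "r = a + 1" | "a + 1 < r" "r < a'"
      | "r = a'" | "a' < r" "r < i'" | "r < i" | "r > i'" by linarith
  then show ?thesis
    unfolding asc_form_row[OF i' a'(2)] asc_form_row[OF i' a'(3)] sop_smult sop_delta[OF assms(3) a'(1)]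
    by cases (use \<open>a' < i'\<close> \<open>a + 1 < a'\<close> assms(2) in simp_all)
qed

lemma sop_asc_desc:
  assumes "1 \<le> i" "i \<le> n" "1 \<le> r"
  shows "sop n n (asc_form n i n r) c = desc_form n i n r c"
proof -
  define i' where "i' = 2 * n + 2 - i"
  have i': "i + i' = 2 * n + 2" "n + 2 \<le> i'" using assms by (auto simp: i'_def)
  have n': "n + (n + 2) = 2 * n + 2" by simp
  consider "r = i" | "r = i'" | "i < r" "r \<le> n" | "r = n + 1" | "n + 1 < r" "r < i'" | "r < i" | "r > i'"
    using i' assms by linarith
  then show ?thesis
    unfolding asc_form_row[OF i'(1) n'] desc_form_row[OF i'(1) n'] sop_smult sop_n_delta
    by cases (use i'(2) assms(2) in simp_all)
qed

lemma sop_desc: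
  assumes "1 \<le> i" "i \<le> b" "b < n" "1 \<le> r"
  shows "sop n b (desc_form n i (b + 1) r) c = desc_form n i b r c"
proof -
  define i' b' where "i' = 2 * n + 2 - i" and "b' = 2 * n + 1 - b"
  have i': "i + i' = 2 * n + 2" and b': "b + b' = 2 * n + 1" "b + (b' + 1) = 2 * n + 2" "b + 1 + b' = 2 * n + 2"
    using assms by (auto simp: i'_def b'_def)
  have "n - b = Suc (n - (b + 1))" using assms by simp
  then have p: "(-1 :: ratfun) ^ (n - b) = - ((-1) ^ (n - (b + 1)))" by simp
  have "b' < i'" "b + 1 < b'" using i' b' assms by auto
  then consider "r = i" | "r = i'" | "i < r" "r \<le> b" | "i < r" "r = b + 1" | "b + 1 < r" "r < b'"
      | "r = b'" | "b' < r" "r < i'" | "r < i" | "r > i'" using assms by linarith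
  then show ?thesis
    unfolding desc_form_row[OF i' b'(2)] desc_form_row[OF i' b'(3)] sop_smult sop_delta[OF assms(3) b'(1)] p
    by cases (use \<open>b' < i'\<close> \<open>b + 1 < b'\<close> assms(2) in simp_all)
qed

lemma ent_asc:
  assumes "1 \<le> i" "i \<le> a" "a \<le> n" "r \<in> Idx n" "c \<in> Idx n"
  shows "ent (mprod n (map (\<lambda>j. sbar n (j - 1)) [i + 1..<a + 1])) r c = asc_form n i a r c"
  using assms(2,3,5)
proof (induction a arbitrary: c rule: dec_induct)
  case base
  then show ?case using assms by (auto simp: ent_idm asc_form_def delta_def)
next
  case (step a)
  let ?P = "mprod n (map (\<lambda>j. sbar n (j - 1)) [i + 1..<a + 1])"
  have "mprod n (map (\<lambda>j. sbar n (j - 1)) [i + 1..<Suc a + 1]) = ?P * sbar n a"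
  proof -
    have "[i + 1..<Suc a + 1] = [i + 1..<a + 1] @ [a + 1]"
      using step.hyps upt_Suc_append[of "i + 1" "a + 1"] by simp
    then show ?thesis by (simp only: map_append, subst mprod_append) auto
  qed
  moreover have "ent (?P * sbar n a) r c = sop n a (ent ?P r) c"
    using step assms by (intro ent_mult_sbar mprod_Mats) auto
  moreover have "\<dots> = sop n a (asc_form n i a r) c"
    by (rule sop_cong) (use step assms in auto)
  ultimately show ?case
    using sop_asc[of i a n r c] step assms by simp
qed

text \<open>The parameter index \<open>j\<close> belongs to the generator \<open>j - 1\<close>:
  factors listed down to \<open>a\<close> reach the simple reflection \<open>a - 1\<close>, hence
  \<open>desc_form\<close> at \<open>a - 1\<close>.\<close>

lemma ent_desc:
  assumes "1 \<le> i" "i < a" "a \<le> n + 1" "r \<in> Idx n" "c \<in> Idx n"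
  shows "ent (mprod n (map (\<lambda>j. sbar n (j - 1)) [i + 1..<n + 1] @ [sbar n n]
      @ map (\<lambda>j. sbar n (j - 1)) (rev [a..<n + 1]))) r c = desc_form n i (a - 1) r c"
  using assms(3,2,5)
proof (induction a arbitrary: c rule: inc_induct)
  case base
  let ?P = "mprod n (map (\<lambda>j. sbar n (j - 1)) [i + 1..<n + 1])"
  have "mprod n (map (\<lambda>j. sbar n (j - 1)) [i + 1..<n + 1] @ [sbar n n]) = ?P * sbar n n"
    by (subst mprod_append) auto
  moreover have "ent (?P * sbar n n) r c = sop n n (ent ?P r) c"
    using base assms by (intro ent_mult_sbar mprod_Mats) auto
  moreover have "\<dots> = sop n n (asc_form n i n r) c"
    by (rule sop_cong) (use base assms ent_asc[of i n n] in auto)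
  ultimately show ?case
    using sop_asc_desc[of i n r c] base assms by simp
next
  case (step a)
  let ?w = "\<lambda>a. map (\<lambda>j. sbar n (j - 1)) [i + 1..<n + 1] @ [sbar n n]
      @ map (\<lambda>j. sbar n (j - 1)) (rev [a..<n + 1])"
  have "?w a = ?w (Suc a) @ [sbar n (a - 1)]"
    using step.hyps by (subst upt_conv_Cons) auto
  then have "mprod n (?w a) = mprod n (?w (Suc a)) * sbar n (a - 1)"
    by (simp only:, subst mprod_append) auto
  moreover have "ent (mprod n (?w (Suc a)) * sbar n (a - 1)) r c
      = sop n (a - 1) (ent (mprod n (?w (Suc a))) r) c"
    using step assms by (intro ent_mult_sbar mprod_Mats) auto
  moreover have "\<dots> = sop n (a - 1) (desc_form n i a r) c"
    by (rule sop_cong) (use step assms in auto)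
  moreover have "sop n (a - 1) (desc_form n i a r) c = desc_form n i (a - 1) r c"
    using sop_desc[of i "a - 1" n r c] step assms by simp
  ultimately show ?case by (simp only:)
qed

section \<open>Entries of a layer R_i for the parameters -t and p\<close>

locale layer_index =
  fixes n i :: nat
  assumes i: "1 \<le> i" "i \<le> n"
begin

lemma Rform_diag: "Rform n i a s' d' t' r r = 1"
  and Rform_low: "c < r \<Longrightarrow> Rform n i a s' d' t' r c = 0"
  by (simp_all add: Rform_def)

lemma open_interval: "{r<..<Suc m} = {r<..m}"
  by auto

text \<open>The entries of R_i by region, for arbitrary parameters, since the uniqueness proof reads
  them off as well. Indices beyond the middle are written \<open>2 * n + 2 - m\<close>, and
  successors are used where needed, so that every product runs over a half-open interval between i
  and n.\<close>

lemma Rform_1: "i \<le> r \<Longrightarrow> r \<le> c \<Longrightarrow> c < n \<Longrightarrow>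
    Rform n i (i + 1) s' d' t' r (Suc c) = (\<Prod>l\<in>{r<..c}. s' l) * (s' (Suc c) + t' (Suc c))"
  using i by (simp add: Rform_def open_interval)

lemma Rform_2: "i \<le> r \<Longrightarrow> r \<le> n \<Longrightarrow>
    Rform n i (i + 1) s' d' t' r (Suc n) = sqrt2 * d' * (\<Prod>l\<in>{r<..n}. s' l)"
  using i by (simp add: Rform_def)

lemma hat_hat: "m \<le> n \<Longrightarrow> 2 * n + 2 - (2 * n + 2 - m) = m" for m by simp

lemma Rform_3: "i \<le> r \<Longrightarrow> r \<le> n \<Longrightarrow> i \<le> m \<Longrightarrow> m \<le> n \<Longrightarrow>
    Rform n i (i + 1) s' d' t' r (2 * n + 2 - m) = - (d'\<^sup>2) * (\<Prod>l\<in>{r<..n}. s' l) * (\<Prod>l\<in>{m<..n}. - t' l)"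
proof -
  assume *: "i \<le> r" "r \<le> n" "i \<le> m" "m \<le> n"
  then have "2 * n + 2 - m \<noteq> r" "\<not> r < i" "\<not> 2 * n + 2 - m \<le> r" "\<not> 2 * n + 2 - i < 2 * n + 2 - m"
    "\<not> 2 * n + 2 - m \<le> n" "2 * n + 2 - m \<noteq> n + 1" "i + 1 + (2 * n + 2 - m) \<le> 2 * n + 3" by auto
  then show ?thesis unfolding Rform_def using * by (simp only: if_False if_True hat_hat) simp
qed

lemma Rform_4: "i \<le> m \<Longrightarrow> m \<le> n \<Longrightarrow>
    Rform n i (i + 1) s' d' t' (Suc n) (2 * n + 2 - m) = - sqrt2 * d' * (\<Prod>l\<in>{m<..n}. - t' l)"
proof -
  assume *: "i \<le> m" "m \<le> n"
  then have "2 * n + 2 - m \<noteq> n + 1" "\<not> n + 1 < i" "\<not> 2 * n + 2 - m \<le> n + 1" "\<not> 2 * n + 2 - i < 2 * n + 2 - m"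
    "\<not> 2 * n + 2 - m \<le> n" "\<not> n + 1 \<le> n" "i + 1 + (2 * n + 2 - m) \<le> 2 * n + 3" using i by auto
  then show ?thesis unfolding Rform_def Suc_eq_plus1 using * by (simp only: if_False if_True hat_hat) simp
qed

lemma Rform_5: "i \<le> m \<Longrightarrow> m \<le> k \<Longrightarrow> k < n \<Longrightarrow>
    Rform n i (i + 1) s' d' t' (2 * n + 2 - Suc k) (2 * n + 2 - m)
      = - (s' (Suc k) + t' (Suc k)) * (\<Prod>l\<in>{m<..k}. - t' l)"
proof -
  assume *: "i \<le> m" "m \<le> k" "k < n"
  then have "2 * n + 2 - m \<noteq> n + 1" "\<not> 2 * n + 2 - Suc k < i" "\<not> 2 * n + 2 - m \<le> 2 * n + 2 - Suc k"
    "\<not> 2 * n + 2 - i < 2 * n + 2 - m" "2 * n + 2 - Suc k \<noteq> 2 * n + 2 - m" "\<not> 2 * n + 2 - Suc k \<le> n"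
    "\<not> 2 * n + 2 - m \<le> n" "2 * n + 2 - Suc k \<noteq> n + 1" "i + 1 + (2 * n + 2 - m) \<le> 2 * n + 3"
    "i + 1 + (2 * n + 2 - Suc k) \<le> 2 * n + 2" "m \<le> n" "Suc k \<le> n" using i by auto
  then show ?thesis unfolding Rform_def by (simp only: if_False if_True hat_hat open_interval simp_thms)
qed

end

text \<open>\<open>P\<close>, \<open>Q\<close>, \<open>pd\<close> below are the parameters $p_{i,l}$, $q_{i,l}$, $p_i$ without the products over
  $k < i$, and \<open>D\<close> is the torus element that creates these products.\<close>

locale layer = layer_index n i for n i +
  fixes s t u :: "nat \<Rightarrow> ratfun" and d :: ratfun
  assumes s_i: "s i = 1" and u_i: "u i = 1"
    and u: "\<And>l. i < l \<Longrightarrow> l \<le> n \<Longrightarrow> u l = s l + t l"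
    and s_nz: "\<And>l. i \<le> l \<Longrightarrow> l \<le> n \<Longrightarrow> s l \<noteq> 0"
    and t_nz: "\<And>l. i < l \<Longrightarrow> l \<le> n \<Longrightarrow> t l \<noteq> 0"
    and u_nz: "\<And>l. i \<le> l \<Longrightarrow> l \<le> n \<Longrightarrow> u l \<noteq> 0"
    and d_nz: "d \<noteq> 0"
begin

definition A :: "nat \<Rightarrow> ratfun" where "A m = (\<Prod>l\<in>{i<..m}. s l)"
definition B :: "nat \<Rightarrow> ratfun" where "B m = (\<Prod>l\<in>{i<..m}. t l)"
definition P :: "nat \<Rightarrow> ratfun" where "P l = u (l - 1) / (u l * s (l - 1))"
definition Q :: "nat \<Rightarrow> ratfun" where "Q l = P l * s l / t l"
definition pd :: ratfun where "pd = u n / (d * s n)"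
text \<open>Signs written as a function of the index, so that products of \<open>- s l\<close> and
  \<open>- P l\<close> telescope like the others.\<close>

definition e :: "nat \<Rightarrow> ratfun" where "e m = (-1) ^ m"

lemma e_cases: "e m = 1 \<or> e m = -1"
  by (cases "even m") (simp_all add: e_def)

lemma e_Suc: "e (Suc m) = - e m"
  by (simp add: e_def)

lemma A_i: "A i = 1" and B_i: "B i = 1"
  by (simp_all add: A_def B_def)

lemma A_Suc: "i \<le> m \<Longrightarrow> A (Suc m) = A m * s (Suc m)"
  and B_Suc: "i \<le> m \<Longrightarrow> B (Suc m) = B m * t (Suc m)"
  by (simp_all add: A_def B_def prod_greaterThanAtMost_Suc)

lemma A_nz: "m \<le> n \<Longrightarrow> A m \<noteq> 0" and B_nz: "m \<le> n \<Longrightarrow> B m \<noteq> 0"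
  by (auto simp: A_def B_def s_nz t_nz)

text \<open>Every product in the entries has quotients of consecutive values of some potential
  \<open>F\<close> as factors: e A for -s, B for t, s/(u B) for \<open>Q\<close>, and e s/(u A) for
  \<open>- P\<close>. This is what the quotients of the u in the parameters achieve.\<close>

lemma telescope:
  assumes "i \<le> r" "r \<le> m" "m \<le> n"
    and "\<And>l. i \<le> l \<Longrightarrow> l < n \<Longrightarrow> F (Suc l) = F l * f (Suc l)"
    and "F r \<noteq> 0"
  shows "(\<Prod>l\<in>{r<..m}. f l) = F m / (F r :: ratfun)"
  using assms(2,3)
proof (induction m rule: dec_induct)
  case base
  then show ?case using assms(5) by simp
next
  case (step m)
  then show ?case using assms(1) by (simp add: prod_greaterThanAtMost_Suc assms(4))
qed

lemma Q_Suc: "i \<le> l \<Longrightarrow> l < n \<Longrightarrow> Q (Suc l) = u l * s (Suc l) / (u (Suc l) * s l * t (Suc l))"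
  by (simp add: Q_def P_def)

text \<open>Entries of a layer contain the sum of the two parameters with the same index; here s + t
  = u cancels the denominator that \<open>P\<close> and \<open>Q\<close> share.\<close>

lemma QP_sum: "i \<le> l \<Longrightarrow> l < n \<Longrightarrow> Q (Suc l) + P (Suc l) = u l / (s l * t (Suc l))"
proof -
  assume l: "i \<le> l" "l < n"
  have "Q (Suc l) + P (Suc l) = P (Suc l) * (s (Suc l) + t (Suc l)) / t (Suc l)"
    using l t_nz[of "Suc l"] by (simp add: Q_def field_simps)
  also have "\<dots> = u l / (s l * t (Suc l))"
    using l u[of "Suc l"] u_nz[of "Suc l"] by (simp add: P_def)
  finally show ?thesis .
qed

lemma prod_neg_s: "i \<le> r \<Longrightarrow> r \<le> m \<Longrightarrow> m \<le> n \<Longrightarrow> (\<Prod>l\<in>{r<..m}. - s l) = (e m * A m) / (e r * A r)"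
  using e_cases[of r] by (intro telescope) (auto simp: e_Suc A_Suc A_nz)

lemma prod_t: "i \<le> r \<Longrightarrow> r \<le> m \<Longrightarrow> m \<le> n \<Longrightarrow> (\<Prod>l\<in>{r<..m}. t l) = B m / B r"
  by (intro telescope) (auto simp: B_Suc B_nz)

lemma prod_Q: "i \<le> r \<Longrightarrow> r \<le> m \<Longrightarrow> m \<le> n \<Longrightarrow>
    (\<Prod>l\<in>{r<..m}. Q l) = (s m / (u m * B m)) / (s r / (u r * B r))"
  by (intro telescope) (auto simp: Q_Suc B_Suc B_nz s_nz u_nz t_nz)

lemma prod_neg_P: "i \<le> r \<Longrightarrow> r \<le> m \<Longrightarrow> m \<le> n \<Longrightarrow>
    (\<Prod>l\<in>{r<..m}. - P l) = (e m * s m / (u m * A m)) / (e r * s r / (u r * A r))"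
  using e_cases[of r] by (intro telescope) (auto simp: P_def e_Suc A_Suc A_nz s_nz u_nz)

definition Rm :: "nat \<Rightarrow> nat \<Rightarrow> ratfun" where
  "Rm = Rform n i (i + 1) (\<lambda>l. - s l) (- d) (\<lambda>l. - t l)"

text \<open>The slot of s_{i,j} receives \<open>Q\<close> and that of t_{i,j} receives
  \<open>P\<close>, because q replaces s and p replaces t in the product.\<close>

definition Rp :: "nat \<Rightarrow> nat \<Rightarrow> ratfun" where
  "Rp = Rform n i (i + 1) Q pd P"

lemma Rm_1: "i \<le> r \<Longrightarrow> r \<le> c \<Longrightarrow> c < n \<Longrightarrow> Rm r (Suc c) = - (e c * e r * A c / A r) * u (Suc c)"
  using e_cases[of r] by (auto simp: Rm_def Rform_1[simplified] prod_neg_s u A_nz field_simps)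

lemma Rm_2: "i \<le> r \<Longrightarrow> r \<le> n \<Longrightarrow> Rm r (Suc n) = - sqrt2 * d * (e n * e r * A n / A r)"
  using e_cases[of r] by (auto simp: Rm_def Rform_2[simplified] prod_neg_s A_nz)

lemma Rm_3: "i \<le> r \<Longrightarrow> r \<le> n \<Longrightarrow> i \<le> m \<Longrightarrow> m \<le> n \<Longrightarrow>
    Rm r (2 * n + 2 - m) = - (d\<^sup>2) * (e n * e r * A n / A r) * (B n / B m)"
  unfolding Rm_def using e_cases[of r] by (subst Rform_3) (auto simp: prod_neg_s prod_t A_nz)

lemma Rm_4: "i \<le> m \<Longrightarrow> m \<le> n \<Longrightarrow> Rm (Suc n) (2 * n + 2 - m) = sqrt2 * d * (B n / B m)"
  unfolding Rm_def by (subst Rform_4) (auto simp: prod_t)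

lemma Rm_5: "i \<le> m \<Longrightarrow> m \<le> k \<Longrightarrow> k < n \<Longrightarrow>
    Rm (2 * n + 2 - Suc k) (2 * n + 2 - m) = u (Suc k) * (B k / B m)"
  unfolding Rm_def by (subst Rform_5) (auto simp: prod_t u)

lemma Rp_1: "i \<le> r \<Longrightarrow> r \<le> c \<Longrightarrow> c \<le> n \<Longrightarrow> i < c \<Longrightarrow> r < c \<Longrightarrow> Rp r c = u r * B r / (B c * s r)"
proof -
  assume *: "i \<le> r" "r \<le> c" "c \<le> n" "i < c" "r < c"
  define b where "b = c - 1"
  with * have c: "c = Suc b" "i \<le> b" "r \<le> b" "b < n" by auto
  show ?thesis using * c(2-)
    by (simp add: c(1) Rp_def Rform_1[simplified] prod_Q QP_sum B_Suc s_nz u_nz)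
qed

lemma Rp_2: "i \<le> r \<Longrightarrow> r \<le> n \<Longrightarrow> Rp r (Suc n) = sqrt2 * u r * B r / (d * B n * s r)"
  by (simp add: Rp_def Rform_2[simplified] prod_Q pd_def u_nz s_nz i mult.assoc)

lemma Rp_3: "i \<le> r \<Longrightarrow> r \<le> n \<Longrightarrow> i \<le> m \<Longrightarrow> m \<le> n \<Longrightarrow>
    Rp r (2 * n + 2 - m) = - (e n * e m) * u r * B r * u m * A m / (d\<^sup>2 * B n * A n * s r * s m)"
  unfolding Rp_def using e_cases[of m] u_nz[of n] s_nz[of n] i
  by (subst Rform_3) (auto simp: prod_Q prod_neg_P pd_def power2_eq_square mult_ac)

lemma Rp_4: "i \<le> m \<Longrightarrow> m \<le> n \<Longrightarrow>
    Rp (Suc n) (2 * n + 2 - m) = - sqrt2 * (e n * e m) * u m * A m / (d * A n * s m)"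
  unfolding Rp_def using e_cases[of m] u_nz[of n] s_nz[of n] i
  by (subst Rform_4) (auto simp: prod_neg_P pd_def mult.assoc)

lemma Rp_5: "i \<le> m \<Longrightarrow> m < k \<Longrightarrow> k \<le> n \<Longrightarrow>
    Rp (2 * n + 2 - k) (2 * n + 2 - m) = e k * e m * u m * A m * s k / (t k * A k * s m)"
proof -
  assume *: "i \<le> m" "m < k" "k \<le> n"
  define b where "b = k - 1"
  with * have k: "k = Suc b" "i \<le> b" "m \<le> b" "b < n" by auto
  have "Rp (2 * n + 2 - Suc b) (2 * n + 2 - m) = - (Q (Suc b) + P (Suc b)) * (\<Prod>l\<in>{m<..b}. - P l)"
    unfolding Rp_def using * k by (subst Rform_5) auto
  also have "\<dots> = - (u b / (s b * t (Suc b))) * ((e b * s b / (u b * A b)) / (e m * s m / (u m * A m)))"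
    using k * by (simp add: QP_sum prod_neg_P)
  also have "\<dots> = e (Suc b) * e m * u m * A m * s (Suc b) / (t (Suc b) * A (Suc b) * s m)"
    using k * e_cases[of m] u_nz[of b] s_nz[of b] s_nz[of "Suc b"]
    by (auto simp: e_Suc A_Suc)
  finally show ?thesis by (simp only: k(1))
qed

section \<open>The torus element and the comparison of rows\<close>

definition D :: "nat \<Rightarrow> ratfun" where
  "D k = (if i < k \<and> k \<le> n then s k / t k
     else if n + 2 \<le> k \<and> k < 2 * n + 2 - i then t (2 * n + 2 - k) / s (2 * n + 2 - k) else 1)"

lemma D_low: "i < k \<Longrightarrow> k \<le> n \<Longrightarrow> D k = s k / t k" and D_mid: "D (Suc n) = 1"
  and D_high: "i < k \<Longrightarrow> k \<le> n \<Longrightarrow> D (2 * n + 2 - k) = t k / s k"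
  using i by (auto simp: D_def)

lemma Rm_diag: "Rm r r = 1" and Rm_low: "c < r \<Longrightarrow> Rm r c = 0"
  and Rp_diag: "Rp r r = 1" and Rp_low: "c < r \<Longrightarrow> Rp r c = 0"
  by (simp_all add: Rm_def Rp_def Rform_diag Rform_low)

lemma Rm_1': "i \<le> r \<Longrightarrow> r < c \<Longrightarrow> c \<le> n \<Longrightarrow> Rm r c = e c * e r * A c * u c / (s c * A r)"
  using Rm_1[of r "c - 1"] e_Suc[of "c - 1"] A_Suc[of "c - 1"] s_nz[of c] by simp

lemma Rm_5': "i \<le> m \<Longrightarrow> m < k \<Longrightarrow> k \<le> n \<Longrightarrow>
    Rm (2 * n + 2 - k) (2 * n + 2 - m) = u k * B k / (t k * B m)"
  using Rm_5[of m "k - 1"] B_Suc[of "k - 1"] t_nz[of k] by simp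

lemma hat_mid: "2 * n + 2 - Suc n = Suc n" by simp

text \<open>The signed reversal of the block turns row i of R_i(-t) into a multiple of row i of
  R_i(p); from this row the parameters can be read off. The factor is, up to the sign, the corner
  entry of R_i(-t), which at \<open>c = i\<close> meets \<open>Rp i i = 1\<close>.\<close>

lemma first_row:
  assumes "i \<le> c" "c \<le> 2 * n + 2 - i"
  shows "(-1) ^ (n + 1 - i) * Rm i (2 * n + 2 - c) = (d\<^sup>2 * A n * B n) * Rp i c"
proof -
  \<comment> \<open>The sign of the reversal, expressed through \<open>e\<close> so that it cancels
    against the signs of the entries.\<close>
  have e: "(-1) ^ (n + 1 - i) = - (e n * e i)"
  proof -
    have "(-1 :: ratfun) ^ (n + 1 - i) * (-1) ^ i = (-1) ^ (n + 1)"
      using i by (simp only: power_add[symmetric]) simp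
    then show ?thesis using e_cases[of i] by (auto simp: e_def)
  qed
  note nz = i d_nz e_cases[of n] e_cases[of i] B_nz[of n] A_nz[of n]
  consider "c = i" | "i < c" "c \<le> n" | "c = Suc n" | "Suc n < c" using assms(1) by linarith
  then show ?thesis
  proof cases
    case 1
    show ?thesis unfolding 1 e Rm_3[OF order.refl i(2) order.refl i(2)] Rp_diag
      using nz by (auto simp: A_i B_i)
  next
    case 2
    show ?thesis
      unfolding e Rm_3[OF order.refl i(2) less_imp_le[OF 2(1)] 2(2)]
        Rp_1[OF order.refl less_imp_le[OF 2(1)] 2(2) 2(1) 2(1)]
      using nz by (auto simp: A_i B_i u_i s_i mult_ac)
  next
    case 3
    show ?thesis unfolding 3 hat_mid e Rm_2[OF order.refl i(2)] Rp_2[OF order.refl i(2)]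
      using nz by (auto simp: A_i B_i u_i s_i power2_eq_square mult_ac)
  next
    case 4
    define m where "m = 2 * n + 2 - c"
    then have m: "c = 2 * n + 2 - m" "i \<le> m" "m \<le> n" using 4 assms by auto
    show ?thesis
    proof (cases "m = i")
      case True
      show ?thesis
        unfolding m(1) hat_hat[OF m(3)] True e Rp_3[OF order.refl i(2) order.refl i(2)]
        using nz by (auto simp: Rm_diag A_i B_i u_i s_i mult_ac)
    next
      case False
      with m have "i < m" by simp
      show ?thesis
        unfolding m(1) hat_hat[OF m(3)] e Rp_3[OF order.refl i(2) m(2,3)]
          Rm_1'[OF order.refl \<open>i < m\<close> m(3)]
        using nz by (auto simp: A_i B_i u_i s_i mult_ac)
    qed
  qed
qed

text \<open>Below row i, a multiple of row i of R_i(p) has to be split off. Its coefficient is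
  forced by the column \<open>c = 2 * n + 2 - i\<close>, which meets \<open>Rp i i = 1\<close> and a
  zero below the diagonal of \<open>Rp\<close>. This lemma and the next two treat the rows above, in
  and below the middle. Off the diagonal one of the three terms vanishes and the other two are
  monomials; on it all three remain, and u = s + t enters, except in the middle row.\<close>

lemma inner_row_low:
  assumes k: "i < k" "k \<le> n" and c: "i \<le> c" "c \<le> 2 * n + 2 - i"
  shows "Rm k c = Rm k (2 * n + 2 - i) * Rp i (2 * n + 2 - c)
      - D (2 * n + 2 - k) * Rp (2 * n + 2 - k) (2 * n + 2 - c)"
proof -
  note k' = less_imp_le[OF k(1)]
  note nz = i d_nz e_cases[of n] e_cases[of k] e_cases[of c] B_nz[of n] A_nz[of n] B_nz[of k] A_nz[of k]
    t_nz[OF k] s_nz[OF k' k(2)] k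
  note unf = Rm_3[OF k' k(2) order.refl i(2)] D_high[OF k] A_i B_i
  consider "c < k" | "c = k" | "k < c" "c \<le> n" | "c = Suc n" | "Suc n < c" by linarith
  then show ?thesis
  proof cases
    case 1
    then have cn: "c \<le> n" using k by simp
    show ?thesis
      unfolding unf Rm_low[OF 1] Rp_3[OF order.refl i(2) c(1) cn] Rp_5[OF c(1) 1 k(2)]
      using nz by (auto simp: u_i s_i power2_eq_square mult_ac)
  next
    case 2
    show ?thesis
      unfolding unf 2 Rm_diag Rp_diag Rp_3[OF order.refl i(2) k' k(2)]
      using nz u[OF k] by (auto simp: A_i B_i u_i s_i power2_eq_square field_simps)
  next
    case 3
    then have lt: "2 * n + 2 - c < 2 * n + 2 - k" by simp
    show ?thesis
      unfolding unf Rp_low[OF lt] Rm_1'[OF k' 3] Rp_3[OF order.refl i(2) c(1) 3(2)]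
      using nz by (auto simp: A_i B_i u_i s_i power2_eq_square mult_ac)
  next
    case 4
    have lt: "Suc n < 2 * n + 2 - k" using k by simp
    show ?thesis
      unfolding unf 4 hat_mid Rp_low[OF lt] Rm_2[OF k' k(2)] Rp_2[OF order.refl i(2)]
      using nz by (auto simp: A_i B_i u_i s_i power2_eq_square mult_ac)
  next
    case 5
    define m where "m = 2 * n + 2 - c"
    then have m: "c = 2 * n + 2 - m" "i \<le> m" "m \<le> n" using 5 c by auto
    have lt: "m < 2 * n + 2 - k" using k m by simp
    have Rp: "Rp i m = 1 / B m"
      using Rp_1[of i m] m by (cases "m = i") (auto simp: Rp_diag B_i u_i s_i mult_ac)
    show ?thesis
      unfolding unf m(1) hat_hat[OF m(3)] Rp_low[OF lt] Rm_3[OF k' k(2) m(2,3)] Rp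
      using nz by (auto simp: A_i B_i u_i s_i power2_eq_square mult_ac)
  qed
qed

lemma inner_row_mid:
  assumes c: "i \<le> c" "c \<le> 2 * n + 2 - i"
  shows "Rm (Suc n) c = Rm (Suc n) (2 * n + 2 - i) * Rp i (2 * n + 2 - c)
      - D (Suc n) * Rp (Suc n) (2 * n + 2 - c)"
proof -
  note nz = i d_nz e_cases[of n] e_cases[of c] B_nz[of n] A_nz[of n] sqrt2_mult two_neq_zero_ratfun
  note unf = Rm_4[OF order.refl i(2)] D_mid A_i B_i
  have "sqrt2 \<noteq> 0" using sqrt2_mult(1) two_neq_zero_ratfun by auto
  consider "c \<le> n" | "c = Suc n" | "Suc n < c" by linarith
  then show ?thesis
  proof cases
    case 1
    then have lt: "c < Suc n" by simp
    show ?thesis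
      unfolding unf Rm_low[OF lt] Rp_3[OF order.refl i(2) c(1) 1] Rp_4[OF c(1) 1]
      using nz by (auto simp: A_i B_i u_i s_i power2_eq_square mult_ac)
  next
    case 2
    \<comment> \<open>On the diagonal the middle row reads 1 = 2 - 1, where 2 is the square of the
      normalising factor of e_n.\<close>
    have "sqrt2 * d * B n * (sqrt2 / (d * B n)) = 2"
      using nz(3,4) B_nz[of n] sqrt2_mult(1) d_nz by (simp add: mult_ac)
    then show ?thesis
      unfolding unf 2 hat_mid Rm_diag Rp_diag Rp_2[OF order.refl i(2)] by (simp add: B_i u_i s_i mult_ac)
  next
    case 3
    define m where "m = 2 * n + 2 - c"
    then have m: "c = 2 * n + 2 - m" "i \<le> m" "m \<le> n" using 3 c by auto
    have lt: "m < Suc n" using m by simp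
    have Rp: "Rp i m = 1 / B m"
      using Rp_1[of i m] m by (cases "m = i") (auto simp: Rp_diag B_i u_i s_i mult_ac)
    show ?thesis
      unfolding unf m(1) hat_hat[OF m(3)] Rp_low[OF lt] Rm_4[OF m(2,3)] Rp
      using nz by (auto simp: A_i B_i u_i s_i power2_eq_square mult_ac)
  qed
qed

lemma inner_row_high:
  assumes k: "i < k" "k \<le> n" and c: "i \<le> c" "c \<le> 2 * n + 2 - i"
  shows "Rm (2 * n + 2 - k) c = Rm (2 * n + 2 - k) (2 * n + 2 - i) * Rp i (2 * n + 2 - c)
      - D k * Rp k (2 * n + 2 - c)"
proof -
  note k' = less_imp_le[OF k(1)]
  note nz = i d_nz e_cases[of n] e_cases[of k] e_cases[of c] B_nz[of n] A_nz[of n] B_nz[of k] A_nz[of k]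
    t_nz[OF k] s_nz[OF k' k(2)] k
  note unf = Rm_5'[OF order.refl k] D_low[OF k] A_i B_i
  consider "c \<le> n" | "c = Suc n" | "Suc n < c" by linarith
  then show ?thesis
  proof cases
    case 1
    then have lt: "c < 2 * n + 2 - k" using k by simp
    show ?thesis
      unfolding unf Rm_low[OF lt] Rp_3[OF order.refl i(2) c(1) 1] Rp_3[OF k' k(2) c(1) 1]
      using nz by (auto simp: A_i B_i u_i s_i power2_eq_square mult_ac)
  next
    case 2
    have lt: "Suc n < 2 * n + 2 - k" using k by simp
    show ?thesis
      unfolding unf 2 hat_mid Rm_low[OF lt] Rp_2[OF order.refl i(2)] Rp_2[OF k' k(2)]
      using nz by (auto simp: A_i B_i u_i s_i mult_ac)
  next
    case 3
    define m where "m = 2 * n + 2 - c"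
    then have m: "c = 2 * n + 2 - m" "i \<le> m" "m \<le> n" using 3 c by auto
    have Rp: "Rp i m = 1 / B m"
      using Rp_1[of i m] m by (cases "m = i") (auto simp: Rp_diag B_i u_i s_i mult_ac)
    consider "m < k" | "m = k" | "k < m" by linarith
    then show ?thesis
    proof cases
      case 1
      show ?thesis
        unfolding unf m(1) hat_hat[OF m(3)] Rp_low[OF 1] Rm_5'[OF m(2) 1 k(2)] Rp
        using nz by (auto simp: A_i B_i u_i s_i mult_ac)
    next
      case 2
      show ?thesis
        unfolding unf m(1) hat_hat[OF m(3)] unfolding 2 Rp_diag Rm_diag Rp[unfolded 2]
        using nz u[OF k] by (auto simp: A_i B_i u_i s_i field_simps)
    next
      case 3
      then have lt: "2 * n + 2 - m < 2 * n + 2 - k" using m by simp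
      have "i < m" using k 3 by simp
      show ?thesis
        unfolding unf m(1) hat_hat[OF m(3)] Rm_low[OF lt] Rp
          Rp_1[OF k' less_imp_le[OF 3] m(3) \<open>i < m\<close> 3]
        using nz by (auto simp: A_i B_i u_i s_i mult_ac)
    qed
  qed
qed

lemma inner_row:
  assumes "i < r" "r < 2 * n + 2 - i" "i \<le> c" "c \<le> 2 * n + 2 - i"
  shows "Rm r c = Rm r (2 * n + 2 - i) * Rp i (2 * n + 2 - c)
      - D (2 * n + 2 - r) * Rp (2 * n + 2 - r) (2 * n + 2 - c)"
proof -
  consider "r \<le> n" | "r = Suc n" | "Suc n < r" by linarith
  then show ?thesis
  proof cases
    case 1
    then show ?thesis using assms by (intro inner_row_low)
  next
    case 2
    then show ?thesis using inner_row_mid[OF assms(3,4)] by (simp only: hat_mid)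
  next
    case 3
    define k where "k = 2 * n + 2 - r"
    then have k: "r = 2 * n + 2 - k" "i < k" "k \<le> n" using 3 assms by auto
    show ?thesis using inner_row_high[OF k(2,3) assms(3,4)] by (simp only: k(1) hat_hat[OF k(3)])
  qed
qed

end

subsection \<open>The orthogonal group\<close>

definition opp :: "nat \<Rightarrow> nat \<Rightarrow> nat" where
  "opp n m = 2 * n + 2 - m"

lemma opp_Idx [simp]: "m \<in> Idx n \<Longrightarrow> opp n m \<in> Idx n"
  by (auto simp: opp_def)

lemma opp_opp [simp]: "m \<in> Idx n \<Longrightarrow> opp n (opp n m) = m"
  by (auto simp: opp_def)

lemma opp_add: "m \<in> Idx n \<Longrightarrow> m + opp n m = 2 * n + 2"
  by (auto simp: opp_def)

lemma opp_less: "r \<in> Idx n \<Longrightarrow> c \<in> Idx n \<Longrightarrow> opp n c < opp n r \<longleftrightarrow> r < c"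
  by (auto simp: opp_def)

lemma opp_eq: "r \<in> Idx n \<Longrightarrow> c \<in> Idx n \<Longrightarrow> opp n c = opp n r \<longleftrightarrow> c = r"
  by (auto simp: opp_def)

lemma sum_opp: "(\<Sum>m\<in>Idx n. f (opp n m)) = (\<Sum>m\<in>Idx n. f m)"
  by (rule sum.reindex_bij_witness[of _ "opp n" "opp n"]) (simp_all del: mem_Idx)

text \<open>The adjoint for the bilinear form, namely the transpose about the antidiagonal. Thus
  \<open>orth\<close> says that the form is preserved, and \<open>dag\<close> serves as the
  inverse.\<close>

definition dag :: "nat \<Rightarrow> ratfun mat \<Rightarrow> ratfun mat" where
  "dag n A = emat n (\<lambda>r c. ent A (opp n c) (opp n r))"

lemma dag_Mats [simp]: "dag n A \<in> Mats n"
  by (simp add: dag_def)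

lemma ent_dag: "r \<in> Idx n \<Longrightarrow> c \<in> Idx n \<Longrightarrow> ent (dag n A) r c = ent A (opp n c) (opp n r)"
  by (simp add: dag_def del: mem_Idx)

lemma dag_dag: "A \<in> Mats n \<Longrightarrow> dag n (dag n A) = A"
  by (rule mat_eqI_ent[of _ n]) (simp_all add: ent_dag opp_Idx opp_opp del: mem_Idx)

lemma dag_mult:
  assumes "A \<in> Mats n" "B \<in> Mats n"
  shows "dag n (A * B) = dag n B * dag n A"
proof (rule mat_eqI_ent[of _ n])
  fix r c assume rc: "r \<in> Idx n" "c \<in> Idx n"
  have "ent (dag n (A * B)) r c = (\<Sum>m\<in>Idx n. ent A (opp n c) m * ent B m (opp n r))"
    by (simp only: ent_dag rc ent_mult[OF assms] opp_Idx)
  also have "\<dots> = (\<Sum>m\<in>Idx n. ent A (opp n c) (opp n m) * ent B (opp n m) (opp n r))"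
    by (rule sum_opp[symmetric])
  also have "\<dots> = ent (dag n B * dag n A) r c"
    unfolding ent_mult[OF dag_Mats dag_Mats rc]
    by (rule sum.cong) (simp_all add: ent_dag rc mult.commute del: mem_Idx)
  finally show "ent (dag n (A * B)) r c = ent (dag n B * dag n A) r c" .
qed (use assms in auto)

definition orth :: "nat \<Rightarrow> ratfun mat \<Rightarrow> bool" where
  "orth n A \<longleftrightarrow> A \<in> Mats n \<and> dag n A * A = idm n"

lemma orthD: "orth n A \<Longrightarrow> A \<in> Mats n" "orth n A \<Longrightarrow> dag n A * A = idm n"
  by (auto simp: orth_def)

lemma orth_right: "orth n A \<Longrightarrow> A * dag n A = idm n"
  using mat_mult_left_right_inverse[of "dag n A" "dimN n" A]
  by (auto simp: orth_def Mats_def idm_def dag_def emat_def)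

lemma dag_idm: "dag n (idm n) = idm n"
  by (rule mat_eqI_ent[of _ n]) (simp_all add: ent_dag ent_idm opp_eq del: mem_Idx)

lemma orth_idm: "orth n (idm n)"
  by (simp add: orth_def dag_idm)

lemma orth_mult: "orth n A \<Longrightarrow> orth n B \<Longrightarrow> orth n (A * B)"
proof -
  assume A: "orth n A" and B: "orth n B"
  note [simp] = orthD(1)[OF A] orthD(1)[OF B]
  have "dag n (A * B) * (A * B) = dag n B * (dag n A * A) * B"
    by (simp add: dag_mult Mats_assoc[of _ n])
  then show ?thesis by (simp add: orth_def orthD(2)[OF A] orthD(2)[OF B])
qed

lemma orth_dag: "orth n A \<Longrightarrow> orth n (dag n A)"
  by (simp add: orth_def dag_dag orth_right[unfolded orth_def])

lemma orth_mprod: "(\<And>A. A \<in> set As \<Longrightarrow> orth n A) \<Longrightarrow> orth n (mprod n As)"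
  by (induction As) (auto simp: orth_idm intro: orth_mult)

text \<open>The middle index is its own opposite, so the three parts of the form become one sum over
  all indices.\<close>

lemma bform_sum:
  "bform n x y = (\<Sum>m\<in>Idx n. x $ (m - 1) * y $ (opp n m - 1))"
proof -
  have I: "Idx n = {1..n} \<union> {n + 1} \<union> {n + 2..2 * n + 1}" by (auto simp: Idx_def)
  have "(\<Sum>m\<in>Idx n. x $ (m - 1) * y $ (hat n m - 1))
      = (\<Sum>m\<in>{1..n}. x $ (m - 1) * y $ (hat n m - 1)) + x $ n * y $ n
        + (\<Sum>m\<in>{n + 2..2 * n + 1}. x $ (m - 1) * y $ (hat n m - 1))"
    unfolding I by (subst sum.union_disjoint, simp, simp, force)+ simp
  also have "(\<Sum>m\<in>{n + 2..2 * n + 1}. x $ (m - 1) * y $ (hat n m - 1))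
      = (\<Sum>m\<in>{1..n}. x $ (hat n m - 1) * y $ (m - 1))"
    by (rule sum.reindex_bij_witness[of _ "hat n" "hat n"]) auto
  finally show ?thesis by (simp add: opp_def bform_def sum.distrib algebra_simps)
qed

lemma index_mult_mat_vec_Idx:
  assumes "A \<in> Mats n" "x \<in> carrier_vec (dimN n)" "m \<in> Idx n"
  shows "(A *\<^sub>v x) $ (m - 1) = (\<Sum>a\<in>Idx n. ent A m a * x $ (a - 1))"
proof -
  have "(A *\<^sub>v x) $ (m - 1) = (\<Sum>k<dimN n. A $$ (m - 1, k) * x $ k)"
    using assms by (auto simp: Mats_def scalar_prod_def atLeast0LessThan)
  also have "\<dots> = (\<Sum>a\<in>Idx n. ent A m a * x $ (a - 1))"
    using sum.atLeast1_atMost_eq[of "\<lambda>a. ent A m a * x $ (a - 1)" "2 * n + 1"]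
    by (simp add: ent_def Idx_def)
  finally show ?thesis .
qed

lemma orth_SO:
  assumes A: "orth n A" and "Determinant.det A = 1"
  shows "A \<in> SO_mats n"
proof -
  have M: "A \<in> Mats n" using A by (rule orthD)
  have "bform n (A *\<^sub>v x) (A *\<^sub>v y) = bform n x y"
    if x: "x \<in> carrier_vec (dimN n)" and y: "y \<in> carrier_vec (dimN n)" for x y
  proof -
    have "bform n (A *\<^sub>v x) (A *\<^sub>v y) = (\<Sum>m\<in>Idx n. (\<Sum>a\<in>Idx n. ent A m a * x $ (a - 1))
        * (\<Sum>b\<in>Idx n. ent A (opp n m) b * y $ (b - 1)))"
      unfolding bform_sum
      by (intro sum.cong refl) (simp only: index_mult_mat_vec_Idx[OF M x] index_mult_mat_vec_Idx[OF M y] opp_Idx)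
    also have "\<dots> = (\<Sum>m\<in>Idx n. \<Sum>a\<in>Idx n. \<Sum>b\<in>Idx n.
        x $ (a - 1) * y $ (b - 1) * (ent A (opp n m) b * ent A m a))"
      by (simp only: sum_product mult_ac)
    \<comment> \<open>With the sum over \<open>m\<close> innermost, an entry of
      \<open>dag n A * A\<close> appears.\<close>
    also have "\<dots> = (\<Sum>a\<in>Idx n. \<Sum>b\<in>Idx n. \<Sum>m\<in>Idx n.
        x $ (a - 1) * y $ (b - 1) * (ent A (opp n m) b * ent A m a))"
      by (subst sum.swap) (intro sum.cong[OF refl] sum.swap)
    also have "\<dots> = (\<Sum>a\<in>Idx n. \<Sum>b\<in>Idx n. x $ (a - 1) * y $ (b - 1) * ent (dag n A * A) (opp n b) a)"
    proof (intro sum.cong refl)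
      fix a b assume ab: "a \<in> Idx n" "b \<in> Idx n"
      have "ent (dag n A * A) (opp n b) a = (\<Sum>m\<in>Idx n. ent A (opp n m) b * ent A m a)"
        unfolding ent_mult[OF dag_Mats M opp_Idx[OF ab(2)] ab(1)]
        by (intro sum.cong refl) (simp only: ent_dag opp_Idx ab opp_opp)
      then show "(\<Sum>m\<in>Idx n. x $ (a - 1) * y $ (b - 1) * (ent A (opp n m) b * ent A m a))
          = x $ (a - 1) * y $ (b - 1) * ent (dag n A * A) (opp n b) a"
        by (simp only: sum_distrib_left)
    qed
    also have "\<dots> = (\<Sum>a\<in>Idx n. \<Sum>b\<in>Idx n. if b = opp n a then x $ (a - 1) * y $ (b - 1) else 0)"
      unfolding orthD(2)[OF A]
      by (intro sum.cong refl) (auto simp: ent_idm opp_eq[symmetric] simp del: mem_Idx)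
    also have "\<dots> = bform n x y"
      unfolding bform_sum by (intro sum.cong refl) (simp only: sum.delta finite_Idx opp_Idx if_True)
    finally show ?thesis .
  qed
  then show ?thesis using assms(2) M by (simp add: SO_mats_def Mats_def)
qed

subsection \<open>Triangular and diagonal matrices\<close>

definition lowtri :: "nat \<Rightarrow> ratfun mat \<Rightarrow> bool" where
  "lowtri n A \<longleftrightarrow> A \<in> Mats n \<and> (\<forall>r\<in>Idx n. \<forall>c\<in>Idx n. r < c \<longrightarrow> ent A r c = 0)"

definition upuni :: "nat \<Rightarrow> ratfun mat \<Rightarrow> bool" where
  "upuni n A \<longleftrightarrow> A \<in> Mats n \<and> (\<forall>r\<in>Idx n. \<forall>c\<in>Idx n. (c < r \<longrightarrow> ent A r c = 0) \<and> (c = r \<longrightarrow> ent A r c = 1))"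

definition dg :: "nat \<Rightarrow> (nat \<Rightarrow> ratfun) \<Rightarrow> ratfun mat" where
  "dg n f = emat n (\<lambda>r c. if r = c then f r else 0)"

lemma dg_Mats [simp]: "dg n f \<in> Mats n"
  by (simp add: dg_def)

text \<open>Used for diagonal, block, triangular and permutation matrices, where a single index
  contributes to the entry in question.\<close>

lemma ent_mult_single:
  assumes "A \<in> Mats n" "B \<in> Mats n" "r \<in> Idx n" "c \<in> Idx n" "k \<in> Idx n"
    and "\<And>m. m \<in> Idx n \<Longrightarrow> m \<noteq> k \<Longrightarrow> ent A r m = 0 \<or> ent B m c = 0"
  shows "ent (A * B) r c = ent A r k * ent B k c"
proof -
  have "ent (A * B) r c = (\<Sum>m\<in>{k}. ent A r m * ent B m c)"
    unfolding ent_mult[OF assms(1-4)]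
    by (rule sum.mono_neutral_right) (use assms(5,6) in \<open>auto simp del: mem_Idx\<close>)
  then show ?thesis by simp
qed

lemma ent_dg_mult:
  assumes "A \<in> Mats n" "r \<in> Idx n" "c \<in> Idx n"
  shows "ent (dg n f * A) r c = f r * ent A r c" "ent (A * dg n f) r c = ent A r c * f c"
  using ent_mult_single[OF dg_Mats assms(1) assms(2,3) assms(2), of f]
    ent_mult_single[OF assms(1) dg_Mats assms(2,3) assms(3), of f] assms
  by (simp_all add: dg_def del: mem_Idx)

lemma ent_dg: "r \<in> Idx n \<Longrightarrow> c \<in> Idx n \<Longrightarrow> ent (dg n f) r c = (if r = c then f r else 0)"
  by (simp add: dg_def del: mem_Idx)

lemma dg_mult: "dg n f * dg n g = dg n (\<lambda>k. f k * g k)"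
  by (rule mat_eqI_ent[of _ n]) (simp_all add: ent_dg_mult ent_dg del: mem_Idx)

lemma dg_cong: "(\<And>k. k \<in> Idx n \<Longrightarrow> f k = g k) \<Longrightarrow> dg n f = dg n g"
  by (rule mat_eqI_ent[of _ n]) (simp_all add: ent_dg del: mem_Idx)

lemma dg_one: "dg n (\<lambda>_. 1) = idm n"
  by (rule mat_eqI_ent[of _ n]) (simp_all add: ent_dg ent_idm del: mem_Idx)

lemma dag_dg: "dag n (dg n f) = dg n (\<lambda>k. f (opp n k))"
  by (rule mat_eqI_ent[of _ n]) (auto simp: ent_dag ent_dg opp_eq simp del: mem_Idx)

lemma orth_dg: "(\<And>k. k \<in> Idx n \<Longrightarrow> f k * f (opp n k) = 1) \<Longrightarrow> orth n (dg n f)"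
  unfolding orth_def dag_dg dg_mult
  by (simp add: dg_one[symmetric] del: mem_Idx) (rule dg_cong, simp add: mult.commute del: mem_Idx)

lemma lowtri_mult:
  assumes "lowtri n A" "lowtri n B"
  shows "lowtri n (A * B)" "r \<in> Idx n \<Longrightarrow> ent (A * B) r r = ent A r r * ent B r r"
proof -
  note M = assms[unfolded lowtri_def, THEN conjunct1]
  have z: "ent A r m = 0" if "r < m" "r \<in> Idx n" "m \<in> Idx n" for r m
    using assms(1) that unfolding lowtri_def by blast
  have z': "ent B r m = 0" if "r < m" "r \<in> Idx n" "m \<in> Idx n" for r m
    using assms(2) that unfolding lowtri_def by blast
  show "lowtri n (A * B)"
    unfolding lowtri_def
  proof (intro conjI ballI impI)
    fix r c assume rc: "r \<in> Idx n" "c \<in> Idx n" "r < c"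
    have "ent A r m * ent B m c = 0" if "m \<in> Idx n" for m
      using z[OF _ rc(1) that] z'[OF _ that rc(2)] rc(3) by (cases "r < m") auto
    then show "ent (A * B) r c = 0" unfolding ent_mult[OF M rc(1,2)] by (intro sum.neutral ballI)
  qed (use M in simp)
  show "r \<in> Idx n \<Longrightarrow> ent (A * B) r r = ent A r r * ent B r r"
    by (rule ent_mult_single[OF M]) (use z z' in \<open>auto simp del: mem_Idx simp: neq_iff\<close>)
qed

lemma lowtri_dag: "lowtri n A \<Longrightarrow> lowtri n (dag n A)"
  unfolding lowtri_def by (simp add: ent_dag opp_less del: mem_Idx)

lemma lowtri_dg: "lowtri n (dg n f)"
  unfolding lowtri_def by (auto simp: ent_dg)

lemma upuni_mult:
  assumes "upuni n A" "upuni n B"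
  shows "upuni n (A * B)"
proof -
  note M = assms[unfolded upuni_def, THEN conjunct1]
  have z: "ent A r m = 0" if "m < r" "r \<in> Idx n" "m \<in> Idx n" for r m
    using assms(1) that unfolding upuni_def by blast
  have z': "ent B r m = 0" if "m < r" "r \<in> Idx n" "m \<in> Idx n" for r m
    using assms(2) that unfolding upuni_def by blast
  have d: "ent A r r = 1" "ent B r r = 1" if "r \<in> Idx n" for r
    using assms that unfolding upuni_def by blast+
  show ?thesis
    unfolding upuni_def
  proof (intro conjI ballI impI)
    fix r c assume rc: "r \<in> Idx n" "c \<in> Idx n" "c < r"
    have "ent A r m * ent B m c = 0" if "m \<in> Idx n" for m
      using z[OF _ rc(1) that] z'[OF _ that rc(2)] rc(3) by (cases "m < r") auto
    then show "ent (A * B) r c = 0" unfolding ent_mult[OF M rc(1,2)] by (intro sum.neutral ballI)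
  next
    fix r c assume rc: "r \<in> Idx n" "c \<in> Idx n" "c = r"
    have "ent (A * B) r r = ent A r r * ent B r r"
      by (rule ent_mult_single[OF M rc(1,1,1)]) (use z z' rc in \<open>auto simp del: mem_Idx simp: neq_iff\<close>)
    then show "ent (A * B) r c = 1" using rc d by simp
  qed (use M in simp)
qed

lemma upuni_idm: "upuni n (idm n)"
  unfolding upuni_def by (auto simp: ent_idm)

lemma upuniD:
  assumes "upuni n A" "r \<in> Idx n" "c \<in> Idx n"
  shows "c < r \<Longrightarrow> ent A r c = 0" "ent A r r = 1"
  using assms unfolding upuni_def by blast+

lemma upuni_dag:
  assumes "upuni n A"
  shows "upuni n (dag n A)"
  unfolding upuni_def
proof (intro conjI ballI impI)
  fix r c assume rc: "r \<in> Idx n" "c \<in> Idx n"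
  show "c < r \<Longrightarrow> ent (dag n A) r c = 0"
    using upuniD(1)[OF assms opp_Idx[OF rc(2)] opp_Idx[OF rc(1)]] opp_less[OF rc(2,1)]
    by (simp only: ent_dag rc)
  show "c = r \<Longrightarrow> ent (dag n A) r c = 1"
    using upuniD(2)[OF assms opp_Idx[OF rc(1)] opp_Idx[OF rc(1)]] by (simp only: ent_dag rc)
qed simp

lemma det_unitri:
  assumes "A \<in> Mats n" "\<And>r. r \<in> Idx n \<Longrightarrow> ent A r r = 1"
    and "(\<forall>r\<in>Idx n. \<forall>c\<in>Idx n. c < r \<longrightarrow> ent A r c = 0) \<or> (\<forall>r\<in>Idx n. \<forall>c\<in>Idx n. r < c \<longrightarrow> ent A r c = 0)"
  shows "Determinant.det A = 1"
proof -
  have d: "A $$ (i, i) = 1" if "i < dimN n" for i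
    using assms(2)[of "i + 1"] that by (auto simp: ent_def)
  have "Determinant.det A = prod_list (diag_mat A)"
    using assms(3)
  proof
    assume *: "\<forall>r\<in>Idx n. \<forall>c\<in>Idx n. c < r \<longrightarrow> ent A r c = 0"
    have "A $$ (i, j) = 0" if "j < i" "i < dimN n" for i j
      using *[rule_format, of "i + 1" "j + 1"] that by (auto simp: ent_def)
    then have "upper_triangular A" using assms(1) by (auto simp: Mats_def)
    then show ?thesis using assms(1) by (intro det_upper_triangular[of _ "dimN n"]) (auto simp: Mats_def)
  next
    assume *: "\<forall>r\<in>Idx n. \<forall>c\<in>Idx n. r < c \<longrightarrow> ent A r c = 0"
    have "A $$ (i, j) = 0" if "i < j" "j < dimN n" for i j
      using *[rule_format, of "i + 1" "j + 1"] that by (auto simp: ent_def)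
    then show ?thesis using assms(1) by (intro det_lower_triangular[of "dimN n"]) (auto simp: Mats_def)
  qed
  also have "\<dots> = 1"
    using assms(1) d by (auto simp: prod_list_diag_prod Mats_def intro!: prod.neutral)
  finally show ?thesis .
qed

text \<open>Cancelling \<open>Y'\<close> and \<open>X\<close> by their adjoints leaves
  \<open>L * dg n f = dg n f' * U\<close> with \<open>L\<close> lower and \<open>U\<close> upper
  unipotent. The diagonals give f = f'; above the diagonal the left side vanishes, so U is the
  identity because f' has no zero.\<close>

lemma gauss_unique:
  assumes Y: "lowtri n Y" "\<And>r. r \<in> Idx n \<Longrightarrow> ent Y r r = 1"
    and Y': "lowtri n Y'" "\<And>r. r \<in> Idx n \<Longrightarrow> ent Y' r r = 1" "orth n Y'"
    and X: "upuni n X" "orth n X" and X': "upuni n X'"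
    and f': "\<And>r. r \<in> Idx n \<Longrightarrow> f' r \<noteq> 0"
    and eq: "Y * dg n f * X = Y' * dg n f' * X'"
  shows "dg n f = dg n f'" "X = X'"
proof -
  note [simp] = orthD(1)[OF X(2)] orthD(1)[OF Y'(3)]
  have [simp]: "Y \<in> Mats n" "X' \<in> Mats n" using Y X' by (auto simp: lowtri_def upuni_def)
  let ?L = "dag n Y' * Y" and ?U = "X' * dag n X"
  have "dag n Y' * (Y * dg n f * X) * dag n X = dag n Y' * (Y' * dg n f' * X') * dag n X"
    by (simp only: eq)
  also have "dag n Y' * (Y * dg n f * X) * dag n X = ?L * dg n f * (X * dag n X)"
    by (simp add: Mats_assoc[of _ n])
  also have "dag n Y' * (Y' * dg n f' * X') * dag n X = (dag n Y' * Y') * (dg n f' * ?U)"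
    by (simp add: Mats_assoc[of _ n])
  finally have main: "?L * dg n f = dg n f' * ?U"
    by (simp add: orth_right[OF X(2)] orthD(2)[OF Y'(3)])
  have L: "lowtri n ?L" by (intro lowtri_mult lowtri_dag Y Y')
  have Ld: "ent ?L r r = 1" if "r \<in> Idx n" for r
    using that by (simp only: lowtri_mult(2)[OF lowtri_dag[OF Y'(1)] Y(1)] ent_dag opp_Idx Y Y' mult_1_left)
  have U: "upuni n ?U" by (intro upuni_mult upuni_dag X X')
  have e: "ent ?L r c * f c = f' r * ent ?U r c" if "r \<in> Idx n" "c \<in> Idx n" for r c
    using arg_cong[OF main, of "\<lambda>A. ent A r c"] that by (simp add: ent_dg_mult del: mem_Idx)
  have d: "f r = f' r" if "r \<in> Idx n" for r
    using e[OF that that] Ld[OF that] U that unfolding upuni_def by (simp del: mem_Idx)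
  then show "dg n f = dg n f'" by (rule dg_cong)
  have "?U = idm n"
  proof (rule mat_eqI_ent[of _ n])
    fix r c assume rc: "r \<in> Idx n" "c \<in> Idx n"
    consider "r < c" | "r = c" | "c < r" by linarith
    then show "ent ?U r c = ent (idm n) r c"
    proof cases
      case 1
      then have "f' r * ent ?U r c = 0" using e[OF rc] L rc unfolding lowtri_def by (metis mult_zero_left)
      then show ?thesis using f'[OF rc(1)] 1 rc by (simp add: ent_idm del: mem_Idx)
    qed (use U rc in \<open>auto simp: upuni_def ent_idm simp del: mem_Idx\<close>)
  qed auto
  then have "X' * dag n X * X = X" by simp
  then show "X = X'" by (simp add: Mats_assoc[of _ n] orthD(2)[OF X(2)])
qed

subsection \<open>Block matrices\<close>

definition blk :: "nat \<Rightarrow> nat \<Rightarrow> ratfun mat \<Rightarrow> bool" where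
  "blk n i A \<longleftrightarrow> A \<in> Mats n \<and> (\<forall>r\<in>Idx n. \<forall>c\<in>Idx n.
     (r < i \<or> opp n i < r \<or> c < i \<or> opp n i < c) \<longrightarrow> ent A r c = (if r = c then 1 else 0))"

lemma blkD:
  assumes "blk n i A" "r \<in> Idx n" "c \<in> Idx n" "r < i \<or> opp n i < r \<or> c < i \<or> opp n i < c"
  shows "ent A r c = (if r = c then 1 else 0)"
  using assms unfolding blk_def by blast

lemma blk_Mats: "blk n i A \<Longrightarrow> A \<in> Mats n"
  by (simp add: blk_def)

lemma blk_idm: "blk n i (idm n)"
  by (auto simp: blk_def ent_idm)

lemma blk_mult:
  assumes A: "blk n i A" and B: "blk n i B"
  shows "blk n i (A * B)"
  unfolding blk_def
proof (intro conjI ballI impI)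
  fix r c assume rc: "r \<in> Idx n" "c \<in> Idx n" and out: "r < i \<or> opp n i < r \<or> c < i \<or> opp n i < c"
  note M = blk_Mats[OF A] blk_Mats[OF B]
  show "ent (A * B) r c = (if r = c then 1 else 0)"
  proof (cases "r < i \<or> opp n i < r")
    case True
    have "ent (A * B) r c = ent A r r * ent B r c"
      by (rule ent_mult_single[OF M rc rc(1)]) (use True in \<open>auto simp: blkD[OF A rc(1)] simp del: mem_Idx\<close>)
    with True show ?thesis using blkD[OF A rc(1,1)] blkD[OF B rc] by auto
  next
    case False
    with out have c: "c < i \<or> opp n i < c" by blast
    have "ent (A * B) r c = ent A r c * ent B c c"
      by (rule ent_mult_single[OF M rc rc(2)]) (use c in \<open>auto simp: blkD[OF B _ rc(2)] simp del: mem_Idx\<close>)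
    with c show ?thesis using blkD[OF A rc] blkD[OF B rc(2,2)] by auto
  qed
qed (use assms in \<open>simp add: blk_Mats\<close>)

lemma blk_dag: "blk n i A \<Longrightarrow> i \<in> Idx n \<Longrightarrow> blk n i (dag n A)"
proof -
  assume A: "blk n i A" and i: "i \<in> Idx n"
  have "opp n r < i \<longleftrightarrow> opp n i < r" "opp n i < opp n r \<longleftrightarrow> r < i" if "r \<in> Idx n" for r
    using opp_less[OF i opp_Idx[OF that]] opp_less[OF that i] that i by (auto simp: opp_def)
  then show ?thesis
    using A unfolding blk_def by (auto simp: ent_dag opp_eq simp del: mem_Idx)
qed

lemma blk_mono: "blk n (Suc i) A \<Longrightarrow> blk n i A"
  unfolding blk_def by (auto simp: opp_def simp del: mem_Idx)

text \<open>The shape of the matrix $Z$.  Its row \<open>opp n i\<close> need not be controlled: it is the last row of the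
  block, hence irrelevant for triangularity, and orthogonality fixes its diagonal entry.\<close>

definition para :: "nat \<Rightarrow> nat \<Rightarrow> ratfun \<Rightarrow> ratfun mat \<Rightarrow> bool" where
  "para n i a Z \<longleftrightarrow> blk n i Z \<and> (\<forall>c\<in>Idx n. ent Z i c = (if c = i then a else 0)) \<and>
     (\<forall>r\<in>Idx n. \<forall>c\<in>Idx n. i < r \<and> r < opp n i \<and> c \<noteq> i \<longrightarrow> ent Z r c = (if r = c then 1 else 0))"

text \<open>Since \<open>Q * dag n Q\<close> is the identity, row r of \<open>L * dag n Q\<close>
  lists the coefficients of row r of \<open>L\<close> in terms of the rows of \<open>Q\<close>. A
  multiple of row i of \<open>Q\<close> therefore shows up in column i only, the column in which the
  shape leaves the middle rows free.\<close>

lemma para_rows: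
  assumes L: "blk n i L" and Q: "blk n i Q" "orth n Q" and i: "i \<in> Idx n"
    and row_i: "\<And>c. c \<in> Idx n \<Longrightarrow> ent L i c = a * ent Q i c"
    and rows: "\<And>r c. r \<in> Idx n \<Longrightarrow> c \<in> Idx n \<Longrightarrow> i < r \<Longrightarrow> r < opp n i \<Longrightarrow>
        ent L r c = ent Q r c + v r * ent Q i c"
  shows "para n i a (L * dag n Q)"
proof -
  note LM = blk_Mats[OF L] and QM = blk_Mats[OF Q(1)]
  have QQ: "(\<Sum>m\<in>Idx n. ent Q r m * ent (dag n Q) m c) = (if r = c then 1 else 0)"
    if "r \<in> Idx n" "c \<in> Idx n" for r c
    using arg_cong[OF orth_right[OF Q(2)], of "\<lambda>A. ent A r c"] that
    by (simp add: ent_mult[OF QM dag_Mats] ent_idm del: mem_Idx)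
  have "ent (L * dag n Q) i c = (if c = i then a else 0)" if c: "c \<in> Idx n" for c
  proof -
    have "ent (L * dag n Q) i c = (\<Sum>m\<in>Idx n. a * (ent Q i m * ent (dag n Q) m c))"
      unfolding ent_mult[OF LM dag_Mats i c] by (intro sum.cong) (simp_all add: row_i del: mem_Idx)
    then show ?thesis by (auto simp: sum_distrib_left[symmetric] QQ[OF i c])
  qed
  moreover have "ent (L * dag n Q) r c = (if r = c then 1 else 0)"
    if r: "r \<in> Idx n" "i < r" "r < opp n i" and c: "c \<in> Idx n" "c \<noteq> i" for r c
  proof -
    have "ent (L * dag n Q) r c
        = (\<Sum>m\<in>Idx n. ent Q r m * ent (dag n Q) m c + v r * (ent Q i m * ent (dag n Q) m c))"
      unfolding ent_mult[OF LM dag_Mats r(1) c(1)]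
      by (intro sum.cong) (simp_all add: rows r distrib_right mult.assoc del: mem_Idx)
    then show ?thesis using c
      by (simp add: sum.distrib sum_distrib_left[symmetric] QQ[OF i c(1)] QQ[OF r(1) c(1)] del: mem_Idx)
  qed
  moreover have "blk n i (L * dag n Q)" by (intro blk_mult blk_dag L Q i)
  ultimately show ?thesis unfolding para_def by auto
qed

text \<open>\<open>X\<close> fixes the coordinates i and \<open>opp n i\<close> and mixes only the
  ones between. Up to column i the middle rows of \<open>Z\<close> are those of the identity, and
  this survives the conjugation.\<close>

lemma para_conj:
  assumes Z: "para n i a Z" and X: "blk n (Suc i) X" "orth n X" and i: "1 \<le> i" "i \<le> n"
  shows "para n i a (X * Z * dag n X)"
proof -
  have iI: "i \<in> Idx n" "Suc i \<in> Idx n" using i by auto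
  have ZB: "blk n i Z" using Z by (simp add: para_def)
  note XM = blk_Mats[OF X(1)] and ZM = blk_Mats[OF ZB]
  have dX: "blk n (Suc i) (dag n X)" using X(1) iI(2) by (rule blk_dag)
  have Xi: "ent X i c = (if i = c then 1 else 0)" "ent (dag n X) i c = (if i = c then 1 else 0)"
    if "c \<in> Idx n" for c
    using blkD[OF X(1) iI(1) that] blkD[OF dX iI(1) that] by auto
  have XZ: "ent (X * Z) i c = (if c = i then a else 0)" if c: "c \<in> Idx n" for c
  proof -
    have "ent (X * Z) i c = ent X i i * ent Z i c"
      by (rule ent_mult_single[OF XM ZM iI(1) c iI(1)]) (use Xi in \<open>auto simp del: mem_Idx\<close>)
    then show ?thesis using Z c Xi[OF iI(1)] by (simp add: para_def del: mem_Idx)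
  qed
  have XZr: "ent (X * Z) r c = ent X r c" if r: "r \<in> Idx n" "i < r" "r < opp n i" and c: "c \<in> Idx n" "c \<noteq> i" for r c
  proof -
    have "ent X r m * ent Z m c = (if m = c then ent X r c else 0)" if m: "m \<in> Idx n" for m
    proof (cases "i < m \<and> m < opp n i")
      case True
      then show ?thesis using Z m c by (auto simp: para_def simp del: mem_Idx)
    next
      case False
      then have "m < Suc i \<or> opp n (Suc i) < m" by (auto simp: opp_def)
      then have "ent X r m = (if r = m then 1 else 0)" using blkD[OF X(1) r(1) m] by blast
      then show ?thesis using False r by auto
    qed
    then show ?thesis unfolding ent_mult[OF XM ZM r(1) c(1)] using c(1) by (simp del: mem_Idx)
  qed
  have "ent (X * Z * dag n X) i c = (if c = i then a else 0)" if c: "c \<in> Idx n" for c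
  proof -
    have "ent (X * Z * dag n X) i c = ent (X * Z) i i * ent (dag n X) i c"
      by (rule ent_mult_single[OF _ dag_Mats iI(1) c iI(1)]) (use XZ XM ZM in \<open>auto simp del: mem_Idx\<close>)
    then show ?thesis using c by (simp add: XZ iI Xi del: mem_Idx)
  qed
  moreover have "ent (X * Z * dag n X) r c = (if r = c then 1 else 0)"
    if r: "r \<in> Idx n" "i < r" "r < opp n i" and c: "c \<in> Idx n" "c \<noteq> i" for r c
  proof -
    have "ent (X * Z * dag n X) r c = (\<Sum>m\<in>Idx n. ent X r m * ent (dag n X) m c)"
      unfolding ent_mult[OF Mats_mult[OF XM ZM] dag_Mats r(1) c(1)]
    proof (intro sum.cong refl)
      \<comment> \<open>Only in column i may \<open>X * Z\<close> differ from \<open>X\<close> in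
        this row, and there the second factor vanishes because \<open>c \<noteq> i\<close>.\<close>
      fix m assume "m \<in> Idx n"
      then show "ent (X * Z) r m * ent (dag n X) m c = ent X r m * ent (dag n X) m c"
        using XZr[OF r] Xi(2)[OF c(1)] c(2) by (cases "m = i") auto
    qed
    also have "\<dots> = (if r = c then 1 else 0)"
      using arg_cong[OF orth_right[OF X(2)], of "\<lambda>A. ent A r c"] r c
      by (simp add: ent_mult[OF XM dag_Mats] ent_idm del: mem_Idx)
    finally show ?thesis .
  qed
  moreover have "blk n i (X * Z * dag n X)" by (intro blk_mult blk_mono[OF X(1)] blk_mono[OF dX] ZB)
  ultimately show ?thesis unfolding para_def by auto
qed

text \<open>Row i has only its diagonal entry, the free entries of the middle rows lie in column i
  and so left of the diagonal, and row \<open>opp n i\<close> ends the block.\<close>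

lemma para_lowtri:
  assumes Z: "para n i a Z" and i: "1 \<le> i" "i \<le> n"
  shows "lowtri n Z" "r \<in> Idx n \<Longrightarrow> r \<le> n + 1 \<Longrightarrow> ent Z r r = (if r = i then a else 1)"
proof -
  have B: "blk n i Z" using Z by (simp add: para_def)
  have "ent Z r c = 0" if rc: "r \<in> Idx n" "c \<in> Idx n" "r < c" for r c
  proof -
    consider "r < i \<or> opp n i < c" | "r = i" | "i < r" "r < opp n i" using rc by linarith
    then show ?thesis
      by cases (use blkD[OF B rc(1,2)] Z rc in \<open>auto simp: para_def simp del: mem_Idx\<close>)
  qed
  then show "lowtri n Z" using B by (auto simp: lowtri_def blk_Mats)
  assume r: "r \<in> Idx n" "r \<le> n + 1"
  then have "r < i \<or> r = i \<or> i < r \<and> r < opp n i" using i by (auto simp: opp_def)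
  then show "ent Z r r = (if r = i then a else 1)"
    using blkD[OF B r(1,1)] Z r by (auto simp: para_def simp del: mem_Idx)
qed

subsection \<open>The factors of the products\<close>

definition xmat :: "nat \<Rightarrow> nat \<Rightarrow> ratfun \<Rightarrow> ratfun mat" where
  "xmat n j a = mexp n (a \<cdot>\<^sub>m egen n j)"

definition xfac :: "nat \<Rightarrow> (pvar \<Rightarrow> ratfun) \<Rightarrow> pvar \<Rightarrow> nat \<Rightarrow> ratfun mat" where
  "xfac n c v j = xmat n j (c v)"

definition sfac :: "nat \<Rightarrow> pvar \<Rightarrow> nat \<Rightarrow> ratfun mat" where
  "sfac n v j = sbar n j"

lemma xmat_Mats [simp]: "xmat n j a \<in> Mats n"
  by (simp add: xmat_def)

lemma Xmat_eq: "Xmat n c = Xword n (xfac n c)"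
  unfolding Xmat_def xfac_def xmat_def ..

lemma w0bar_eq: "w0bar n = Xword n (sfac n)"
  unfolding w0bar_def sfac_def sbar_def ..

lemma ent_xmat:
  assumes "1 \<le> j" "j \<le> n" "r \<in> Idx n" "c \<in> Idx n"
  shows "ent (xmat n j a) r c = xop n j a (\<lambda>m. if r = m then 1 else 0) c"
proof -
  have "ent (xmat n j a) r c = ent (idm n * mexp n (a \<cdot>\<^sub>m egen n j)) r c"
    by (simp add: xmat_def)
  also have "\<dots> = xop n j a (ent (idm n) r) c"
    by (rule ent_mult_xmat) (use assms in auto)
  also have "\<dots> = xop n j a (\<lambda>m. if r = m then 1 else 0) c"
    by (rule xop_cong) (use assms in \<open>simp_all add: ent_idm del: mem_Idx\<close>)
  finally show ?thesis .
qed

lemma xop_delta: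
  assumes "j < n" "j + j' = 2 * n + 1"
  shows "xop n j a (\<lambda>m. if r = m then 1 else 0) c = (if r = c then 1
     else if r = j \<and> c = j + 1 then a else if r = j' \<and> c = j' + 1 then - a else 0)"
proof -
  have "2 * n + 1 - j = j'" "2 * n + 2 - j = j' + 1" "j + 1 < j'" using assms by auto
  then show ?thesis using assms(1) unfolding xop_def by (simp only:) auto
qed

lemma xop_n_delta:
  "xop n n a (\<lambda>m. if r = m then 1 else 0) c = (if r = c then 1
     else if r = n \<and> c = n + 1 then sqrt2 * a else if r = n + 1 \<and> c = n + 2 then - sqrt2 * a
     else if r = n \<and> c = n + 2 then - (a\<^sup>2) else 0)"
  unfolding xop_def by auto

text \<open>e_j is skew for the form, so the adjoint of exp(a e_j) is exp(-a e_j), which is also its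
  inverse.\<close>

lemma orth_xmat:
  assumes "1 \<le> j" "j \<le> n"
  shows "orth n (xmat n j a)"
proof -
  have dag: "dag n (xmat n j a) = xmat n j (- a)"
  proof (rule mat_eqI_ent[of _ n])
    fix r c assume rc: "r \<in> Idx n" "c \<in> Idx n"
    show "ent (dag n (xmat n j a)) r c = ent (xmat n j (- a)) r c"
    proof (cases "j < n")
      case True
      define j' where "j' = 2 * n + 1 - j"
      have j': "j + j' = 2 * n + 1" using True by (simp add: j'_def)
      have "opp n c = j \<longleftrightarrow> c = j' + 1" "opp n r = j + 1 \<longleftrightarrow> r = j'" "opp n c = j' \<longleftrightarrow> c = j + 1"
          "opp n r = j' + 1 \<longleftrightarrow> r = j" "opp n c = opp n r \<longleftrightarrow> r = c"
        using opp_add[OF rc(1)] opp_add[OF rc(2)] j' by presburger+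
      then show ?thesis
        unfolding ent_dag[OF rc] ent_xmat[OF assms rc] ent_xmat[OF assms opp_Idx[OF rc(2)] opp_Idx[OF rc(1)]]
          xop_delta[OF True j'] using j' True by (simp only:) auto
    next
      case False
      then have j: "j = n" using assms by simp
      have iffs: "opp n c = n \<longleftrightarrow> c = n + 2" "opp n r = n + 1 \<longleftrightarrow> r = n + 1" "opp n c = n + 1 \<longleftrightarrow> c = n + 1"
          "opp n r = n + 2 \<longleftrightarrow> r = n" "opp n c = opp n r \<longleftrightarrow> r = c"
        using opp_add[OF rc(1)] opp_add[OF rc(2)] by presburger+
      show ?thesis
        unfolding j ent_dag[OF rc] ent_xmat[OF assms(1,2)[unfolded j] rc]
          ent_xmat[OF assms(1,2)[unfolded j] opp_Idx[OF rc(2)] opp_Idx[OF rc(1)]] xop_n_delta iffs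
        by (cases "r = n"; cases "r = n + 1"; cases "c = n + 1"; cases "c = n + 2"; simp)
    qed
  qed auto
  have "xmat n j (- a) * xmat n j a = idm n"
  proof (rule mat_eqI_ent[of _ n])
    fix r c assume rc: "r \<in> Idx n" "c \<in> Idx n"
    have "ent (xmat n j (- a) * xmat n j a) r c = xop n j a (ent (xmat n j (- a)) r) c"
      unfolding xmat_def[of n j a] by (rule ent_mult_xmat) (use assms rc in auto)
    also have "\<dots> = xop n j a (\<lambda>c. xop n j (- a) (\<lambda>m. if r = m then 1 else 0) c) c"
      by (rule xop_cong) (use assms rc in \<open>simp_all add: ent_xmat del: mem_Idx\<close>)
    also have "\<dots> = ent (idm n) r c"
    proof (cases "j < n")
      case True
      define j' where "j' = 2 * n + 1 - j"
      have j': "j + j' = 2 * n + 1" using True by (simp add: j'_def)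
      have "2 * n + 1 - j = j'" "2 * n + 2 - j = j' + 1" "j + 1 < j'" using True j' by auto
      then show ?thesis using True unfolding xop_delta[OF True j'] xop_def ent_idm[OF rc]
        by (simp only:) auto
    next
      case False
      then have j: "j = n" using assms by simp
      have a: "sqrt2 * a * (sqrt2 * - a) = - 2 * a\<^sup>2" "sqrt2 * - a * (sqrt2 * a) = - 2 * a\<^sup>2"
        by (simp_all add: power2_eq_square mult_ac sqrt2_mult)
      show ?thesis unfolding j xop_n_delta xop_def ent_idm[OF rc]
        by (cases "r = n"; cases "r = n + 1"; cases "r = n + 2"; cases "c = n + 1"; cases "c = n + 2"; simp add: a[simplified])
    qed
    finally show "ent (xmat n j (- a) * xmat n j a) r c = ent (idm n) r c" .
  qed auto
  then show ?thesis by (simp add: orth_def dag)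
qed

subsection \<open>Partial products\<close>

text \<open>The tail R_n ... R_i plays the part of X for the block i, ..., 2n+2-i. The empty tail i
  = n+1 starts the inductions.\<close>

definition Xpart :: "nat \<Rightarrow> (pvar \<Rightarrow> nat \<Rightarrow> ratfun mat) \<Rightarrow> nat \<Rightarrow> ratfun mat" where
  "Xpart n \<phi> i = mprod n (map (Rword n \<phi>) (rev [i..<n + 1]))"

lemma Xpart_1: "Xpart n \<phi> 1 = Xword n \<phi>"
  by (simp add: Xpart_def Xword_def)

lemma Rword_Mats [simp]: "(\<And>v j. \<phi> v j \<in> Mats n) \<Longrightarrow> Rword n \<phi> i \<in> Mats n"
  unfolding Rword_def by (rule mprod_Mats) auto

lemma Xpart_Mats [simp]: "(\<And>v j. \<phi> v j \<in> Mats n) \<Longrightarrow> Xpart n \<phi> i \<in> Mats n"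
  unfolding Xpart_def by (rule mprod_Mats) auto

lemma Xpart_top: "Xpart n \<phi> (Suc n) = idm n"
  by (simp add: Xpart_def)

lemma Xpart_Suc:
  assumes "\<And>v j. \<phi> v j \<in> Mats n" "i \<le> n"
  shows "Xpart n \<phi> i = Xpart n \<phi> (Suc i) * Rword n \<phi> i"
proof -
  have "map (Rword n \<phi>) (rev [i..<n + 1]) = map (Rword n \<phi>) (rev [Suc i..<n + 1]) @ [Rword n \<phi> i]"
    using assms(2) by (subst upt_conv_Cons) auto
  then show ?thesis unfolding Xpart_def
    by (simp only:, subst mprod_append) (auto simp: assms(1))
qed

lemma xfac_Mats [simp]: "xfac n c v j \<in> Mats n"
  by (simp add: xfac_def)

lemma sfac_Mats [simp]: "sfac n v j \<in> Mats n"
  by (simp add: sfac_def)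

lemma Rword_xfac:
  assumes i: "1 \<le> i" "i \<le> n"
    and "\<And>j. i < j \<Longrightarrow> j \<le> n \<Longrightarrow> c (Sv i j) = s j" "\<And>j. i < j \<Longrightarrow> j \<le> n \<Longrightarrow> c (Tv i j) = t j" "c (Dv i) = d"
  shows "Rword n (xfac n c) i = emat n (Rform n i (i + 1) s d t)"
proof (rule mat_eqI_ent[of _ n])
  fix r q assume "r \<in> Idx n" "q \<in> Idx n"
  have *: "map (\<lambda>j. xfac n c (Sv i j) (j - 1)) [i + 1..<n + 1] = map (\<lambda>j. mexp n (s j \<cdot>\<^sub>m egen n (j - 1))) [i + 1..<n + 1]"
    "map (\<lambda>j. xfac n c (Tv i j) (j - 1)) (rev [i + 1..<n + 1]) = map (\<lambda>j. mexp n (t j \<cdot>\<^sub>m egen n (j - 1))) (rev [i + 1..<n + 1])"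
    "xfac n c (Dv i) n = mexp n (d \<cdot>\<^sub>m egen n n)"
    using assms(3-5) by (auto simp: xfac_def xmat_def)
  show "ent (Rword n (xfac n c) i) r q = ent (emat n (Rform n i (i + 1) s d t)) r q"
    unfolding Rword_def * ent_emat[OF \<open>r \<in> Idx n\<close> \<open>q \<in> Idx n\<close>]
    by (rule ent_tprod) (use i \<open>r \<in> Idx n\<close> \<open>q \<in> Idx n\<close> in auto)
qed auto

lemma Rword_sfac:
  assumes "1 \<le> i" "i \<le> n"
  shows "Rword n (sfac n) i = emat n (desc_form n i i)"
proof (rule mat_eqI_ent[of _ n])
  fix r q assume rq: "r \<in> Idx n" "q \<in> Idx n"
  show "ent (Rword n (sfac n) i) r q = ent (emat n (desc_form n i i)) r q"
    unfolding Rword_def sfac_def ent_emat[OF rq]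
    using ent_desc[of i "i + 1" n r q] assms rq by simp
qed auto

lemma orth_Rword_xfac: "1 \<le> i \<Longrightarrow> i \<le> n \<Longrightarrow> orth n (Rword n (xfac n c) i)"
  unfolding Rword_def by (rule orth_mprod) (auto simp: xfac_def intro!: orth_xmat)

lemma orth_Xpart_xfac: "1 \<le> i \<Longrightarrow> orth n (Xpart n (xfac n c) i)"
  unfolding Xpart_def by (rule orth_mprod) (auto intro!: orth_Rword_xfac)

lemma blk_Rform: "blk n i (emat n (Rform n i a s d t))"
  unfolding blk_def by (auto simp: Rform_def opp_def)

lemma upuni_Rform: "upuni n (emat n (Rform n i a s d t))"
  unfolding upuni_def by (auto simp: Rform_def)

lemma blk_Rword_xfac: "1 \<le> i \<Longrightarrow> i \<le> n \<Longrightarrow> blk n i (Rword n (xfac n c) i)"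
  using Rword_xfac[of i n c "\<lambda>j. c (Sv i j)" "\<lambda>j. c (Tv i j)"] blk_Rform by simp

lemma upuni_Rword_xfac: "1 \<le> i \<Longrightarrow> i \<le> n \<Longrightarrow> upuni n (Rword n (xfac n c) i)"
  using Rword_xfac[of i n c "\<lambda>j. c (Sv i j)" "\<lambda>j. c (Tv i j)"] upuni_Rform by simp

lemma blk_Xpart_xfac:
  assumes "i \<le> Suc n" "1 \<le> i"
  shows "blk n i (Xpart n (xfac n c) i)"
  using assms
proof (induction i rule: inc_induct)
  case base
  then show ?case by (simp add: Xpart_top blk_idm)
next
  case (step i)
  have "Xpart n (xfac n c) i = Xpart n (xfac n c) (Suc i) * Rword n (xfac n c) i"
    by (rule Xpart_Suc) (use step in auto)
  with step show ?case by (simp add: blk_mult blk_mono blk_Rword_xfac)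
qed

lemma upuni_Xpart_xfac:
  assumes "i \<le> Suc n" "1 \<le> i"
  shows "upuni n (Xpart n (xfac n c) i)"
  using assms
proof (induction i rule: inc_induct)
  case base
  then show ?case by (simp add: Xpart_top upuni_idm)
next
  case (step i)
  have "Xpart n (xfac n c) i = Xpart n (xfac n c) (Suc i) * Rword n (xfac n c) i"
    by (rule Xpart_Suc) (use step in auto)
  with step show ?case by (simp add: upuni_mult upuni_Rword_xfac)
qed

text \<open>The representative of the longest Weyl group element of the block: a reversal with one
  common sign.\<close>

definition Wform :: "nat \<Rightarrow> nat \<Rightarrow> nat \<Rightarrow> nat \<Rightarrow> ratfun" where
  "Wform n i r c = (if i \<le> r \<and> r \<le> opp n i then (-1) ^ (n + 1 - i) * delta (opp n r) c else delta r c)"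

text \<open>One more layer exchanges i and \<open>opp n i\<close> with the sign (-1)^(n+1-i) and
  negates everything between them. Hence the sign of the inner reversal flips and agrees with that
  of the new outer pair.\<close>

lemma Xpart_sfac:
  assumes "i \<le> Suc n" "1 \<le> i"
  shows "Xpart n (sfac n) i = emat n (Wform n i)"
  using assms
proof (induction i rule: inc_induct)
  case base
  show ?case
    by (rule mat_eqI_ent[of _ n]) (auto simp: Xpart_top ent_idm Wform_def delta_def opp_def)
next
  case (step i)
  then have i: "1 \<le> i" "i \<le> n" by auto
  show ?case
  proof (rule mat_eqI_ent[of _ n])
    fix r c assume rc: "r \<in> Idx n" "c \<in> Idx n"
    let ?b = "Suc i \<le> r \<and> r \<le> opp n (Suc i)"
    let ?k = "if ?b then opp n r else r"
    have k: "?k \<in> Idx n" using rc by (auto simp del: mem_Idx)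
    have "ent (Xpart n (sfac n) i) r c
        = ent (emat n (Wform n (Suc i)) * emat n (desc_form n i i)) r c"
      using step i by (simp add: Xpart_Suc[of "sfac n"] Rword_sfac)
    also have "\<dots> = Wform n (Suc i) r ?k * desc_form n i i ?k c"
      by (subst ent_mult_single[OF _ _ rc k])
         (use rc k in \<open>auto simp: Wform_def delta_def simp del: mem_Idx\<close>)
    also have "\<dots> = Wform n i r c"
    proof -
      have o: "opp n i = 2 * n + 2 - i" "opp n (Suc i) = 2 * n + 1 - i" by (auto simp: opp_def)
      have p: "(-1 :: ratfun) ^ (n + 1 - i) = - ((-1) ^ (n - i))" using i by (simp add: Suc_diff_le)
      consider "r < i" | "r = i" | ?b | "r = opp n i" | "r > opp n i"
        using o i by linarith
      then show ?thesis
      proof cases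
        case 1
        then show ?thesis using i rc by (simp add: Wform_def desc_form_def o)
      next
        case 2
        then show ?thesis using i rc by (simp add: Wform_def desc_form_def o p[simplified])
      next
        case 3
        then have "i \<le> r" "r \<le> opp n i" "i < opp n r" "opp n r < 2 * n + 2 - i" "\<not> opp n r \<le> i" "\<not> 2 * n + 2 \<le> opp n r + i"
          using i rc by (auto simp: opp_def)
        with 3 show ?thesis by (simp add: Wform_def desc_form_def p[simplified])
      next
        case 4
        then have "\<not> ?b" "r \<noteq> i" "r = 2 * n + 2 - i" "i \<le> r" "r \<le> opp n i" "opp n r = i" using i by (auto simp: opp_def)
        then show ?thesis by (simp only: Wform_def desc_form_def if_False if_True p) simp
      next
        case 5
        then have "\<not> ?b" "r \<noteq> i" "\<not> r \<le> opp n i" "\<not> r \<le> i" "r \<noteq> 2 * n + 2 - i" "\<not> r < 2 * n + 2 - i" using i by (auto simp: opp_def)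
        then show ?thesis by (simp only: Wform_def desc_form_def if_False if_True simp_thms) simp
      qed
    qed
    finally show "ent (Xpart n (sfac n) i) r c = ent (emat n (Wform n i)) r c"
      using rc by (simp del: mem_Idx)
  qed auto
qed

lemma blk_Wform: "blk n i (emat n (Wform n i))"
proof -
  have "Wform n i r c = (if r = c then 1 else 0)"
    if "r \<in> Idx n" "c \<in> Idx n" "r < i \<or> opp n i < r \<or> c < i \<or> opp n i < c" for r c
    using that by (auto simp: Wform_def delta_def opp_def)
  then show ?thesis unfolding blk_def by (simp del: mem_Idx)
qed

lemma ent_Wform_mult:
  assumes "A \<in> Mats n" "r \<in> Idx n" "c \<in> Idx n"
  shows "ent (emat n (Wform n i) * A) r c =
    (if i \<le> r \<and> r \<le> opp n i then (-1) ^ (n + 1 - i) * ent A (opp n r) c else ent A r c)"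
proof -
  let ?k = "if i \<le> r \<and> r \<le> opp n i then opp n r else r"
  have k: "?k \<in> Idx n" using assms by (auto simp del: mem_Idx)
  have "ent (emat n (Wform n i) * A) r c = Wform n i r ?k * ent A ?k c"
    by (subst ent_mult_single[OF emat_Mats assms k])
       (use assms k in \<open>auto simp: Wform_def delta_def simp del: mem_Idx\<close>)
  then show ?thesis by (simp add: Wform_def)
qed

lemma block_opp: "r \<in> Idx n \<Longrightarrow> i \<in> Idx n \<Longrightarrow> i \<le> opp n r \<and> opp n r \<le> opp n i \<longleftrightarrow> i \<le> r \<and> r \<le> opp n i"
  using opp_add[of r n] opp_add[of i n] by linarith

text \<open>The adjoint and the inverse of this matrix are both the matrix itself.\<close>

lemma orth_Wform: "i \<in> Idx n \<Longrightarrow> orth n (emat n (Wform n i))"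
proof -
  assume i: "i \<in> Idx n"
  have "dag n (emat n (Wform n i)) = emat n (Wform n i)"
  proof (rule mat_eqI_ent[of _ n])
    fix r c assume rc: "r \<in> Idx n" "c \<in> Idx n"
    have "ent (dag n (emat n (Wform n i))) r c = Wform n i (opp n c) (opp n r)"
      using rc by (simp add: ent_dag del: mem_Idx)
    also have "\<dots> = Wform n i r c"
    proof (cases "c = opp n r")
      case True
      then show ?thesis using block_opp[OF rc(1) i] rc by (auto simp: Wform_def simp del: mem_Idx)
    next
      case False
      then have "opp n r \<noteq> c" "r \<noteq> opp n c" "opp n c = opp n r \<longleftrightarrow> r = c"
        using rc opp_opp[OF rc(2)] by (auto simp: opp_eq simp del: mem_Idx)
      then show ?thesis using block_opp[OF rc(1) i] block_opp[OF rc(2) i] rc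
        by (auto simp: Wform_def delta_def simp del: mem_Idx)
    qed
    finally show "ent (dag n (emat n (Wform n i))) r c = ent (emat n (Wform n i)) r c"
      using rc by (simp del: mem_Idx)
  qed auto
  moreover have "emat n (Wform n i) * emat n (Wform n i) = idm n"
  proof (rule mat_eqI_ent[of _ n])
    fix r c assume rc: "r \<in> Idx n" "c \<in> Idx n"
    have "(-1 :: ratfun) ^ k * ((-1) ^ k * x) = x" for k x
      by (simp add: mult.assoc[symmetric] power_mult_distrib[symmetric])
    then show "ent (emat n (Wform n i) * emat n (Wform n i)) r c = ent (idm n) r c"
      using rc block_opp[OF rc(1) i]
      by (auto simp: ent_Wform_mult Wform_def delta_def ent_idm simp del: mem_Idx)
  qed auto
  ultimately show ?thesis by (simp add: orth_def)
qed

lemma ent_mult_Wform: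
  assumes A: "A \<in> Mats n" and rc: "r \<in> Idx n" "c \<in> Idx n" and i: "i \<in> Idx n"
  shows "ent (A * emat n (Wform n i)) r c =
    (if i \<le> c \<and> c \<le> opp n i then (-1) ^ (n + 1 - i) * ent A r (opp n c) else ent A r c)"
proof -
  let ?k = "if i \<le> c \<and> c \<le> opp n i then opp n c else c"
  have k: "?k \<in> Idx n" using rc by (auto simp del: mem_Idx)
  have z: "Wform n i m c = 0" if m: "m \<in> Idx n" "m \<noteq> ?k" for m
  proof -
    have "opp n m = c \<longleftrightarrow> m = opp n c" using m rc by (metis opp_opp)
    then show ?thesis using m block_opp[OF rc(2) i] by (auto simp: Wform_def delta_def split: if_splits)
  qed
  have "ent (A * emat n (Wform n i)) r c = ent A r ?k * Wform n i ?k c"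
    by (subst ent_mult_single[OF A emat_Mats rc k]) (use rc k z in \<open>auto simp del: mem_Idx\<close>)
  then show ?thesis using block_opp[OF rc(2) i] rc by (auto simp: Wform_def simp del: mem_Idx)
qed

subsection \<open>Conjugation by the torus\<close>

text \<open>The torus acts on each root subgroup by a character. The hypotheses on \<open>D\<close>
  express orthogonality and a middle entry 1; they make the mirrored entry and, for
  \<open>j = n\<close>, the quadratic entry scale consistently with the first one.\<close>

lemma xmat_dg:
  assumes j: "1 \<le> j" "j \<le> n" and D: "\<And>k. k \<in> Idx n \<Longrightarrow> D k * D (opp n k) = 1" "D (n + 1) = 1"
  shows "xmat n j a * dg n D = dg n D * xmat n j (a * (D (j + 1) / D j))"
proof (rule mat_eqI_ent[of _ n])
  fix r c assume rc: "r \<in> Idx n" "c \<in> Idx n"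
  have nz: "D k \<noteq> 0" if "k \<in> Idx n" for k using D(1)[OF that] by auto
  have inv: "D (opp n k) = 1 / D k" if "k \<in> Idx n" for k
    using D(1)[OF that] nz[OF that] by (simp add: field_simps)
  have e: "ent (xmat n j a * dg n D) r c = ent (xmat n j a) r c * D c"
      "ent (dg n D * xmat n j b) r c = D r * ent (xmat n j b) r c" for b
    using rc by (simp_all add: ent_dg_mult del: mem_Idx)
  show "ent (xmat n j a * dg n D) r c = ent (dg n D * xmat n j (a * (D (j + 1) / D j))) r c"
  proof (cases "j < n")
    case True
    define j' where "j' = 2 * n + 1 - j"
    have j': "j + j' = 2 * n + 1" using True by (simp add: j'_def)
    have "opp n j = j' + 1" "opp n (j + 1) = j'" using j' True by (auto simp: opp_def)
    then have "D (j' + 1) = 1 / D j" "D j' = 1 / D (j + 1)" "D j \<noteq> 0" "D (j + 1) \<noteq> 0"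
      using inv[of j] inv[of "j + 1"] nz[of j] nz[of "j + 1"] j by auto
    then show ?thesis unfolding e ent_xmat[OF j rc] xop_delta[OF True j'] by auto
  next
    case False
    then have jn: "j = n" using j by simp
    have "opp n n = n + 2" by (simp add: opp_def)
    then have "D (n + 2) = 1 / D n" "D n \<noteq> 0" using inv[of n] nz[of n] j by auto
    then show ?thesis unfolding e ent_xmat[OF j rc] unfolding jn xop_n_delta
      using D(2) by (auto simp: power2_eq_square)
  qed
qed auto

lemma mprod_commute:
  assumes "E \<in> Mats n" "\<And>x. x \<in> set xs \<Longrightarrow> f x \<in> Mats n \<and> g x \<in> Mats n \<and> f x * E = E * g x"
  shows "mprod n (map f xs) * E = E * mprod n (map g xs)"
  using assms(2)
proof (induction xs)
  case Nil
  then show ?case using assms(1) by simp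
next
  case (Cons x xs)
  have [simp]: "mprod n (map f xs) \<in> Mats n" "mprod n (map g xs) \<in> Mats n" "f x \<in> Mats n" "g x \<in> Mats n"
    using Cons.prems by (auto intro!: mprod_Mats)
  have fE: "f x * E = E * g x" using Cons.prems by auto
  have "mprod n (map f (x # xs)) * E = f x * (mprod n (map f xs) * E)"
    using assms(1) by (simp add: Mats_assoc[of _ n])
  also have "\<dots> = f x * (E * mprod n (map g xs))"
    using Cons by (simp del: mprod_Cons)
  also have "\<dots> = (f x * E) * mprod n (map g xs)"
    using assms(1) by (simp add: Mats_assoc[of _ n])
  also have "\<dots> = E * mprod n (map g (x # xs))"
    unfolding fE using assms(1) by (simp add: Mats_assoc[of _ n])
  finally show ?case .
qed

lemma Rword_commute:
  assumes "E \<in> Mats n" "\<And>v j. f v j \<in> Mats n" "\<And>v j. g v j \<in> Mats n"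
    and "\<And>j. l < j \<Longrightarrow> j \<le> n \<Longrightarrow> f (Sv l j) (j - 1) * E = E * g (Sv l j) (j - 1)"
    and "\<And>j. l < j \<Longrightarrow> j \<le> n \<Longrightarrow> f (Tv l j) (j - 1) * E = E * g (Tv l j) (j - 1)"
    and "f (Dv l) n * E = E * g (Dv l) n"
  shows "Rword n f l * E = E * Rword n g l"
proof -
  let ?xs = "map (\<lambda>j. (Sv l j, j - 1)) [l + 1..<n + 1] @ [(Dv l, n)] @ map (\<lambda>j. (Tv l j, j - 1)) (rev [l + 1..<n + 1])"
  have R: "Rword n h l = mprod n (map (\<lambda>x. h (fst x) (snd x)) ?xs)" for h
    by (simp add: Rword_def o_def)
  show ?thesis
    unfolding R by (rule mprod_commute) (use assms in auto)
qed

lemma Xpart_commute: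
  assumes "E \<in> Mats n" "\<And>v j. f v j \<in> Mats n" "\<And>v j. g v j \<in> Mats n"
    and "\<And>l. i \<le> l \<Longrightarrow> l \<le> n \<Longrightarrow> Rword n f l * E = E * Rword n g l"
  shows "Xpart n f i * E = E * Xpart n g i"
  unfolding Xpart_def by (rule mprod_commute) (use assms in auto)

subsection \<open>The induction step\<close>

context layer
begin

lemma D_opp:
  assumes "k \<in> Idx n"
  shows "D k * D (opp n k) = 1"
proof -
  have o: "opp n k = 2 * n + 2 - k" by (simp add: opp_def)
  consider "i < k" "k \<le> n" | "k = Suc n" | "Suc n < k" "k < 2 * n + 2 - i" | "k \<le> i \<or> 2 * n + 2 - i \<le> k" by linarith
  then show ?thesis
  proof cases
    case 1
    then show ?thesis unfolding o D_high[OF 1] D_low[OF 1] using s_nz[of k] t_nz[of k] by simp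
  next
    case 2
    then have "opp n k = Suc n" by (simp add: opp_def)
    with 2 show ?thesis by (simp add: D_mid)
  next
    case 3
    define m where "m = 2 * n + 2 - k"
    then have m: "k = 2 * n + 2 - m" "i < m" "m \<le> n" using 3 by auto
    have "D k = t m / s m" unfolding m(1) by (rule D_high[OF m(2,3)])
    moreover have "D (opp n k) = s m / t m"
      unfolding o m_def[symmetric] by (rule D_low[OF m(2,3)])
    ultimately show ?thesis using m s_nz[of m] t_nz[of m] by simp
  next
    case 4
    then have "D k = 1" "D (opp n k) = 1" using assms i by (auto simp: D_def o)
    then show ?thesis by simp
  qed
qed

text \<open>\<open>Qm\<close> is the remaining Weyl element times the torus element times R_i(p), so
  \<open>Lm * dag n Qm\<close> is the correction Z. The relations \<open>first_row\<close> and
  \<open>inner_row\<close> between the rows of \<open>Lm\<close> and \<open>Qm\<close> are what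
  \<open>para_rows\<close> asks for.\<close>

lemma layer_step:
  defines "Lm \<equiv> emat n Rm * emat n (Wform n i)"
    and "Qm \<equiv> emat n (Wform n (Suc i)) * dg n D * emat n Rp"
  assumes orth: "orth n (emat n Rp)"
  shows "para n i (d\<^sup>2 * A n * B n) (Lm * dag n Qm)" "orth n Qm"
proof -
  have iI: "i \<in> Idx n" "Suc i \<in> Idx n" using i by auto
  have blkRm: "blk n i (emat n Rm)" and blkRp: "blk n i (emat n Rp)"
    unfolding Rm_def Rp_def by (rule blk_Rform)+
  have Dout: "D r = 1" if "r \<in> Idx n" "r \<le> i \<or> opp n i \<le> r" for r
    using that i by (auto simp: D_def opp_def)
  have blkD': "blk n i (dg n D)"
    unfolding blk_def by (auto simp: ent_dg Dout simp del: mem_Idx)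
  have blkL: "blk n i Lm" unfolding Lm_def by (intro blk_mult blkRm blk_Wform)
  have blkQ: "blk n i Qm" unfolding Qm_def by (intro blk_mult blkRp blkD' blk_mono[OF blk_Wform])
  show orthQ: "orth n Qm"
    unfolding Qm_def by (intro orth_mult orth_Wform orth_dg D_opp orth iI)
  have Q: "ent Qm r c = (if Suc i \<le> r \<and> r \<le> opp n (Suc i)
      then (-1) ^ (n + 1 - Suc i) * (D (opp n r) * Rp (opp n r) c) else D r * Rp r c)"
    if "r \<in> Idx n" "c \<in> Idx n" for r c
    unfolding Qm_def using that
    by (simp add: Mats_assoc[of _ n] ent_Wform_mult ent_dg_mult del: mem_Idx)
  have L: "ent Lm r c = (if i \<le> c \<and> c \<le> opp n i then (-1) ^ (n + 1 - i) * Rm r (opp n c) else Rm r c)"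
    if "r \<in> Idx n" "c \<in> Idx n" for r c
    unfolding Lm_def using that iI by (simp add: ent_mult_Wform del: mem_Idx)
  have oi: "opp n i = 2 * n + 2 - i" by (simp add: opp_def)
  have Qi: "ent Qm i c = Rp i c" if "c \<in> Idx n" for c
    using Q[OF iI(1) that] Dout[OF iI(1)] by simp
  \<comment> \<open>Removing the outer layer flips the sign of the reversal, which accounts for the
    minus sign before \<open>D\<close> in \<open>inner_row\<close>.\<close>
  have eps: "(-1 :: ratfun) ^ (n + 1 - Suc i) = - ((-1) ^ (n + 1 - i))"
    using i by (simp add: Suc_diff_le)
  show "para n i (d\<^sup>2 * A n * B n) (Lm * dag n Qm)"
  proof (rule para_rows[OF blkL blkQ orthQ iI(1), where v = "\<lambda>r. (-1) ^ (n + 1 - i) * Rm r (2 * n + 2 - i)"])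
    fix c assume c: "c \<in> Idx n"
    show "ent Lm i c = d\<^sup>2 * A n * B n * ent Qm i c"
    proof (cases "i \<le> c \<and> c \<le> opp n i")
      case True
      then show ?thesis using first_row[of c] L[OF iI(1) c] Qi[OF c] by (simp add: opp_def)
    next
      case False
      then have "c < i \<or> opp n i < c" "i \<noteq> c" using i by (auto simp: opp_def)
      then show ?thesis using blkD[OF blkL iI(1) c] blkD[OF blkQ iI(1) c] by simp
    qed
  next
    fix r c assume r: "r \<in> Idx n" "i < r" "r < opp n i" and c: "c \<in> Idx n"
    show "ent Lm r c = ent Qm r c + (-1) ^ (n + 1 - i) * Rm r (2 * n + 2 - i) * ent Qm i c"
    proof (cases "i \<le> c \<and> c \<le> opp n i")
      case True
      have ro: "Suc i \<le> r \<and> r \<le> opp n (Suc i)" using r by (auto simp: opp_def)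
      have oc: "i \<le> opp n c" "opp n c \<le> 2 * n + 2 - i" "2 * n + 2 - opp n c = c"
        using True c by (auto simp: opp_def)
      have "Rm r (opp n c) = Rm r (2 * n + 2 - i) * Rp i c - D (opp n r) * Rp (opp n r) c"
        using inner_row[of r "opp n c"] r oc unfolding oi oc(3) by (simp only: opp_def)
      then show ?thesis unfolding L[OF r(1) c] Q[OF r(1) c] Qi[OF c] eps if_P[OF True] if_P[OF ro]
        by (simp only: right_diff_distrib mult_minus_left) (simp add: mult.assoc)
    next
      case False
      then have "c < i \<or> opp n i < c" "i \<noteq> c" "r \<noteq> c" using i r by (auto simp: opp_def)
      then show ?thesis using blkD[OF blkL r(1) c] blkD[OF blkQ iI(1) c] blkD[OF blkQ r(1) c] by simp
    qed
  qed
qed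

end

section \<open>Closed formulas for the tails and the downward induction\<close>

lemma svar_nonzero: "svar i j \<noteq> 0" and tvar_nonzero: "tvar i j \<noteq> 0" and uvar_nonzero: "uvar i j \<noteq> 0"
  by (auto simp: svar_def tvar_def uvar_def rvar_nonzero rvar_add_nonzero)

lemma layer_vars: "1 \<le> i \<Longrightarrow> i \<le> n \<Longrightarrow> layer n i (svar i) (tvar i) (uvar i) (dvar i)"
  by unfold_locales
     (auto simp: svar_nonzero tvar_nonzero uvar_nonzero rvar_nonzero, auto simp: svar_def uvar_def tvar_def)

text \<open>The parameters of the tail from i on. Starting the products at k = i makes the step from
  i+1 to i insert one factor; i = 1 gives the formulas of the theorem.\<close>

definition pform :: "nat \<Rightarrow> nat \<Rightarrow> pvar \<Rightarrow> ratfun" where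
  "pform n i v = (case v of
     Tv l j \<Rightarrow> rquot l j * (\<Prod>k\<in>{i..<l}. tvar k (j - 1) / svar k (j - 1)) * (\<Prod>k\<in>{i..<l}. svar k j / tvar k j)
   | Sv l j \<Rightarrow> rquot l j * (\<Prod>k\<in>{i..<l}. tvar k (j - 1) / svar k (j - 1)) * (\<Prod>k\<in>{i..l}. svar k j / tvar k j)
   | Dv l \<Rightarrow> uvar l n / (dvar l * svar l n) * (\<Prod>k\<in>{i..<l}. tvar k n / svar k n))"

text \<open>The torus entries of the tail from i on. The default 1 reflects that the tail fixes the
  coordinates before i, and at n+1 it gives \<open>Tdiag\<close> its middle entry.\<close>

definition tau :: "nat \<Rightarrow> nat \<Rightarrow> nat \<Rightarrow> ratfun" where
  "tau n i k = (if i \<le> k \<and> k \<le> n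
      then (dvar k)\<^sup>2 * (\<Prod>j\<in>{i..<k}. svar j k / tvar j k) * (\<Prod>j\<in>{k<..n}. svar k j * tvar k j) else 1)"

definition Tdiag :: "nat \<Rightarrow> nat \<Rightarrow> nat \<Rightarrow> ratfun" where
  "Tdiag n i k = (if k \<le> n then tau n i k else inverse (tau n i (opp n k)))"

lemma tau_nonzero: "tau n i k \<noteq> 0"
  by (auto simp: tau_def svar_nonzero tvar_nonzero rvar_nonzero)

lemma atLeastLessThan_insert: "i < l \<Longrightarrow> {i..<l} = insert i {Suc i..<l}" for i l :: nat
  by auto

lemma prod_first: "i < l \<Longrightarrow> (\<Prod>k\<in>{i..<l}. f k) = f i * (\<Prod>k\<in>{Suc i..<l}. f k)" for i l :: nat
  by (simp add: atLeastLessThan_insert)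

lemma prod_first': "i < l \<Longrightarrow> (\<Prod>k\<in>{i..l}. f k) = f i * (\<Prod>k\<in>{Suc i..l}. f k)" for i l :: nat
  by (simp add: prod.atLeast_Suc_atMost)

text \<open>The diagonal of \<open>Y\<close> is tracked only up to the middle, because the shape
  \<open>para\<close> leaves the entry at \<open>opp n i\<close> open. The rest follows from
  orthogonality in \<open>factorization_exists\<close>.\<close>

lemma main_induction:
  assumes "i \<le> Suc n" "1 \<le> i"
  shows "\<exists>Y. lowtri n Y \<and> (\<forall>r\<in>Idx n. r \<le> n + 1 \<longrightarrow> ent Y r r = 1) \<and>
    Xpart n (xfac n (\<lambda>v. - rvar v)) i * Xpart n (sfac n) i
      = Y * dg n (Tdiag n i) * Xpart n (xfac n (pform n i)) i"
  using assms
proof (induction i rule: inc_induct)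
  case base
  have "dg n (Tdiag n (Suc n)) = idm n"
    unfolding dg_one[symmetric] by (rule dg_cong) (auto simp: Tdiag_def tau_def opp_def)
  then show ?case
    by (intro exI[of _ "idm n"]) (auto simp: Xpart_top lowtri_def ent_idm)
next
  case (step i)
  then have i: "1 \<le> i" "i \<le> n" by auto
  have iI: "i \<in> Idx n" "Suc i \<in> Idx n" using i by auto
  interpret L: layer n i "svar i" "tvar i" "uvar i" "dvar i"
    by (rule layer_vars[OF i])
  obtain Y where Y: "lowtri n Y" "\<And>r. r \<in> Idx n \<Longrightarrow> r \<le> n + 1 \<Longrightarrow> ent Y r r = 1"
    and eq: "Xpart n (xfac n (\<lambda>v. - rvar v)) (Suc i) * Xpart n (sfac n) (Suc i)
      = Y * dg n (Tdiag n (Suc i)) * Xpart n (xfac n (pform n (Suc i))) (Suc i)"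
    using step.IH i by auto
  define a where "a = (dvar i)\<^sup>2 * L.A n * L.B n"
  have a: "a \<noteq> 0" using L.A_nz[of n] L.B_nz[of n] by (simp add: a_def rvar_nonzero)
  \<comment> \<open>\<open>Z' * Y\<close> will have the diagonal entry a in row i. The factor
    \<alpha> divides it out to keep \<open>Y\<close> unipotent there, and the torus part absorbs the
    inverse of \<alpha>; the opposite entry keeps that part orthogonal.\<close>
  define \<alpha> where "\<alpha> k = (if k = i then inverse a else if k = opp n i then a else 1)" for k
  let ?Xm = "Xpart n (xfac n (\<lambda>v. - rvar v)) (Suc i)" and ?W = "emat n (Wform n (Suc i))"
  let ?Xp = "Xpart n (xfac n (pform n (Suc i))) (Suc i)" and ?Xq = "Xpart n (xfac n (pform n i)) (Suc i)"
  let ?Q = "?W * dg n L.D * emat n L.Rp" and ?L = "emat n L.Rm * emat n (Wform n i)"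
  have Rm: "Rword n (xfac n (\<lambda>v. - rvar v)) i = emat n L.Rm"
    unfolding L.Rm_def by (rule Rword_xfac[OF i]) (auto simp: svar_def tvar_def)
  have Rp: "Rword n (xfac n (pform n i)) i = emat n L.Rp"
    unfolding L.Rp_def
    by (rule Rword_xfac[OF i]) (auto simp: pform_def L.P_def L.Q_def L.pd_def rquot_def)
  have orthRp: "orth n (emat n L.Rp)" unfolding Rp[symmetric] by (rule orth_Rword_xfac[OF i])
  define Z where "Z = ?L * dag n ?Q"
  have Z: "para n i a Z" and oQ: "orth n ?Q"
    using L.layer_step[OF orthRp] by (simp_all add: Z_def a_def)
  have ZM: "Z \<in> Mats n" by (simp add: Z_def)
  have LZ: "?L = Z * ?Q"
  proof -
    have "Z * ?Q = ?L * (dag n ?Q * ?Q)" unfolding Z_def by (rule Mats_assoc[of _ n]) auto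
    also have "\<dots> = ?L" by (simp only: orthD(2)[OF oQ]) simp
    finally show ?thesis ..
  qed
  define Z' where "Z' = ?Xm * Z * dag n ?Xm"
  have Z': "para n i a Z'"
    unfolding Z'_def by (rule para_conj[OF Z _ _ i]) (use i in \<open>auto intro: blk_Xpart_xfac orth_Xpart_xfac\<close>)
  have Z'M: "Z' \<in> Mats n" by (simp add: Z'_def ZM)
  have XZ: "?Xm * Z = Z' * ?Xm"
  proof -
    have "Z' * ?Xm = ?Xm * Z * (dag n ?Xm * ?Xm)" unfolding Z'_def by (rule Mats_assoc[of _ n]) (use ZM in auto)
    also have "\<dots> = ?Xm * Z" using orthD(2)[OF orth_Xpart_xfac[of "Suc i" n]] ZM by simp
    finally show ?thesis ..
  qed
  have YM: "Y \<in> Mats n" using Y(1) by (simp add: lowtri_def)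
  have W: "Xpart n (sfac n) i = emat n (Wform n i)" "Xpart n (sfac n) (Suc i) = ?W"
    by (rule Xpart_sfac; use i in simp)+
  \<comment> \<open>Conjugation by \<open>L.D\<close> multiplies each parameter by precisely the
    factors with k = i that distinguish \<open>pform n i\<close> from
    \<open>pform n (Suc i)\<close>.\<close>
  have comm: "?Xp * dg n L.D = dg n L.D * ?Xq"
  proof (rule Xpart_commute)
    fix l assume l: "Suc i \<le> l" "l \<le> n"
    have Dq: "L.D j / L.D (j - 1) = (tvar i (j - 1) / svar i (j - 1)) * (svar i j / tvar i j)"
      if "l < j" "j \<le> n" for j
      using that l by (simp add: L.D_low mult_ac)
    have Dn: "L.D (n + 1) / L.D n = tvar i n / svar i n"
      using l by (simp add: L.D_low L.D_mid)
    show "Rword n (xfac n (pform n (Suc i))) l * dg n L.D = dg n L.D * Rword n (xfac n (pform n i)) l"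
    proof (rule Rword_commute)
      fix j assume j: "l < j" "j \<le> n"
      then have j1: "1 \<le> j - 1" "j - 1 \<le> n" "j - 1 + 1 = j" using l by auto
      have *: "xmat n (j - 1) b * dg n L.D = dg n L.D * xmat n (j - 1) (b * (L.D j / L.D (j - 1)))" for b
        using xmat_dg[of "j - 1" n L.D b] j1 L.D_opp L.D_mid by (simp del: mem_Idx)
      show "xfac n (pform n (Suc i)) (Sv l j) (j - 1) * dg n L.D = dg n L.D * xfac n (pform n i) (Sv l j) (j - 1)"
        unfolding xfac_def * Dq[OF j] using l
        by (simp add: pform_def prod_first prod_first' mult_ac del: times_divide_eq_left times_divide_eq_right)
      show "xfac n (pform n (Suc i)) (Tv l j) (j - 1) * dg n L.D = dg n L.D * xfac n (pform n i) (Tv l j) (j - 1)"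
        unfolding xfac_def * Dq[OF j] using l
        by (simp add: pform_def prod_first prod_first' mult_ac del: times_divide_eq_left times_divide_eq_right)
    next
      have *: "xmat n n b * dg n L.D = dg n L.D * xmat n n (b * (L.D (n + 1) / L.D n))" for b
        using xmat_dg[of n n L.D b] L.D_opp L.D_mid i by (simp del: mem_Idx)
      show "xfac n (pform n (Suc i)) (Dv l) n * dg n L.D = dg n L.D * xfac n (pform n i) (Dv l) n"
        unfolding xfac_def * Dn using l
        by (simp add: pform_def prod_first mult_ac del: times_divide_eq_left times_divide_eq_right)
    qed auto
  qed auto
  \<comment> \<open>The recursion for the torus entries. It is checked up to row n and carried to
    the other half by inversion, as opposite entries of each diagonal multiply to 1.\<close>
  have tau: "\<alpha> k * Tdiag n i k = Tdiag n (Suc i) k * L.D k" if k: "k \<in> Idx n" for k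
  proof -
    have low: "\<alpha> k * tau n i k = tau n (Suc i) k * L.D k" if "k \<le> n" for k
    proof -
      consider "k < i" | "k = i" | "i < k" by linarith
      then show ?thesis
      proof cases
        case 1
        then show ?thesis using i by (simp add: \<alpha>_def tau_def L.D_def opp_def)
      next
        case 2
        have "tau n i i = a" using i by (simp add: tau_def a_def L.A_def L.B_def prod.distrib)
        moreover have "tau n (Suc i) i = 1" "L.D i = 1" using i by (simp_all add: tau_def L.D_def)
        ultimately show ?thesis using a 2 by (simp add: \<alpha>_def)
      next
        case 3
        then have "\<alpha> k = 1" using that i by (auto simp: \<alpha>_def opp_def)
        then show ?thesis using 3 that by (simp add: tau_def prod_first L.D_low)
      qed
    qed
    show ?thesis
    proof (cases "k \<le> n")
      case True
      then show ?thesis using low by (simp add: Tdiag_def)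
    next
      case False
      show ?thesis
      proof (cases "k = Suc n")
        case True
        have "opp n (Suc n) = Suc n" "\<alpha> (Suc n) = 1" using i by (auto simp: \<alpha>_def opp_def)
        then show ?thesis unfolding True by (simp add: Tdiag_def tau_def L.D_mid)
      next
        case F: False
        then have o: "opp n k \<le> n" "opp n k \<in> Idx n" "opp n (opp n k) = k" using False k by (auto simp: opp_def)
        have Dk: "L.D k = inverse (L.D (opp n k))"
          using L.D_opp[OF k] by (metis inverse_unique mult.commute)
        have ak: "\<alpha> k = inverse (\<alpha> (opp n k))"
        proof -
          have "opp n k = i \<longleftrightarrow> k = opp n i" "opp n k \<noteq> opp n i" "k \<noteq> i"
            using k iI(1) o F False i by (auto simp: opp_def)
          then show ?thesis by (simp add: \<alpha>_def)
        qed
        show ?thesis using False low[OF o(1)] unfolding Dk ak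
          by (simp add: Tdiag_def del: inverse_mult_distrib flip: inverse_mult_distrib)
      qed
    qed
  qed
  have diag: "dg n (Tdiag n (Suc i)) * dg n L.D = dg n \<alpha> * dg n (Tdiag n i)"
    unfolding dg_mult by (rule dg_cong) (simp only: tau)
  have "Xpart n (xfac n (\<lambda>v. - rvar v)) i * Xpart n (sfac n) i = ?Xm * (emat n L.Rm * emat n (Wform n i))"
    unfolding W(1) by (simp add: Xpart_Suc[of "xfac n _"] i Rm Mats_assoc[of _ n])
  also have "\<dots> = ?Xm * Z * ?Q"
    unfolding LZ by (rule Mats_assoc[of _ n, symmetric]) (use ZM in auto)
  also have "\<dots> = Z' * (?Xm * ?W) * (dg n L.D * emat n L.Rp)"
    unfolding XZ using Z'M by (simp add: Mats_assoc[of _ n])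
  also have "\<dots> = Z' * Y * dg n (Tdiag n (Suc i)) * (?Xp * dg n L.D) * emat n L.Rp"
    unfolding eq[unfolded W(2)] using Z'M YM by (simp add: Mats_assoc[of _ n])
  also have "\<dots> = Z' * Y * (dg n (Tdiag n (Suc i)) * dg n L.D) * (?Xq * emat n L.Rp)"
    unfolding comm using Z'M YM by (simp add: Mats_assoc[of _ n])
  also have "\<dots> = (Z' * Y * dg n \<alpha>) * dg n (Tdiag n i) * Xpart n (xfac n (pform n i)) i"
    unfolding diag using Z'M YM by (simp add: Mats_assoc[of _ n] Xpart_Suc[of "xfac n _"] i Rp)
  finally have main: "Xpart n (xfac n (\<lambda>v. - rvar v)) i * Xpart n (sfac n) i
      = (Z' * Y * dg n \<alpha>) * dg n (Tdiag n i) * Xpart n (xfac n (pform n i)) i" .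
  have low: "lowtri n Z'" "lowtri n (Z' * Y)"
    by (auto intro!: lowtri_mult para_lowtri(1)[OF Z' i] Y)
  have "ent (Z' * Y * dg n \<alpha>) r r = 1" if r: "r \<in> Idx n" "r \<le> n + 1" for r
  proof -
    have "opp n i \<noteq> r" using r i by (auto simp: opp_def)
    then show ?thesis
      using para_lowtri(2)[OF Z' i r] Y(2)[OF r] a r
      by (simp add: lowtri_mult(2)[OF low(2) lowtri_dg] lowtri_mult(2)[OF low(1) Y(1)] ent_dg \<alpha>_def del: mem_Idx)
  qed
  moreover have "lowtri n (Z' * Y * dg n \<alpha>)" by (intro lowtri_mult low lowtri_dg)
  ultimately show ?case using main by blast
qed

subsection \<open>Existence of the factorization\<close>

definition entries_in :: "nat \<Rightarrow> ratfun mat \<Rightarrow> bool" where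
  "entries_in n A \<longleftrightarrow> A \<in> Mats n \<and> (\<forall>r\<in>Idx n. \<forall>c\<in>Idx n. ent A r c \<in> ratfuns n)"

lemma ratfuns_diff: "f \<in> ratfuns n \<Longrightarrow> g \<in> ratfuns n \<Longrightarrow> f - g \<in> ratfuns n"
  unfolding diff_conv_add_uminus by (intro ratfuns_add ratfuns_uminus)

lemma entries_in_mult: "entries_in n A \<Longrightarrow> entries_in n B \<Longrightarrow> entries_in n (A * B)"
  unfolding entries_in_def by (auto simp: ent_mult simp del: mem_Idx intro!: ratfuns_sum ratfuns_mult)

lemma entries_in_dag: "entries_in n A \<Longrightarrow> entries_in n (dag n A)"
  unfolding entries_in_def by (simp add: ent_dag del: mem_Idx)

lemma entries_in_idm: "entries_in n (idm n)"
  unfolding entries_in_def by (simp add: ent_idm ratfuns_zero ratfuns_one del: mem_Idx)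

lemma entries_in_dg: "(\<And>k. k \<in> Idx n \<Longrightarrow> f k \<in> ratfuns n) \<Longrightarrow> entries_in n (dg n f)"
  unfolding entries_in_def by (simp add: ent_dg ratfuns_zero del: mem_Idx)

lemma entries_in_mprod: "(\<And>A. A \<in> set As \<Longrightarrow> entries_in n A) \<Longrightarrow> entries_in n (mprod n As)"
  by (induction As) (auto intro: entries_in_idm entries_in_mult)

lemma entries_in_xmat:
  assumes "1 \<le> j" "j \<le> n" "a \<in> ratfuns n"
  shows "entries_in n (xmat n j a)"
proof -
  have "xop n j a g c \<in> ratfuns n" if "\<And>m. g m \<in> ratfuns n" for g c
    using that assms(3) unfolding xop_def power2_eq_square
    by (auto intro!: ratfuns_add ratfuns_diff ratfuns_mult ratfuns_rconst)
  then show ?thesis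
    unfolding entries_in_def using assms by (simp add: ent_xmat ratfuns_zero ratfuns_one del: mem_Idx)
qed

lemma entries_in_Xpart_xfac:
  assumes "\<And>v. v \<in> pvars n \<Longrightarrow> c v \<in> ratfuns n" "1 \<le> i"
  shows "entries_in n (Xpart n (xfac n c) i)"
proof -
  have "entries_in n (Rword n (xfac n c) l)" if "1 \<le> l" "l \<le> n" for l
    unfolding Rword_def
    by (rule entries_in_mprod) (use that in \<open>auto simp: xfac_def pvars_def intro!: entries_in_xmat assms(1)\<close>)
  then show ?thesis
    unfolding Xpart_def using assms(2) by (intro entries_in_mprod) auto
qed

lemma entries_in_Wform: "entries_in n (emat n (Wform n i))"
proof -
  have "(-1) ^ k \<in> ratfuns n" for k
    by (induction k) (auto intro: ratfuns_uminus ratfuns_one)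
  then show ?thesis
    unfolding entries_in_def
    by (auto simp: Wform_def delta_def ratfuns_zero ratfuns_one ratfuns_uminus simp del: mem_Idx intro!: ratfuns_mult)
qed

lemma svar_ratfuns: "1 \<le> i \<Longrightarrow> i \<le> j \<Longrightarrow> j \<le> n \<Longrightarrow> svar i j \<in> ratfuns n"
  and tvar_ratfuns: "1 \<le> i \<Longrightarrow> i \<le> j \<Longrightarrow> j \<le> n \<Longrightarrow> tvar i j \<in> ratfuns n"
  and dvar_ratfuns: "1 \<le> i \<Longrightarrow> i \<le> n \<Longrightarrow> dvar i \<in> ratfuns n"
  by (auto simp: svar_def tvar_def pvars_def intro!: ratfuns_one ratfuns_rvar)

lemma uvar_ratfuns: "1 \<le> i \<Longrightarrow> i \<le> j \<Longrightarrow> j \<le> n \<Longrightarrow> uvar i j \<in> ratfuns n"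
  by (auto simp: uvar_def intro!: ratfuns_one ratfuns_add svar_ratfuns tvar_ratfuns)

lemma rquot_ratfuns: "1 \<le> i \<Longrightarrow> i < j \<Longrightarrow> j \<le> n \<Longrightarrow> rquot i j \<in> ratfuns n"
  by (auto simp: rquot_def intro!: ratfuns_divide ratfuns_mult svar_ratfuns uvar_ratfuns)

lemma pform_ratfuns: "v \<in> pvars n \<Longrightarrow> pform n 1 v \<in> ratfuns n"
  by (auto simp: pvars_def pform_def intro!: ratfuns_divide ratfuns_mult ratfuns_prod rquot_ratfuns
      svar_ratfuns tvar_ratfuns uvar_ratfuns dvar_ratfuns; linarith)

lemma pform_nonzero: "pform n i v \<noteq> 0"
  by (auto simp: pform_def rquot_def svar_nonzero tvar_nonzero uvar_nonzero rvar_nonzero split: pvar.split)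

lemma Tdiag_ratfuns: "k \<in> Idx n \<Longrightarrow> Tdiag n 1 k \<in> ratfuns n"
proof -
  have "tau n 1 k \<in> ratfuns n" for k
    by (auto simp: tau_def power2_eq_square intro!: ratfuns_one ratfuns_divide ratfuns_mult ratfuns_prod
        svar_ratfuns tvar_ratfuns dvar_ratfuns)
  then show ?thesis by (simp add: Tdiag_def ratfuns_inverse)
qed

lemma Tdiag_opp: "k \<in> Idx n \<Longrightarrow> Tdiag n i k * Tdiag n i (opp n k) = 1"
proof -
  assume k: "k \<in> Idx n"
  consider "k \<le> n" | "k = n + 1" | "n + 1 < k" by linarith
  then show ?thesis
  proof cases
    case 1
    then have "\<not> opp n k \<le> n" by (auto simp: opp_def)
    with 1 k show ?thesis by (simp add: Tdiag_def tau_nonzero del: mem_Idx)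
  next
    case 2
    then have "opp n k = n + 1" by (auto simp: opp_def)
    with 2 show ?thesis by (simp add: Tdiag_def tau_def)
  next
    case 3
    then have "\<not> k \<le> n" "opp n k \<le> n" by (auto simp: opp_def)
    then show ?thesis by (simp add: Tdiag_def tau_nonzero)
  qed
qed

lemma det_dg: "Determinant.det (dg n f) = (\<Prod>k\<in>Idx n. f k)"
proof -
  have e: "dg n f $$ (i, j) = (if i = j then f (i + 1) else 0)" if "i < dimN n" "j < dimN n" for i j
    using ent_dg[of "i + 1" n "j + 1" f] that by (auto simp: ent_def)
  have C: "dg n f \<in> carrier_mat (dimN n) (dimN n)" using MatsD[OF dg_Mats] .
  then have "upper_triangular (dg n f)" using e by auto
  then have "Determinant.det (dg n f) = prod_list (diag_mat (dg n f))"
    using C by (rule det_upper_triangular)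
  also have "\<dots> = (\<Prod>i<dimN n. f (i + 1))"
    unfolding prod_list_diag_prod using C e by (auto simp: atLeast0LessThan intro!: prod.cong)
  also have "\<dots> = (\<Prod>k\<in>Idx n. f k)"
    by (rule prod.reindex_bij_witness[of _ "\<lambda>k. k - 1" "\<lambda>i. i + 1"]) auto
  finally show ?thesis .
qed

text \<open>Opposite entries cancel in pairs and leave the middle one.\<close>

lemma det_dg_one:
  assumes "\<And>k. k \<in> Idx n \<Longrightarrow> f k * f (opp n k) = 1" "f (n + 1) = 1"
  shows "Determinant.det (dg n f) = 1"
proof -
  have I: "Idx n = {1..n} \<union> {n + 1} \<union> {n + 2..2 * n + 1}" by (auto simp: Idx_def)
  have "(\<Prod>k\<in>Idx n. f k) = (\<Prod>k\<in>{1..n}. f k) * (\<Prod>k\<in>{n + 2..2 * n + 1}. f k)"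
    unfolding I by (subst prod.union_disjoint, simp, simp, force)+ (simp add: assms(2)[simplified])
  also have "(\<Prod>k\<in>{n + 2..2 * n + 1}. f k) = (\<Prod>k\<in>{1..n}. f (opp n k))"
    by (rule prod.reindex_bij_witness[of _ "opp n" "opp n"]) (auto simp: opp_def)
  also have "(\<Prod>k\<in>{1..n}. f k) * \<dots> = (\<Prod>k\<in>{1..n}. 1)"
    unfolding prod.distrib[symmetric] by (rule prod.cong) (use assms(1) in auto)
  finally show ?thesis by (simp add: det_dg)
qed

text \<open>Solving the equation for \<open>Y\<close>, with adjoints as inverses, shows that
  \<open>Y\<close> is orthogonal and has entries in the subfield. Comparing diagonals in
  \<open>dag n Y * Y\<close>, a product of lower triangular matrices, then gives the diagonal
  entries below the middle.\<close>

lemma factorization_exists: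
  obtains Y where "lowtri n Y" "\<And>r. r \<in> Idx n \<Longrightarrow> ent Y r r = 1" "orth n Y" "entries_in n Y"
    "Xmat n (\<lambda>v. - rvar v) * w0bar n = Y * dg n (Tdiag n 1) * Xmat n (pform n 1)"
proof -
  let ?X = "Xpart n (xfac n (pform n 1)) 1" and ?T = "dg n (Tdiag n 1)"
  let ?M = "Xpart n (xfac n (\<lambda>v. - rvar v)) 1 * Xpart n (sfac n) 1"
  obtain Y where Y: "lowtri n Y" "\<And>r. r \<in> Idx n \<Longrightarrow> r \<le> n + 1 \<Longrightarrow> ent Y r r = 1"
    and eq: "?M = Y * ?T * ?X"
    using main_induction[of 1 n] by auto
  have YM: "Y \<in> Mats n" using Y(1) by (simp add: lowtri_def)
  have W: "Xpart n (sfac n) 1 = emat n (Wform n 1)" by (rule Xpart_sfac) auto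
  have M: "orth n ?M" unfolding W by (intro orth_mult orth_Xpart_xfac orth_Wform) auto
  have X: "orth n ?X" by (rule orth_Xpart_xfac) simp
  have T: "orth n ?T" by (rule orth_dg) (rule Tdiag_opp)
  have "?M * dag n ?X * dag n ?T = Y * (?T * (?X * dag n ?X) * dag n ?T)"
    unfolding eq using YM by (simp add: Mats_assoc[of _ n])
  also have "\<dots> = Y" using YM by (simp add: orth_right[OF X] orth_right[OF T] del: One_nat_def)
  finally have Yeq: "Y = ?M * dag n ?X * dag n ?T" ..
  have orthY: "orth n Y" unfolding Yeq by (intro orth_mult orth_dag M X T)
  have KY: "entries_in n Y"
    unfolding Yeq W
    by (intro entries_in_mult entries_in_dag entries_in_Xpart_xfac entries_in_Wform entries_in_dg)
       (auto intro: ratfuns_uminus ratfuns_rvar pform_ratfuns[unfolded One_nat_def] Tdiag_ratfuns[unfolded One_nat_def])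
  have "ent Y r r = 1" if r: "r \<in> Idx n" for r
  proof (cases "r \<le> n + 1")
    case False
    then have o: "opp n r \<le> n + 1" by (auto simp: opp_def)
    have "ent (dag n Y * Y) r r = ent Y (opp n r) (opp n r) * ent Y r r"
      using r by (simp only: lowtri_mult(2)[OF lowtri_dag[OF Y(1)] Y(1)] ent_dag)
    then show ?thesis using Y(2)[OF opp_Idx[OF r] o] orthD(2)[OF orthY] r
      by (simp add: ent_idm del: mem_Idx)
  qed (use Y r in auto)
  with Y(1) orthY KY eq show thesis
    by (intro that[of Y]) (simp_all add: Xmat_eq w0bar_eq Xpart_1[unfolded One_nat_def])
qed

section \<open>Translation into the predicates of the statement\<close>

lemma elements_mat_subset: "entries_in n A \<Longrightarrow> elements_mat A \<subseteq> ratfuns n"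
proof
  fix x assume A: "entries_in n A" and "x \<in> elements_mat A"
  then obtain i j where "i < dimN n" "j < dimN n" "x = A $$ (i, j)"
    by (auto simp: entries_in_def Mats_def elements_mat_def)
  then show "x \<in> ratfuns n"
    using A[unfolded entries_in_def, THEN conjunct2, rule_format, of "i + 1" "j + 1"] by (auto simp: ent_def)
qed

lemma lower_unipotent_iff:
  "lower_unipotent n Y \<longleftrightarrow> lowtri n Y \<and> (\<forall>r\<in>Idx n. ent Y r r = 1)"
proof -
  have *: "(\<forall>r\<in>Idx n. P (r - 1)) \<longleftrightarrow> (\<forall>i<dimN n. P i)" for P
  proof
    assume L: "\<forall>r\<in>Idx n. P (r - 1)"
    show "\<forall>i<dimN n. P i" using L[rule_format, of "Suc i" for i] by auto
  qed auto
  have "(\<forall>r\<in>Idx n. \<forall>c\<in>Idx n. r < c \<longrightarrow> ent Y r c = 0)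
      \<longleftrightarrow> (\<forall>r\<in>Idx n. \<forall>c\<in>Idx n. r - 1 < c - 1 \<longrightarrow> Y $$ (r - 1, c - 1) = 0)"
    by (intro ball_cong refl) (auto simp: ent_def)
  also have "\<dots> \<longleftrightarrow> (\<forall>i<dimN n. \<forall>j<dimN n. i < j \<longrightarrow> Y $$ (i, j) = 0)"
    by (simp only: *[of "\<lambda>j. _ < j \<longrightarrow> Y $$ (_, j) = 0"] *[of "\<lambda>i. \<forall>j<dimN n. i < j \<longrightarrow> Y $$ (i, j) = 0"])
  finally show ?thesis
    unfolding lower_unipotent_def lowtri_def Mats_def ent_def *[of "\<lambda>i. Y $$ (i, i) = 1"] by auto
qed

lemma diagonal_mat_dg:
  assumes "T \<in> Mats n" "diagonal_mat T"
  shows "T = dg n (\<lambda>k. ent T k k)"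
proof (rule mat_eqI_ent[OF assms(1) dg_Mats])
  fix r c assume rc: "r \<in> Idx n" "c \<in> Idx n"
  have "ent T r c = 0" if "r \<noteq> c"
    using assms rc that by (auto simp: diagonal_mat_def Mats_def ent_def)
  then show "ent T r c = ent (dg n (\<lambda>k. ent T k k)) r c"
    using rc by (simp add: ent_dg del: mem_Idx)
qed

lemma Tdiag_matrix:
  "munit n (n + 1) (n + 1) + msum n (map (\<lambda>k. Tcoeff n k \<cdot>\<^sub>m munit n k k
     + inverse (Tcoeff n k) \<cdot>\<^sub>m munit n (hat n k) (hat n k)) [1..<n + 1]) = dg n (Tdiag n 1)"
proof -
  let ?g = "\<lambda>k. Tcoeff n k \<cdot>\<^sub>m munit n k k + inverse (Tcoeff n k) \<cdot>\<^sub>m munit n (hat n k) (hat n k)"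
  have G: "set (map ?g [1..<n + 1]) \<subseteq> Mats n" by (auto intro!: Mats_add Mats_smult)
  show ?thesis
  proof (rule mat_eqI_ent[of _ n])
    fix r c assume rc: "r \<in> Idx n" "c \<in> Idx n"
    have "ent (msum n (map ?g [1..<n + 1])) r c = (\<Sum>k\<leftarrow>[1..<n + 1]. ent (?g k) r c)"
      using ent_msum[OF G rc] by (simp only: map_map o_def)
    also have "\<dots> = (\<Sum>k\<in>{1..n}. ent (?g k) r c)"
      unfolding interv_sum_list_conv_sum_set_nat by (rule sum.cong) auto
    \<comment> \<open>The summands are sorted by which k meets the row r, so that the sum over k
      collapses; at most one of r and \<open>opp n r\<close> lies between 1 and n.\<close>
    also have "\<dots> = (\<Sum>k\<in>{1..n}. (if k = r then if r = c then Tcoeff n r else 0 else 0)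
        + (if k = opp n r then if r = c then inverse (Tcoeff n (opp n r)) else 0 else 0))"
    proof (rule sum.cong[OF refl])
      fix k assume k: "k \<in> {1..n}"
      have h: "hat n k = opp n k" by (simp add: opp_def)
      have "r = opp n k \<longleftrightarrow> k = opp n r" using k rc(1) by (auto simp: opp_def)
      then show "ent (?g k) r c = (if k = r then if r = c then Tcoeff n r else 0 else 0)
        + (if k = opp n r then if r = c then inverse (Tcoeff n (opp n r)) else 0 else 0)"
        using rc unfolding h by (auto simp: ent_add[of _ n] ent_smult[of _ n] ent_munit simp del: mem_Idx)
    qed
    also have "\<dots> = (if r \<le> n \<and> r = c then Tcoeff n r else 0)
        + (if n + 1 < r \<and> r = c then inverse (Tcoeff n (opp n r)) else 0)"
    proof -
      have "1 \<le> opp n r \<and> opp n r \<le> n \<longleftrightarrow> n + 1 < r" "1 \<le> r" using rc(1) by (auto simp: opp_def)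
      then show ?thesis by (auto simp: sum.distrib sum.delta)
    qed
    finally have s: "ent (msum n (map ?g [1..<n + 1])) r c = \<dots>" .
    have t: "tau n 1 k = Tcoeff n k" if "1 \<le> k" "k \<le> n" for k
      using that by (simp add: tau_def Tcoeff_def)
    have "ent (munit n (n + 1) (n + 1) + msum n (map ?g [1..<n + 1])) r c
        = ent (munit n (n + 1) (n + 1)) r c + ent (msum n (map ?g [1..<n + 1])) r c"
      by (rule ent_add[OF munit_Mats msum_Mats[OF G] rc])
    also have "\<dots> = ent (dg n (Tdiag n 1)) r c"
    proof -
      consider "r \<noteq> c" | "r = c" "r \<le> n" | "r = c" "r = n + 1" | "r = c" "n + 1 < r" by linarith
      then show ?thesis
      proof cases
        case 1
        then show ?thesis unfolding s using rc by (auto simp: ent_munit ent_dg simp del: mem_Idx)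
      next
        case 2
        moreover have "1 \<le> r" using rc(1) by simp
        ultimately show ?thesis unfolding s using rc t[of r] by (auto simp: ent_munit ent_dg Tdiag_def simp del: mem_Idx)
      next
        case 3
        have "opp n (n + 1) = n + 1" by (simp add: opp_def)
        then have "Tdiag n 1 (n + 1) = 1" by (simp add: Tdiag_def tau_def)
        with 3 show ?thesis unfolding s using rc by (auto simp: ent_munit ent_dg simp del: mem_Idx)
      next
        case 4
        then have "1 \<le> opp n r" "opp n r \<le> n" using rc by (auto simp: opp_def)
        with 4 show ?thesis unfolding s using rc t[of "opp n r"] by (auto simp: ent_munit ent_dg Tdiag_def simp del: mem_Idx)
      qed
    qed
    finally show "ent (munit n (n + 1) (n + 1) + msum n (map ?g [1..<n + 1])) r c = ent (dg n (Tdiag n 1)) r c" .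
  qed (use msum_Mats[OF G] in auto)
qed

subsection \<open>Uniqueness of the parameters\<close>

text \<open>Let A be the product of all s and B_m that of \<open>- t l\<close> for l > m. Up to
  constants, column n+1 gives d A and column 2n+2-m gives d^2 A B_m. The quotient at m = n gives d,
  successive quotients of the B_m give the t, and the entries in the columns up to n, with their
  factors s_c + t_c, give the s recursively.\<close>

lemma row_determines_parameters:
  assumes i: "1 \<le> i" "i \<le> n"
    and eq: "\<And>q. q \<in> Idx n \<Longrightarrow> Rform n i (i + 1) s d t i q = Rform n i (i + 1) s0 d0 t0 i q"
    and nz: "d0 \<noteq> 0" "\<And>l. i < l \<Longrightarrow> l \<le> n \<Longrightarrow> s0 l \<noteq> 0 \<and> t0 l \<noteq> 0"
  shows "d = d0" "\<And>l. i < l \<Longrightarrow> l \<le> n \<Longrightarrow> s l = s0 l" "\<And>l. i < l \<Longrightarrow> l \<le> n \<Longrightarrow> t l = t0 l"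
proof -
  interpret layer_index n i by unfold_locales (rule i)+
  let ?A = "\<Prod>l\<in>{i<..n}. s l" and ?C = "\<Prod>l\<in>{i<..n}. s0 l"
  let ?B = "\<lambda>m. \<Prod>l\<in>{m<..n}. - t l" and ?E = "\<lambda>m. \<Prod>l\<in>{m<..n}. - t0 l"
  have F: "d\<^sup>2 * ?A * ?B m = d0\<^sup>2 * ?C * ?E m" if "i \<le> m" "m \<le> n" for m
  proof -
    have q: "2 * n + 2 - m \<in> Idx n" using that i by auto
    have "- (d\<^sup>2) * ?A * ?B m = - (d0\<^sup>2) * ?C * ?E m"
      using eq[OF q] unfolding Rform_3[OF order.refl i(2) that] .
    then show ?thesis by (simp only: mult_minus_left neg_equal_iff_equal)
  qed
  have G: "d * ?A = d0 * ?C"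
    using eq[of "Suc n"] i sqrt2_mult(1) two_neq_zero_ratfun unfolding Rform_2[OF order.refl i(2)] by auto
  have "d0\<^sup>2 * ?C * ?E i \<noteq> 0" using nz by auto
  then have ne: "d\<^sup>2 * ?A * ?B i \<noteq> 0" unfolding F[OF order.refl i(2)] .
  \<comment> \<open>At m = i nonvanishing passes from the reference parameters to \<open>d\<close>
    and to the product of the \<open>s l\<close>.\<close>
  have nz': "d \<noteq> 0" "?A \<noteq> 0" using ne by (metis mult_zero_left mult_zero_right power2_eq_square)+
  have "d\<^sup>2 * ?A = d0\<^sup>2 * ?C" using F[OF i(2) order.refl] by simp
  then have "d * (d * ?A) = d0 * (d0 * ?C)" by (simp add: power2_eq_square mult.assoc)
  then show d: "d = d0" unfolding G using nz by auto
  have A: "?A = ?C" using G nz(1) unfolding d by simp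
  have B: "?B m = ?E m" if "i \<le> m" "m \<le> n" for m
    using F[OF that] nz'(1,2) unfolding d A by auto
  show "t l = t0 l" if l: "i < l" "l \<le> n" for l
  proof -
    have s: "{l - 1<..n} = insert l {l<..n}" using l by auto
    have "t l * ?B l = t0 l * ?B l" using B[of "l - 1"] B[of l] l unfolding s by simp
    moreover have "?B l \<noteq> 0" using B[of l] nz(2) l by auto
    ultimately show ?thesis by simp
  qed note t = this
  show "s l = s0 l" if "i < l" "l \<le> n" for l
    using that
  proof (induction l rule: less_induct)
    case (less l)
    define b where "b = l - 1"
    with less.prems have b: "l = Suc b" "i \<le> b" "b < n" by auto
    have P: "(\<Prod>l\<in>{i<..b}. s l) = (\<Prod>l\<in>{i<..b}. s0 l)"
      by (rule prod.cong) (use less.IH b in auto)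
    have "(\<Prod>l\<in>{i<..b}. s l) * (s l + t l) = (\<Prod>l\<in>{i<..b}. s0 l) * (s0 l + t0 l)"
      using eq[of l] less.prems unfolding b(1) Rform_1[OF order.refl b(2,3)] by simp
    moreover have "(\<Prod>l\<in>{i<..b}. s0 l) \<noteq> 0" using nz(2) b by auto
    ultimately show ?case unfolding P using t[OF less.prems] by simp
  qed
qed

text \<open>R_n ... R_{i+1} has a unit vector as row i, so row i of the tail is that of R_i. Once
  the parameters of R_i agree, this layer is cancelled by its adjoint and the tail from i+1
  remains.\<close>

lemma parameters_unique:
  assumes nz: "\<And>v. c0 v \<noteq> 0"
    and "i \<le> Suc n" "1 \<le> i" "Xpart n (xfac n c) i = Xpart n (xfac n c0) i"
  shows "\<And>l. i \<le> l \<Longrightarrow> l \<le> n \<Longrightarrow> c (Dv l) = c0 (Dv l)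
    \<and> (\<forall>j. l < j \<and> j \<le> n \<longrightarrow> c (Sv l j) = c0 (Sv l j) \<and> c (Tv l j) = c0 (Tv l j))"
  using assms(2-4)
proof (induction i rule: inc_induct)
  case base
  then show ?case by simp
next
  case (step i)
  then have i: "1 \<le> i" "i \<le> n" by auto
  have iI: "i \<in> Idx n" using i by auto
  have X: "Xpart n (xfac n b) i = Xpart n (xfac n b) (Suc i) * Rword n (xfac n b) i" for b
    by (rule Xpart_Suc) (use i in auto)
  have R: "Rword n (xfac n b) i = emat n (Rform n i (i + 1) (\<lambda>j. b (Sv i j)) (b (Dv i)) (\<lambda>j. b (Tv i j)))" for b
    by (rule Rword_xfac[OF i]) auto
  have row: "ent (Xpart n (xfac n b) i) i q = Rform n i (i + 1) (\<lambda>j. b (Sv i j)) (b (Dv i)) (\<lambda>j. b (Tv i j)) i q"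
    if q: "q \<in> Idx n" for q b
  proof -
    have B: "blk n (Suc i) (Xpart n (xfac n b) (Suc i))" using i by (intro blk_Xpart_xfac) auto
    have "ent (Xpart n (xfac n b) i) i q = ent (Xpart n (xfac n b) (Suc i)) i i * ent (Rword n (xfac n b) i) i q"
      unfolding X
      by (rule ent_mult_single) (use q iI blkD[OF B iI] in \<open>auto simp del: mem_Idx\<close>)
    then show ?thesis using q iI blkD[OF B iI iI] by (simp add: R del: mem_Idx)
  qed
  have same: "Rform n i (i + 1) (\<lambda>j. c (Sv i j)) (c (Dv i)) (\<lambda>j. c (Tv i j)) i q
      = Rform n i (i + 1) (\<lambda>j. c0 (Sv i j)) (c0 (Dv i)) (\<lambda>j. c0 (Tv i j)) i q" if "q \<in> Idx n" for q
    using row[OF that, of c] row[OF that, of c0] step.prems by simp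
  note par = row_determines_parameters[OF i same nz, simplified nz]
  have Req: "Rword n (xfac n c) i = Rword n (xfac n c0) i"
    unfolding R[of c0] by (rule Rword_xfac[OF i]) (use par in auto)
  have O: "orth n (Rword n (xfac n c0) i)" by (rule orth_Rword_xfac[OF i])
  have "Xpart n (xfac n b) i * dag n (Rword n (xfac n c0) i) = Xpart n (xfac n b) (Suc i)"
    if "Rword n (xfac n b) i = Rword n (xfac n c0) i" for b
    unfolding X that by (simp add: Mats_assoc[of _ n] orth_right[OF O])
  from this[OF Req] this[of c0] have "Xpart n (xfac n c) (Suc i) = Xpart n (xfac n c0) (Suc i)"
    using step.prems by simp
  then have "c (Dv l) = c0 (Dv l)
    \<and> (\<forall>j. l < j \<and> j \<le> n \<longrightarrow> c (Sv l j) = c0 (Sv l j) \<and> c (Tv l j) = c0 (Tv l j))" if "Suc i \<le> l" "l \<le> n" for l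
    using step.IH that by simp
  then show ?case using step.prems(1,2) par by (cases "l = i") auto
qed

text \<open>A given factorization is compared with the constructed one. The orthogonality required
  by \<open>gauss_unique\<close> is that of \<open>Y0\<close> and of \<open>Xmat n p\<close>, and
  the latter holds for every choice of \<open>p\<close>.\<close>

lemma factorization_iff:
  assumes "n \<ge> 1" "is_factorization n Y T p"
  shows "T = dg n (Tdiag n 1)" "\<And>v. v \<in> pvars n \<Longrightarrow> p v = pform n 1 v"
proof -
  obtain Y0 where Y0: "lowtri n Y0" "\<And>r. r \<in> Idx n \<Longrightarrow> ent Y0 r r = 1" "orth n Y0" "entries_in n Y0"
    and eq0: "Xmat n (\<lambda>v. - rvar v) * w0bar n = Y0 * dg n (Tdiag n 1) * Xmat n (pform n 1)"
    by (rule factorization_exists[of n]) blast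
  have F: "lower_unipotent n Y" "T \<in> Mats n" "diagonal_mat T"
    and eq: "Xmat n (\<lambda>v. - rvar v) * w0bar n = Y * T * Xmat n p"
    using assms(2) by (auto simp: is_factorization_def SO_mats_def Mats_def)
  have Xm: "Xmat n c = Xpart n (xfac n c) 1" for c
    using Xpart_1 by (simp add: Xmat_eq)
  have T: "T = dg n (\<lambda>k. ent T k k)" by (rule diagonal_mat_dg[OF F(2,3)])
  have U: "upuni n (Xmat n c)" "orth n (Xmat n c)" for c
    unfolding Xm by (rule upuni_Xpart_xfac, simp, simp, rule orth_Xpart_xfac, simp)
  have "Y * dg n (\<lambda>k. ent T k k) * Xmat n p = Y0 * dg n (Tdiag n 1) * Xmat n (pform n 1)"
    using eq eq0 T by simp
  note eq' = this
  have tn: "Tdiag n 1 r \<noteq> 0" for r by (simp add: Tdiag_def tau_nonzero)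
  have L: "lowtri n Y" "\<And>r. r \<in> Idx n \<Longrightarrow> ent Y r r = 1" using F(1) by (auto simp: lower_unipotent_iff simp del: mem_Idx)
  have "dg n (\<lambda>k. ent T k k) = dg n (Tdiag n 1)"
    by (rule gauss_unique(1)[OF L(1) _ Y0(1) _ Y0(3) U U(1) _ eq']) (simp_all only: L Y0 tn not_False_eq_True)
  then show "T = dg n (Tdiag n 1)" using T by simp
  have "Xmat n p = Xmat n (pform n 1)"
    by (rule gauss_unique(2)[OF L(1) _ Y0(1) _ Y0(3) U U(1) _ eq']) (simp_all only: L Y0 tn not_False_eq_True)
  then have "Xpart n (xfac n p) 1 = Xpart n (xfac n (pform n 1)) 1"
    by (simp only: Xm)
  from parameters_unique[OF pform_nonzero _ _ this] show "p v = pform n 1 v" if "v \<in> pvars n" for v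
    using that by (auto simp: pvars_def)
qed

lemma is_factorization_pform:
  "\<exists>Y. is_factorization n Y (dg n (Tdiag n 1)) (pform n 1)"
proof -
  obtain Y where Y: "lowtri n Y" "\<And>r. r \<in> Idx n \<Longrightarrow> ent Y r r = 1" "orth n Y" "entries_in n Y"
    and eq: "Xmat n (\<lambda>v. - rvar v) * w0bar n = Y * dg n (Tdiag n 1) * Xmat n (pform n 1)"
    by (rule factorization_exists[of n]) blast
  have "Determinant.det Y = 1"
    using Y(1,2) by (intro det_unitri[of _ n]) (auto simp: lowtri_def simp del: mem_Idx)
  then have "Y \<in> SO_mats n" using Y(3) by (intro orth_SO)
  moreover have "dg n (Tdiag n 1) \<in> SO_mats n"
  proof (rule orth_SO)
    show "orth n (dg n (Tdiag n 1))" by (rule orth_dg) (rule Tdiag_opp)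
    have "opp n (n + 1) = n + 1" by (simp add: opp_def)
    then have "Tdiag n 1 (n + 1) = 1" by (simp add: Tdiag_def tau_def)
    then show "Determinant.det (dg n (Tdiag n 1)) = 1" by (intro det_dg_one Tdiag_opp)
  qed
  moreover have "diagonal_mat (dg n (Tdiag n 1))"
    using MatsD[OF dg_Mats[of n "Tdiag n 1"]]
    by (auto simp: diagonal_mat_def dg_def emat_def)
  moreover have "elements_mat Y \<subseteq> ratfuns n" "elements_mat (dg n (Tdiag n 1)) \<subseteq> ratfuns n"
    using Y(4) entries_in_dg[of n "Tdiag n 1", OF Tdiag_ratfuns] by (auto intro: elements_mat_subset[THEN subsetD])
  moreover have "lower_unipotent n Y" using Y by (auto simp: lower_unipotent_iff simp del: mem_Idx)
  moreover have "pform n 1 ` pvars n \<subseteq> ratfuns n" using pform_ratfuns by auto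
  ultimately show ?thesis using eq unfolding is_factorization_def by blast
qed

subsection \<open>The measure $dx/x$\<close>

lemma space_log_measure: "space log_measure = {0<..}"
  by (simp add: log_measure_def space_restrict_space)

lemma sets_log_measure: "sets log_measure = sets (restrict_space borel {0<..})"
  by (simp add: log_measure_def cong: sets_restrict_space_cong)

lemma measurable_log_measureI:
  assumes "f \<in> borel_measurable N" "\<And>x. x \<in> space N \<Longrightarrow> 0 < f x"
  shows "f \<in> measurable N log_measure"
  unfolding measurable_cong_sets[OF refl sets_log_measure]
  by (rule measurable_restrict_space2) (use assms in auto)

lemma measurable_log_measureD:
  "f \<in> measurable N log_measure \<Longrightarrow> f \<in> borel_measurable N"
  unfolding measurable_cong_sets[OF refl sets_log_measure]
  by (rule measurable_restrict_space2_iff[THEN iffD1, THEN conjunct1])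

lemma measurable_from_log_measure:
  "f \<in> measurable borel N \<Longrightarrow> f \<in> measurable log_measure N"
  unfolding measurable_cong_sets[OF sets_log_measure refl] by (rule measurable_restrict_space1)

lemma emeasure_log_measure_interval:
  assumes "0 < a" "a \<le> b"
  shows "emeasure log_measure {a<..<b} = ennreal (ln b - ln a)"
proof -
  have A: "{a<..<b} \<in> sets (restrict_space lborel {0<..})"
    using assms by (subst sets_restrict_space_iff) auto
  have "emeasure log_measure {a<..<b}
      = (\<integral>\<^sup>+x. ennreal (1 / x) * indicator {a<..<b} x \<partial>restrict_space lborel {0<..})"
    unfolding log_measure_def
    by (rule emeasure_density) (use A in \<open>auto intro!: measurable_restrict_space1\<close>)
  also have "\<dots> = (\<integral>\<^sup>+x. ennreal (1 / x) * indicator {a<..<b} x * indicator {0<..} x \<partial>lborel)"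
    by (rule nn_integral_restrict_space) auto
  \<comment> \<open>The endpoints form a null set, so the closed interval of the fundamental theorem
    of calculus may be used.\<close>
  also have "\<dots> = (\<integral>\<^sup>+x. ennreal (1 / x) * indicator {a..b} x \<partial>lborel)"
  proof (rule nn_integral_cong_AE)
    show "AE x in lborel. ennreal (1 / x) * indicator {a<..<b} x * indicator {0<..} x
        = ennreal (1 / x) * indicator {a..b} x"
      using AE_lborel_singleton[of a] AE_lborel_singleton[of b]
      by eventually_elim (use assms in \<open>auto simp: indicator_def\<close>)
  qed
  also have "\<dots> = ennreal (ln b - ln a)"
    by (rule nn_integral_FTC_Icc) (use assms in \<open>auto intro!: derivative_eq_intros\<close>)
  finally show ?thesis .
qed

text \<open>The measure dx/x is a Haar measure of the multiplicative group: in logarithmic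
  coordinates it is Lebesgue measure, multiplication by a constant is a translation, and inversion
  is a reflection.\<close>

lemma distr_log_measure_ln: "distr log_measure lborel ln = lborel"
proof (rule lborel_eqI[symmetric])
  have ln: "ln \<in> measurable log_measure lborel"
    using measurable_from_log_measure[of ln borel] by simp
  fix l u :: real assume "\<And>b. b \<in> Basis \<Longrightarrow> l \<bullet> b \<le> u \<bullet> b"
  then have lu: "l \<le> u" by simp
  have "ln -` box l u \<inter> space log_measure = {exp l<..<exp u}"
    using ln_less_cancel_iff by (auto simp: space_log_measure box_real) (metis exp_gt_zero exp_ln exp_less_cancel_iff less_trans)+
  then have "emeasure (distr log_measure lborel ln) (box l u) = ennreal (u - l)"
    using ln lu by (simp add: emeasure_distr emeasure_log_measure_interval)
  then show "emeasure (distr log_measure lborel ln) (box l u) = (\<Prod>b\<in>Basis. (u - l) \<bullet> b)"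
    by simp
qed simp

lemma exp_measurable_log: "exp \<in> measurable lborel log_measure"
  by (rule measurable_log_measureI) auto

lemma distr_lborel_exp: "distr lborel log_measure exp = log_measure"
proof -
  have ln: "ln \<in> measurable log_measure lborel"
    using measurable_from_log_measure[of ln borel] by simp
  have "distr lborel log_measure exp = distr (distr log_measure lborel ln) log_measure exp"
    by (simp only: distr_log_measure_ln)
  also have "\<dots> = distr log_measure log_measure (exp \<circ> ln)"
    by (rule distr_distr[OF exp_measurable_log ln])
  also have "\<dots> = distr log_measure log_measure (\<lambda>x. x)"
    by (rule distr_cong) (auto simp: space_log_measure)
  finally show ?thesis by (simp add: distr_id)
qed

lemma distr_log_measure_mult:
  assumes "0 < c"
  shows "distr log_measure log_measure (\<lambda>x. c * x) = log_measure"
proof -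
  have m: "(\<lambda>x. c * x) \<in> measurable log_measure log_measure"
    by (intro measurable_log_measureI measurable_from_log_measure) (use assms in \<open>auto simp: space_log_measure\<close>)
  have "distr log_measure log_measure (\<lambda>x. c * x) = distr (distr lborel log_measure exp) log_measure (\<lambda>x. c * x)"
    by (simp only: distr_lborel_exp)
  also have "\<dots> = distr lborel log_measure ((\<lambda>x. c * x) \<circ> exp)"
    by (rule distr_distr[OF m exp_measurable_log])
  also have "(\<lambda>x. c * x) \<circ> exp = exp \<circ> (+) (ln c)"
    using assms by (auto simp: fun_eq_iff exp_add)
  also have "distr lborel log_measure (exp \<circ> (+) (ln c)) = distr (distr lborel borel ((+) (ln c))) log_measure exp"
    by (rule distr_distr[symmetric]) (use exp_measurable_log in \<open>auto simp: measurable_lborel1\<close>)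
  also have "\<dots> = log_measure"
    by (simp only: lborel_distr_plus distr_lborel_exp)
  finally show ?thesis .
qed

lemma distr_log_measure_divide:
  assumes "0 < c"
  shows "distr log_measure log_measure (\<lambda>x. c / x) = log_measure"
proof -
  have m: "(\<lambda>x. 1 / x) \<in> measurable log_measure log_measure"
    by (intro measurable_log_measureI measurable_from_log_measure) (auto simp: space_log_measure)
  have m': "(\<lambda>x. c * x) \<in> measurable log_measure log_measure"
    by (intro measurable_log_measureI measurable_from_log_measure) (use assms in \<open>auto simp: space_log_measure\<close>)
  have "distr log_measure log_measure (\<lambda>x. 1 / x) = distr (distr lborel log_measure exp) log_measure (\<lambda>x. 1 / x)"
    by (simp only: distr_lborel_exp)
  also have "\<dots> = distr lborel log_measure ((\<lambda>x. 1 / x) \<circ> exp)"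
    by (rule distr_distr[OF m exp_measurable_log])
  also have "(\<lambda>x. 1 / x) \<circ> exp = exp \<circ> (uminus :: real \<Rightarrow> real)"
    by (auto simp: fun_eq_iff exp_minus field_simps)
  also have "distr lborel log_measure (exp \<circ> uminus) = distr (distr lborel borel uminus) log_measure exp"
    by (rule distr_distr[symmetric]) (use exp_measurable_log in \<open>auto simp: measurable_lborel1\<close>)
  also have "\<dots> = log_measure"
    by (simp only: lborel_distr_uminus distr_lborel_exp)
  finally have inv: "distr log_measure log_measure (\<lambda>x. 1 / x) = log_measure" .
  have "distr log_measure log_measure (\<lambda>x. c / x)
      = distr (distr log_measure log_measure (\<lambda>x. 1 / x)) log_measure (\<lambda>x. c * x)"
    by (subst distr_distr[OF m' m]) (simp add: o_def)
  then show ?thesis by (simp only: inv distr_log_measure_mult[OF assms])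
qed

lemma sigma_finite_log_measure: "sigma_finite_measure log_measure"
proof
  \<comment> \<open>Under the logarithm these are the intervals from -n to n.\<close>
  let ?A = "range (\<lambda>n::nat. {exp (- real n)<..<exp (real n)})"
  have "x \<in> \<Union>?A" if "0 < x" for x :: real
  proof -
    obtain n :: nat where "\<bar>ln x\<bar> < real n" using reals_Archimedean2 by blast
    then have "- real n < ln x" "ln x < real n" by auto
    then have "exp (- real n) < x" "x < exp (real n)"
      using that by (metis exp_less_cancel_iff exp_ln)+
    then show ?thesis by auto
  qed
  moreover have "a \<subseteq> {0<..}" if "a \<in> ?A" for a
    using that by (auto intro: less_trans[OF exp_gt_zero])
  moreover have "a \<in> sets log_measure" if "a \<in> ?A" for a
    unfolding sets_log_measure using that calculation(2)[OF that] by (subst sets_restrict_space_iff) auto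
  moreover have "emeasure log_measure a \<noteq> \<infinity>" if "a \<in> ?A" for a
    using that by (auto simp: emeasure_log_measure_interval)
  ultimately show "\<exists>A. countable A \<and> A \<subseteq> sets log_measure \<and> \<Union>A = space log_measure \<and> (\<forall>a\<in>A. emeasure log_measure a \<noteq> \<infinity>)"
    by (intro exI[of _ ?A]) (auto simp: space_log_measure)
qed

interpretation log: product_sigma_finite "\<lambda>_. log_measure"
  by (rule product_sigma_finite.intro) (rule sigma_finite_log_measure)

subsection \<open>Coordinatewise scaling preserves the product measure\<close>

definition mpres :: "'a measure \<Rightarrow> ('a \<Rightarrow> 'a) \<Rightarrow> bool" where
  "mpres M f \<longleftrightarrow> f \<in> measurable M M \<and> distr M M f = M"

lemma mpres_comp: "mpres M f \<Longrightarrow> mpres M g \<Longrightarrow> mpres M (f \<circ> g)"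
  unfolding mpres_def by (metis distr_distr measurable_comp)

lemma mpres_cong:
  assumes "\<And>x. x \<in> space M \<Longrightarrow> f x = g x" "mpres M g"
  shows "mpres M f"
  using assms unfolding mpres_def by (simp cong: measurable_cong distr_cong)

text \<open>Both kinds of one-dimensional change occur: the passage between s and s/t multiplies,
  whereas t is replaced by a constant divided by t.\<close>

definition scale1 :: "bool \<Rightarrow> real \<Rightarrow> real \<Rightarrow> real" where
  "scale1 e c y = (if e then c / y else c * y)"

lemma mpres_scale1: "0 < c \<Longrightarrow> mpres log_measure (scale1 e c)"
  unfolding mpres_def
proof
  assume c: "0 < c"
  show "scale1 e c \<in> measurable log_measure log_measure"
    unfolding scale1_def
    by (intro measurable_log_measureI measurable_from_log_measure) (use c in \<open>auto simp: space_log_measure\<close>)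
  show "distr log_measure log_measure (scale1 e c) = log_measure"
    using distr_log_measure_mult[OF c] distr_log_measure_divide[OF c]
    by (cases e) (simp_all add: scale1_def[abs_def])
qed

abbreviation logPi :: "'i set \<Rightarrow> ('i \<Rightarrow> real) measure" where
  "logPi I \<equiv> Pi\<^sub>M I (\<lambda>_. log_measure)"

lemma space_logPi: "space (logPi I) = I \<rightarrow>\<^sub>E {0<..}"
  by (simp add: space_PiM space_log_measure PiE_def)

lemma measurable_logPi_component: "i \<in> I \<Longrightarrow> (\<lambda>x. x i) \<in> borel_measurable (logPi I)"
  by (rule measurable_log_measureD) (rule measurable_component_singleton)

text \<open>Fubini with \<open>v\<close> as the inner variable: \<open>c\<close> does not depend on
  that coordinate, so for fixed other coordinates the map is a \<open>scale1\<close> with constant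
  coefficient, which preserves dx/x.\<close>

lemma mpres_coordinate:
  assumes I: "finite I" "v \<in> I" and c: "c \<in> borel_measurable (logPi I)"
    and pos: "\<And>x. x \<in> space (logPi I) \<Longrightarrow> 0 < c x"
    and dep: "\<And>x y. x \<in> space (logPi I) \<Longrightarrow> 0 < y \<Longrightarrow> c (x(v := y)) = c x"
  shows "mpres (logPi I) (\<lambda>x. x(v := scale1 e (c x) (x v)))"
proof -
  let ?P = "logPi I" and ?\<phi> = "\<lambda>x. x(v := scale1 e (c x) (x v))"
  have \<phi>: "?\<phi> \<in> measurable ?P ?P"
  proof -
    have "(\<lambda>x. \<lambda>i\<in>I. if i = v then scale1 e (c x) (x v) else x i) \<in> measurable ?P ?P"
    proof (rule measurable_restrict)
      fix i assume i: "i \<in> I"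
      show "(\<lambda>x. if i = v then scale1 e (c x) (x v) else x i) \<in> measurable ?P log_measure"
      proof (rule measurable_log_measureI)
        have [measurable]: "(\<lambda>x. x i) \<in> borel_measurable ?P" "(\<lambda>x. x v) \<in> borel_measurable ?P"
            "c \<in> borel_measurable ?P"
          using measurable_logPi_component i I c by auto
        show "(\<lambda>x. if i = v then scale1 e (c x) (x v) else x i) \<in> borel_measurable ?P"
          unfolding scale1_def by measurable
      next
        fix x assume x: "x \<in> space ?P"
        then have "0 < x i" "0 < x v" using i I by (auto simp: space_logPi)
        then show "0 < (if i = v then scale1 e (c x) (x v) else x i)"
          using pos[OF x] by (auto simp: scale1_def)
      qed
    qed
    moreover have "(\<lambda>i\<in>I. if i = v then scale1 e (c x) (x v) else x i) = ?\<phi> x" if "x \<in> space ?P" for x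
      using that I by (auto simp: space_logPi fun_eq_iff PiE_def extensional_def)
    ultimately show ?thesis by (subst measurable_cong[of ?P ?\<phi>]) auto
  qed
  have "distr ?P ?P ?\<phi> = ?P"
  proof (rule measure_eqI)
    fix A assume "A \<in> sets (distr ?P ?P ?\<phi>)"
    then have A: "A \<in> sets ?P" by simp
    define J where "J = I - {v}"
    have J: "finite J" "v \<notin> J" "I = insert v J" using I by (auto simp: J_def)
    have upd: "x(v := y) \<in> space ?P" if "x \<in> space (logPi J)" "0 < y" for x y
      using that J by (auto simp: space_logPi PiE_def extensional_def)
    have "emeasure (distr ?P ?P ?\<phi>) A = (\<integral>\<^sup>+x. indicator A (?\<phi> x) \<partial>?P)"
      using A \<phi> by (simp add: nn_integral_distr flip: nn_integral_indicator)
    also have "\<dots> = (\<integral>\<^sup>+x. \<integral>\<^sup>+y. indicator A (?\<phi> (x(v := y))) \<partial>log_measure \<partial>logPi J)"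
      unfolding J(3)
      by (rule log.product_nn_integral_insert[OF J(1,2)])
         (use \<phi> A in \<open>auto simp: J(3)[symmetric] intro!: measurable_compose[OF \<phi>]\<close>)
    also have "\<dots> = (\<integral>\<^sup>+x. \<integral>\<^sup>+y. indicator A (x(v := y)) \<partial>log_measure \<partial>logPi J)"
    proof (rule nn_integral_cong)
      fix x assume x: "x \<in> space (logPi J)"
      \<comment> \<open>The value 1 is an arbitrary positive number; by \<open>dep\<close> any other
        choice gives the same coefficient.\<close>
      define k where "k = c (x(v := 1))"
      have x1: "x(v := 1) \<in> space ?P" by (rule upd[OF x]) simp
      have k: "0 < k" using pos[OF x1] by (simp add: k_def)
      have ck: "c (x(v := y)) = k" if "0 < y" for y
        using dep[OF x1 that] by (simp add: k_def)
      have meas: "(\<lambda>y. x(v := y)) \<in> measurable log_measure ?P"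
        unfolding J(3) by (rule measurable_component_update[OF x J(2)])
      have ind: "(\<lambda>y. indicator A (x(v := y)) :: ennreal) \<in> borel_measurable log_measure"
        by (rule measurable_compose[OF meas]) (use A in auto)
      have "(\<integral>\<^sup>+y. indicator A (?\<phi> (x(v := y))) \<partial>log_measure)
          = (\<integral>\<^sup>+y. indicator A (x(v := scale1 e k y)) \<partial>log_measure)"
        by (rule nn_integral_cong) (simp add: ck space_log_measure)
      also have "\<dots> = (\<integral>\<^sup>+y. indicator A (x(v := y)) \<partial>distr log_measure log_measure (scale1 e k))"
        by (rule nn_integral_distr[symmetric]) (use mpres_scale1[OF k] ind in \<open>auto simp: mpres_def\<close>)
      also have "\<dots> = (\<integral>\<^sup>+y. indicator A (x(v := y)) \<partial>log_measure)"
        using mpres_scale1[OF k] by (simp add: mpres_def)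
      finally show "(\<integral>\<^sup>+y. indicator A (?\<phi> (x(v := y))) \<partial>log_measure)
          = (\<integral>\<^sup>+y. indicator A (x(v := y)) \<partial>log_measure)" .
    qed
    also have "\<dots> = (\<integral>\<^sup>+x. indicator A x \<partial>?P)"
      unfolding J(3)
      by (rule log.product_nn_integral_insert[OF J(1,2), symmetric]) (use A in \<open>auto simp: J(3)[symmetric]\<close>)
    also have "\<dots> = emeasure ?P A" using A by simp
    finally show "emeasure (distr ?P ?P ?\<phi>) A = emeasure ?P A" .
  qed simp
  with \<phi> show ?thesis by (simp add: mpres_def)
qed

definition scale_coords :: "bool \<Rightarrow> 'i set \<Rightarrow> ('i \<Rightarrow> ('i \<Rightarrow> real) \<Rightarrow> real) \<Rightarrow> ('i \<Rightarrow> real) \<Rightarrow> 'i \<Rightarrow> real" where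
  "scale_coords e J c x v = (if v \<in> J then scale1 e (c v x) (x v) else x v)"

lemma scale_coords_space:
  assumes "J \<subseteq> I" "\<And>v. v \<in> J \<Longrightarrow> 0 < c v x" "x \<in> space (logPi I)"
  shows "scale_coords e J c x \<in> space (logPi I)"
  using assms by (auto simp: space_logPi scale_coords_def scale1_def PiE_def Pi_def extensional_def)

text \<open>The coefficients read only coordinates outside \<open>J\<close>, and these stay
  unchanged. The simultaneous change is therefore a composition of changes of single
  coordinates.\<close>

lemma mpres_scale_coords:
  assumes I: "finite I" "J \<subseteq> I" and c: "\<And>v. v \<in> J \<Longrightarrow> c v \<in> borel_measurable (logPi I)"
    and pos: "\<And>v x. v \<in> J \<Longrightarrow> x \<in> space (logPi I) \<Longrightarrow> 0 < c v x"
    and dep: "\<And>v x y. v \<in> J \<Longrightarrow> x \<in> space (logPi I) \<Longrightarrow> y \<in> space (logPi I)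
        \<Longrightarrow> (\<And>w. w \<in> I - J \<Longrightarrow> x w = y w) \<Longrightarrow> c v x = c v y"
  shows "mpres (logPi I) (scale_coords e J c)"
proof -
  have "mpres (logPi I) (scale_coords e J' c)" if "finite J'" "J' \<subseteq> J" for J'
    using that
  proof (induction J')
    case empty
    have "scale_coords e {} c = (\<lambda>x. x)" by (auto simp: fun_eq_iff scale_coords_def)
    then show "mpres (logPi I) (scale_coords e {} c)" by (simp add: mpres_def distr_id)
  next
    case (insert v J')
    then have v: "v \<in> J" "v \<in> I" and J': "J' \<subseteq> J" using I by auto
    have 1: "mpres (logPi I) (\<lambda>x. x(v := scale1 e (c v x) (x v)))"
    proof (rule mpres_coordinate[OF I(1) v(2) c[OF v(1)] pos[OF v(1)]])
      fix x y assume x: "x \<in> space (logPi I)" "(0::real) < y"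
      then have "x(v := y) \<in> space (logPi I)" using v by (auto simp: space_logPi PiE_def extensional_def)
      then show "c v (x(v := y)) = c v x" using x v by (intro dep[OF v(1)]) auto
    qed
    have "mpres (logPi I) ((\<lambda>x. x(v := scale1 e (c v x) (x v))) \<circ> scale_coords e J' c)"
      by (rule mpres_comp[OF 1 insert.IH[OF J']])
    then show "mpres (logPi I) (scale_coords e (insert v J') c)"
    proof (rule mpres_cong[rotated])
      fix x assume x: "x \<in> space (logPi I)"
      have "scale_coords e J' c x \<in> space (logPi I)"
        by (rule scale_coords_space) (use J' I x pos in auto)
      then have "c v (scale_coords e J' c x) = c v x"
        using J' by (intro dep[OF v(1) _ x]) (auto simp: scale_coords_def)
      then show "scale_coords e (insert v J') c x = ((\<lambda>x. x(v := scale1 e (c v x) (x v))) \<circ> scale_coords e J' c) x"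
        using insert(2) by (auto simp: fun_eq_iff scale_coords_def)
    qed
  qed
  then show ?thesis using finite_subset[OF I(2,1)] by blast
qed

subsection \<open>The map on the positive orthant\<close>

lemma finite_pvars: "finite (pvars n)"
proof (rule finite_subset)
  show "pvars n \<subseteq> (\<lambda>(i, j). Tv i j) ` ({1..n} \<times> {1..n}) \<union> (\<lambda>(i, j). Sv i j) ` ({1..n} \<times> {1..n}) \<union> Dv ` {1..n}"
    by (force simp: pvars_def)
qed auto

text \<open>Applied after \<open>Ssplit\<close>, when the slot \<open>Sv i j\<close> holds
  s_{i,j}/t_{i,j}; the value for i = j comes from the convention s_{i,i} = t_{i,i} = 1.\<close>

definition ratio :: "(pvar \<Rightarrow> real) \<Rightarrow> nat \<Rightarrow> nat \<Rightarrow> real" where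
  "ratio x i j = (if i = j then 1 else x (Sv i j))"

text \<open>The products p_{i,j} t_{i,j} and p_i t_i in terms of the ratios, obtained from t/u =
  1/(1 + s/t) and u/s = 1 + t/s. The exceptional value 1 is due to the convention u_{i,i} = 1, which
  differs from t_{i,i} + s_{i,i} = 2.\<close>

definition pcoef :: "nat \<Rightarrow> pvar \<Rightarrow> (pvar \<Rightarrow> real) \<Rightarrow> real" where
  "pcoef n v x = (case v of
     Tv i j \<Rightarrow> (if i = j - 1 then 1 else 1 + 1 / ratio x i (j - 1)) / (1 + ratio x i j)
        * (\<Prod>k\<in>{1..<i}. 1 / ratio x k (j - 1)) * (\<Prod>k\<in>{1..<i}. ratio x k j)
   | Dv i \<Rightarrow> (if i = n then 1 else 1 + 1 / ratio x i n) * (\<Prod>k\<in>{1..<i}. 1 / ratio x k n)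
   | Sv i j \<Rightarrow> 1)"

definition Svars :: "nat \<Rightarrow> pvar set" where
  "Svars n = {Sv i j | i j. 1 \<le> i \<and> i < j \<and> j \<le> n}"

definition Ssplit :: "nat \<Rightarrow> (pvar \<Rightarrow> real) \<Rightarrow> pvar \<Rightarrow> real" where
  "Ssplit n = scale_coords False (Svars n) (\<lambda>v x. case v of Sv i j \<Rightarrow> 1 / x (Tv i j) | _ \<Rightarrow> 1)"

definition Sjoin :: "nat \<Rightarrow> (pvar \<Rightarrow> real) \<Rightarrow> pvar \<Rightarrow> real" where
  "Sjoin n = scale_coords False (Svars n) (\<lambda>v x. case v of Sv i j \<Rightarrow> x (Tv i j) | _ \<Rightarrow> 1)"

definition Tflip :: "nat \<Rightarrow> (pvar \<Rightarrow> real) \<Rightarrow> pvar \<Rightarrow> real" where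
  "Tflip n = scale_coords True (pvars n - Svars n) (pcoef n)"

text \<open>In the coordinates $t_{i,j}$, $t_i$ and $s_{i,j}/t_{i,j}$ the map is \<open>Tflip\<close>.\<close>

definition pmap :: "nat \<Rightarrow> (pvar \<Rightarrow> real) \<Rightarrow> pvar \<Rightarrow> real" where
  "pmap n = Sjoin n \<circ> (Tflip n \<circ> Ssplit n)"

lemma Svars_subset: "Svars n \<subseteq> pvars n"
  by (auto simp: Svars_def pvars_def)

lemma Tv_pvars: "Sv i j \<in> Svars n \<Longrightarrow> Tv i j \<in> pvars n - Svars n"
  by (auto simp: Svars_def pvars_def)

lemma orthant_pos: "x \<in> space (logPi I) \<Longrightarrow> v \<in> I \<Longrightarrow> 0 < x v"
  by (auto simp: space_logPi)

lemma ratio_pos: "x \<in> space (logPi (pvars n)) \<Longrightarrow> 1 \<le> i \<Longrightarrow> i \<le> j \<Longrightarrow> j \<le> n \<Longrightarrow> 0 < ratio x i j"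
  by (auto simp: ratio_def pvars_def intro: orthant_pos)

lemma pcoef_pos:
  assumes "x \<in> space (logPi (pvars n))" "v \<in> pvars n"
  shows "0 < pcoef n v x"
  using assms(2) ratio_pos[OF assms(1)]
  by (auto simp: pvars_def pcoef_def intro!: mult_pos_pos divide_pos_pos prod_pos add_pos_pos)

lemma ratio_measurable: "1 \<le> i \<Longrightarrow> i \<le> j \<Longrightarrow> j \<le> n \<Longrightarrow> (\<lambda>x. ratio x i j) \<in> borel_measurable (logPi (pvars n))"
  by (cases "i = j") (auto simp: ratio_def pvars_def intro!: measurable_logPi_component)

lemma pcoef_measurable:
  assumes "v \<in> pvars n"
  shows "pcoef n v \<in> borel_measurable (logPi (pvars n))"
proof -
  let ?B = "borel_measurable (logPi (pvars n))"
  have h: "(\<lambda>x. if i = j then 1 else 1 + 1 / ratio x i j) \<in> ?B" if "1 \<le> i" "i \<le> j" "j \<le> n" for i j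
    using ratio_measurable[OF that] by (cases "i = j") auto
  have P: "(\<lambda>x. \<Prod>k\<in>{1..<i}. ratio x k j) \<in> ?B" "(\<lambda>x. \<Prod>k\<in>{1..<i}. 1 / ratio x k j) \<in> ?B"
    if "i \<le> Suc j" "j \<le> n" for i j
    by (intro borel_measurable_prod borel_measurable_divide ratio_measurable; use that in auto)+
  show ?thesis
  proof (cases v)
    case (Tv i j)
    with assms have ij: "1 \<le> i" "i < j" "j \<le> n" by (auto simp: pvars_def)
    show ?thesis
      unfolding Tv pcoef_def pvar.case
      by (intro borel_measurable_times borel_measurable_divide borel_measurable_add
          borel_measurable_const h P ratio_measurable) (use ij in auto)
  next
    case (Dv i)
    with assms have i: "1 \<le> i" "i \<le> n" by (auto simp: pvars_def)
    show ?thesis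
      unfolding Dv pcoef_def pvar.case by (intro borel_measurable_times h P) (use i in auto)
  qed (simp add: pcoef_def[abs_def])
qed

lemma mpres_scale_Svars:
  assumes f: "\<And>t. 0 < t \<Longrightarrow> 0 < f t" "f \<in> borel_measurable borel"
  shows "mpres (logPi (pvars n))
    (scale_coords False (Svars n) (\<lambda>v x. case v of Sv i j \<Rightarrow> f (x (Tv i j)) | _ \<Rightarrow> 1))"
proof (rule mpres_scale_coords[OF finite_pvars Svars_subset])
  fix v assume v: "v \<in> Svars n"
  then obtain i j where ij: "v = Sv i j" by (auto simp: Svars_def)
  have T: "Tv i j \<in> pvars n - Svars n" using v Tv_pvars unfolding ij by blast
  show "(\<lambda>x. case v of Sv i j \<Rightarrow> f (x (Tv i j)) | _ \<Rightarrow> 1) \<in> borel_measurable (logPi (pvars n))"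
    using T unfolding ij by (auto intro!: measurable_compose[OF measurable_logPi_component f(2)])
  show "0 < (case v of Sv i j \<Rightarrow> f (x (Tv i j)) | _ \<Rightarrow> 1)" if "x \<in> space (logPi (pvars n))" for x
    using T f(1)[OF orthant_pos[OF that, of "Tv i j"]] unfolding ij by auto
  show "(case v of Sv i j \<Rightarrow> f (x (Tv i j)) | _ \<Rightarrow> 1) = (case v of Sv i j \<Rightarrow> f (y (Tv i j)) | _ \<Rightarrow> 1)"
    if "\<And>w. w \<in> pvars n - Svars n \<Longrightarrow> x w = y w" for x y :: "pvar \<Rightarrow> real"
    using that[OF T] unfolding ij by simp
qed

lemma mpres_Ssplit: "mpres (logPi (pvars n)) (Ssplit n)"
  unfolding Ssplit_def by (rule mpres_scale_Svars[of "\<lambda>t. 1 / t"]) auto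

lemma mpres_Sjoin: "mpres (logPi (pvars n)) (Sjoin n)"
  unfolding Sjoin_def by (rule mpres_scale_Svars[of "\<lambda>t. t"]) auto

text \<open>The coefficients read only ratios, which \<open>Tflip\<close> leaves alone. This is the
  independence that measure preservation and the involution property rest on.\<close>

lemma pcoef_cong:
  assumes "v \<in> pvars n" "\<And>w. w \<in> Svars n \<Longrightarrow> x w = y w"
  shows "pcoef n v x = pcoef n v y"
proof -
  have "ratio x i j = ratio y i j" if "1 \<le> i" "i \<le> j" "j \<le> n" for i j
    using that assms(2)[of "Sv i j"] by (auto simp: ratio_def Svars_def)
  then show ?thesis
    using assms(1) unfolding pvars_def pcoef_def
    by (auto intro!: arg_cong2[of _ _ _ _ "(*)"] prod.cong)
qed

lemma mpres_Tflip: "mpres (logPi (pvars n)) (Tflip n)"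
  unfolding Tflip_def
proof (rule mpres_scale_coords[OF finite_pvars])
  fix v and x y :: "pvar \<Rightarrow> real"
  assume v: "v \<in> pvars n - Svars n" and "\<And>w. w \<in> pvars n - (pvars n - Svars n) \<Longrightarrow> x w = y w"
  then show "pcoef n v x = pcoef n v y"
    using Svars_subset by (intro pcoef_cong) auto
qed (auto intro: pcoef_measurable pcoef_pos)

lemma mpres_pmap: "mpres (logPi (pvars n)) (pmap n)"
  unfolding pmap_def by (intro mpres_comp mpres_Ssplit mpres_Sjoin mpres_Tflip)

lemma pmap_space: "x \<in> space (logPi (pvars n)) \<Longrightarrow> pmap n x \<in> space (logPi (pvars n))"
  using mpres_pmap by (auto simp: mpres_def dest: measurable_space)

lemma Ssplit_Sv: "Sv i j \<in> Svars n \<Longrightarrow> Ssplit n x (Sv i j) = x (Sv i j) / x (Tv i j)"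
  by (simp add: Ssplit_def scale_coords_def scale1_def)

lemma pmap_other: "v \<in> pvars n - Svars n \<Longrightarrow> pmap n x v = pcoef n v (Ssplit n x) / x v"
  by (auto simp: pmap_def Sjoin_def Tflip_def Ssplit_def scale_coords_def scale1_def)

lemma pmap_Sv: "Sv i j \<in> Svars n \<Longrightarrow> pmap n x (Sv i j) = pmap n x (Tv i j) * (x (Sv i j) / x (Tv i j))"
  using Tv_pvars[of i j n]
  by (auto simp: pmap_def Sjoin_def Tflip_def Ssplit_def scale_coords_def scale1_def Svars_def)

text \<open>The ratios s/t are unchanged by the map, hence so are the coefficients, and for a fixed
  coefficient c the map y to c/y is its own inverse.\<close>

lemma pmap_involution:
  assumes x: "x \<in> space (logPi (pvars n))"
  shows "pmap n (pmap n x) = x"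
proof
  fix v
  have pos: "0 < x w" "0 < pmap n x w" if "w \<in> pvars n" for w
    using orthant_pos[OF x that] orthant_pos[OF pmap_space[OF x] that] by blast+
  have rho: "Ssplit n (pmap n x) w = Ssplit n x w" if w: "w \<in> Svars n" for w
  proof -
    obtain i j where ij: "w = Sv i j" using w by (auto simp: Svars_def)
    have "Tv i j \<in> pvars n" using w Tv_pvars unfolding ij by blast
    then show ?thesis using w pos[of "Tv i j"] unfolding ij by (simp add: Ssplit_Sv pmap_Sv)
  qed
  have other: "pmap n (pmap n x) w = x w" if "w \<in> pvars n - Svars n" for w
  proof -
    have "pcoef n w (Ssplit n (pmap n x)) = pcoef n w (Ssplit n x)"
      using that by (intro pcoef_cong rho) auto
    moreover have "pcoef n w (Ssplit n x) \<noteq> 0"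
      using pos(2)[of w] that by (auto simp: pmap_other)
    ultimately show ?thesis using that pos(1)[of w] by (simp add: pmap_other)
  qed
  consider "v \<in> pvars n - Svars n" | "v \<in> Svars n" | "v \<notin> pvars n" by blast
  then show "pmap n (pmap n x) v = x v"
  proof cases
    case 2
    then obtain i j where ij: "v = Sv i j" by (auto simp: Svars_def)
    have T: "Tv i j \<in> pvars n - Svars n" using 2 Tv_pvars unfolding ij by blast
    then show ?thesis using 2 pos[of "Tv i j"] unfolding ij by (simp add: pmap_Sv other)
  next
    case 3
    then show ?thesis using x pmap_space[OF pmap_space[OF x]] by (auto simp: space_logPi PiE_def extensional_def)
  qed (rule other)
qed

text \<open>Carries the formulas over from rational functions to real numbers. On the orthant every
  denominator is positive, so the expressions may be evaluated factor by factor; rewriting in the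
  ratios then gives \<open>pmap\<close>.\<close>

lemma evaluates_pform:
  assumes x: "x \<in> space (logPi (pvars n))" and v: "v \<in> pvars n"
  shows "evaluates x (pform n 1 v) (pmap n x v)"
proof -
  define t s u where "t i j = (if i = j then 1 else x (Tv i j))" and "s i j = (if i = j then 1 else x (Sv i j))"
    and "u i j = (if i = j then 1 else t i j + s i j)" for i j
  have pos: "0 < t i j" "0 < s i j" "0 < u i j" if "1 \<le> i" "i \<le> j" "j \<le> n" for i j
    using that orthant_pos[OF x, of "Tv i j"] orthant_pos[OF x, of "Sv i j"]
    by (auto simp: t_def s_def u_def pvars_def)
  have dpos: "0 < x (Dv i)" if "1 \<le> i" "i \<le> n" for i
    using that orthant_pos[OF x, of "Dv i"] by (auto simp: pvars_def)
  have et: "evaluates x (tvar i j) (t i j)" and es: "evaluates x (svar i j) (s i j)" for i j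
    by (auto simp: tvar_def t_def svar_def s_def evaluates_one evaluates_rvar)
  have eu: "evaluates x (uvar i j) (u i j)" for i j
    by (auto simp: uvar_def u_def evaluates_one intro!: evaluates_add et es)
  have ratio: "ratio (Ssplit n x) i j = s i j / t i j" if "1 \<le> i" "i \<le> j" "j \<le> n" for i j
    using that by (auto simp: ratio_def s_def t_def Ssplit_Sv Svars_def)
  have us: "u i j / s i j = (if i = j then 1 else 1 + 1 / ratio (Ssplit n x) i j)" if "1 \<le> i" "i \<le> j" "j \<le> n" for i j
    unfolding ratio[OF that] using pos[OF that] by (auto simp: u_def s_def t_def field_simps)
  define r where "r i j = u i (j - 1) / (u i j * s i (j - 1))
      * (\<Prod>k\<in>{1..<i}. t k (j - 1) / s k (j - 1)) * (\<Prod>k\<in>{1..<i}. s k j / t k j)" for i j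
  have r: "r i j = pcoef n (Tv i j) (Ssplit n x) / x (Tv i j)" if ij: "1 \<le> i" "i < j" "j \<le> n" for i j
  proof -
    have p1: "(\<Prod>k\<in>{1..<i}. t k (j - 1) / s k (j - 1)) = (\<Prod>k\<in>{1..<i}. 1 / ratio (Ssplit n x) k (j - 1))"
      by (rule prod.cong) (use ij in \<open>auto simp: ratio\<close>)
    have p2: "(\<Prod>k\<in>{1..<i}. s k j / t k j) = (\<Prod>k\<in>{1..<i}. ratio (Ssplit n x) k j)"
      by (rule prod.cong) (use ij in \<open>auto simp: ratio\<close>)
    have tx: "t i j = x (Tv i j)" using ij by (simp add: t_def)
    have uij: "u i j = x (Tv i j) * (1 + ratio (Ssplit n x) i j)"
      using ij pos[of i j] by (simp add: ratio u_def tx[symmetric] field_simps)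
    have "u i (j - 1) / (u i j * s i (j - 1)) = (u i (j - 1) / s i (j - 1)) / u i j" by simp
    also have "\<dots> = (if i = j - 1 then 1 else 1 + 1 / ratio (Ssplit n x) i (j - 1)) / u i j"
      using ij by (subst us) auto
    finally show ?thesis unfolding r_def p1 p2 uij pcoef_def by (simp add: mult_ac)
  qed
  have eq: "evaluates x (rquot i j) (u i (j - 1) / (u i j * s i (j - 1)))" if "1 \<le> i" "i < j" "j \<le> n" for i j
  proof -
    have "1 \<le> i" "i \<le> j - 1" "j - 1 \<le> n" "i \<le> j" using that by auto
    then have "u i j * s i (j - 1) \<noteq> 0" using pos(3)[of i j] pos(2)[of i "j - 1"] that by auto
    then show ?thesis unfolding rquot_def by (intro evaluates_divide evaluates_mult eu es)
  qed
  have nz: "t k l \<noteq> 0" "s k l \<noteq> 0" if "1 \<le> k" "k \<le> l" "l \<le> n" for k l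
    using pos[OF that] by auto
  have er: "evaluates x (rquot i j * (\<Prod>k\<in>{1..<i}. tvar k (j - 1) / svar k (j - 1)) * (\<Prod>k\<in>{1..<i}. svar k j / tvar k j)) (r i j)"
    if "1 \<le> i" "i < j" "j \<le> n" for i j
    unfolding r_def using that
    by (intro evaluates_mult eq evaluates_prod evaluates_divide et es nz) auto
  show ?thesis
  proof (cases v)
    case (Tv i j)
    with v have ij: "1 \<le> i" "i < j" "j \<le> n" "v \<in> pvars n - Svars n" by (auto simp: pvars_def Svars_def)
    then show ?thesis using er[OF ij(1-3)] r[OF ij(1-3)] pmap_other[OF ij(4)] Tv by (simp add: pform_def)
  next
    case (Sv i j)
    with v have ij: "1 \<le> i" "i < j" "j \<le> n" "Sv i j \<in> Svars n" by (auto simp: pvars_def Svars_def)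
    have s: "{1..i} = insert i {1..<i}" using ij by auto
    have "pform n 1 v = (rquot i j * (\<Prod>k\<in>{1..<i}. tvar k (j - 1) / svar k (j - 1)) * (\<Prod>k\<in>{1..<i}. svar k j / tvar k j))
        * (svar i j / tvar i j)"
      unfolding Sv pform_def pvar.case s by simp
    moreover have "pmap n x v = r i j * (s i j / t i j)"
      unfolding Sv pmap_Sv[OF ij(4)] pmap_other[OF Tv_pvars[OF ij(4)]] r[OF ij(1-3)] using ij by (simp add: s_def t_def)
    moreover have "evaluates x (svar i j / tvar i j) (s i j / t i j)"
      using ij nz[of i j] by (intro evaluates_divide es et) auto
    ultimately show ?thesis using er[OF ij(1-3)] by (simp only: evaluates_mult)
  next
    case (Dv i)
    with v have i: "1 \<le> i" "i \<le> n" "v \<in> pvars n - Svars n" by (auto simp: pvars_def Svars_def)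
    have "evaluates x (pform n 1 v) (u i n / (x (Dv i) * s i n) * (\<Prod>k\<in>{1..<i}. t k n / s k n))"
      unfolding Dv pform_def pvar.case using i dpos[of i] nz[of i n]
      by (intro evaluates_mult evaluates_divide evaluates_prod eu es et evaluates_rvar nz) auto
    moreover have "u i n / (x (Dv i) * s i n) * (\<Prod>k\<in>{1..<i}. t k n / s k n) = pmap n x v"
    proof -
      have "(\<Prod>k\<in>{1..<i}. t k n / s k n) = (\<Prod>k\<in>{1..<i}. 1 / ratio (Ssplit n x) k n)"
        by (rule prod.cong) (use i in \<open>auto simp: ratio\<close>)
      moreover have "u i n / (x (Dv i) * s i n) = (u i n / s i n) / x (Dv i)" by simp
      ultimately show ?thesis
        unfolding pmap_other[OF i(3)] unfolding Dv pcoef_def pvar.case using us[of i n] i by simp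
    qed
    ultimately show ?thesis by simp
  qed
qed

theorem theorem5p1:
  fixes n :: nat
  assumes "n \<ge> 1"
  shows "(\<exists>Y T p. is_factorization n Y T p) \<and>
    (\<forall>Y T p. is_factorization n Y T p \<longrightarrow>
      (\<forall>i j. 1 \<le> i \<and> i < j \<and> j \<le> n \<longrightarrow>
          p (Tv i j) = rquot i j * (\<Prod>k\<in>{1..<i}. tvar k (j - 1) / svar k (j - 1))
                                 * (\<Prod>k\<in>{1..<i}. svar k j / tvar k j)
        \<and> p (Sv i j) = rquot i j * (\<Prod>k\<in>{1..<i}. tvar k (j - 1) / svar k (j - 1))
                                 * (\<Prod>k\<in>{1..i}. svar k j / tvar k j))
      \<and> (\<forall>i. 1 \<le> i \<and> i \<le> n \<longrightarrow>
          p (Dv i) = uvar i n / (dvar i * svar i n) * (\<Prod>k\<in>{1..<i}. tvar k n / svar k n))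
      \<and> T = munit n (n + 1) (n + 1)
            + msum n (map (\<lambda>k. Tcoeff n k \<cdot>\<^sub>m munit n k k
                              + inverse (Tcoeff n k) \<cdot>\<^sub>m munit n (hat n k) (hat n k)) [1..<n+1])
      \<and> (\<forall>v\<in>pvars n. \<forall>x\<in>space (orthant_measure n). regular_at x (p v))
      \<and> bij_betw (rat_map n p) (space (orthant_measure n)) (space (orthant_measure n))
      \<and> rat_map n p \<in> measurable (orthant_measure n) (orthant_measure n)
      \<and> distr (orthant_measure n) (orthant_measure n) (rat_map n p) = orthant_measure n)"
proof (intro conjI allI impI ballI)
  show "\<exists>Y T p. is_factorization n Y T p"
    using is_factorization_pform by blast
next
  fix Y T p assume F: "is_factorization n Y T p"
  note T = factorization_iff(1)[OF assms F] and p = factorization_iff(2)[OF assms F]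
  show "T = munit n (n + 1) (n + 1)
            + msum n (map (\<lambda>k. Tcoeff n k \<cdot>\<^sub>m munit n k k
                              + inverse (Tcoeff n k) \<cdot>\<^sub>m munit n (hat n k) (hat n k)) [1..<n+1])"
    unfolding T by (rule Tdiag_matrix[symmetric])
  {
    fix i j assume ij: "1 \<le> i \<and> i < j \<and> j \<le> n"
    then have "Tv i j \<in> pvars n" "Sv i j \<in> pvars n" by (auto simp: pvars_def)
    then show "p (Tv i j) = rquot i j * (\<Prod>k\<in>{1..<i}. tvar k (j - 1) / svar k (j - 1))
                                 * (\<Prod>k\<in>{1..<i}. svar k j / tvar k j)"
      "p (Sv i j) = rquot i j * (\<Prod>k\<in>{1..<i}. tvar k (j - 1) / svar k (j - 1))
                                 * (\<Prod>k\<in>{1..i}. svar k j / tvar k j)"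
      by (simp_all add: p pform_def)
  }
  show "p (Dv i) = uvar i n / (dvar i * svar i n) * (\<Prod>k\<in>{1..<i}. tvar k n / svar k n)"
    if "1 \<le> i \<and> i \<le> n" for i
  proof -
    have "Dv i \<in> pvars n" using that by (auto simp: pvars_def)
    then show ?thesis by (simp add: p pform_def)
  qed
  \<comment> \<open>From here on the claims about \<open>p\<close> become claims about the explicit
    map \<open>pmap\<close>.\<close>
  have ev: "evaluates x (p v) (pmap n x v)" if "x \<in> space (orthant_measure n)" "v \<in> pvars n" for x v
    using evaluates_pform[of x n v] that p by (simp add: orthant_measure_def)
  show "regular_at x (p v)" if "v \<in> pvars n" "x \<in> space (orthant_measure n)" for v x
    using ev[OF that(2,1)] by (rule evaluates_regular_at)
  \<comment> \<open>Equality has to hold at every name: outside \<open>pvars n\<close> both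
    functions take the default value of extensional functions.\<close>
  have eq: "rat_map n p x = pmap n x" if x: "x \<in> space (orthant_measure n)" for x
  proof
    fix v
    show "rat_map n p x v = pmap n x v"
    proof (cases "v \<in> pvars n")
      case True
      then show ?thesis using evaluates_rat_eval[OF ev[OF x True]] by (simp add: rat_map_def)
    next
      case False
      then show ?thesis using pmap_space[of x n] x
        by (auto simp: rat_map_def orthant_measure_def space_logPi PiE_def extensional_def)
    qed
  qed
  show "bij_betw (rat_map n p) (space (orthant_measure n)) (space (orthant_measure n))"
    by (rule bij_betw_byWitness[of _ "pmap n"])
       (use eq pmap_space[of _ n] pmap_involution[of _ n] in \<open>auto simp: orthant_measure_def\<close>)
  have "mpres (orthant_measure n) (rat_map n p)"
    by (rule mpres_cong[OF eq]) (use mpres_pmap[of n] in \<open>auto simp: orthant_measure_def\<close>)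
  then show "rat_map n p \<in> measurable (orthant_measure n) (orthant_measure n)"
    "distr (orthant_measure n) (orthant_measure n) (rat_map n p) = orthant_measure n"
    by (auto simp: mpres_def)
qed

end
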